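(* Let $d\ge 2$ be an integer and let $(G_n)_{n\ge 1}$ be a sequence of graphings of maximum degree at most $d$. Then $(G_n)$ is local-global convergent if and only if, for every integer $k\ge 1$, the closed sets $\mathcal S_k(G_n)\subseteq\mathcal P(\mathsf S_{d,k})$ of $k$-colored star statistics converge in Hausdorff distance as $n\to\infty$.
   Context: All graphs and graphings are simple, undirected and loopless; $[k]=\{1,\dots,k\}$, $\mathbb N=\{0,1,2,\dots\}$. Graphing: $G=(X,\nu,E)$ where $X$ is a Polish space, $\nu$ is a Borel probability measure on $X$, and $(X,E)$ is a Borel graph in which every vertex has degree at most $d$, such that $\int_A e(x,B)\,d\nu(x)=\int_B e(x,A)\,d\nu(x)$ for all measurable $A,B\subseteq X$, where $e(x,S)$ is the number of neighbours of $x$ lying in $S$. A $k$-coloring of $G$ is a measurable map $f\colon X\to[k]$. $N_G(x)$ denotes the set of neighbours of $x$. For a finite set $\Omega$, $\mathcal P(\Omega)$ is the simplex of probability measures on $\Omega$ with the total variation metric $d_{\mathrm{TV}}(\mu,\mu')=\frac12\sum_{\alpha\in\Omega}|\mu(\alpha)-\mu'(\alpha)|$. Hausdorff distance of subsets of $\mathcal P(\Omega)$ is taken with respect to $d_{\mathrm{TV}}$. A sequence of nonempty closed subsets converges in Hausdorff distance if it converges to some nonempty closed subset. Local-global convergence: for $k\ge1$, $r\ge0$ let $\mathcal G_{d,k,r}$ be the finite set of isomorphism classes of rooted $k$-colored graphs of maximum degree at most $d$ in which every vertex is at distance at most $r$ from the root. For a graphing $G$ and a $k$-coloring $f$, $\gamma_{r,G,f}(x)\in\mathcal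 G_{d,k,r}$ is the isomorphism class of the induced colored radius-$r$ ball around $x$, rooted at $x$; $\tau_r(G,f)\in\mathcal P(\mathcal G_{d,k,r})$ is the distribution of $\gamma_{r,G,f}(x)$ for $x\sim\nu$; $\mathcal Q_{k,r}(G)$ is the closure of $\{\tau_r(G,f): f\colon X\to[k]\text{ measurable}\}$ in $\mathcal P(\mathcal G_{d,k,r})$. The sequence $(G_n)$ is local-global convergent if for every $k\ge1$, $r\ge0$ the sets $\mathcal Q_{k,r}(G_n)$ converge in Hausdorff distance. Star statistics: $\mathsf S_{d,k}$ is the finite set of tuples $(i,n_1,\dots,n_k)$ with $i\in[k]$, $n_j\in\mathbb N$, $\sum_j n_j\le d$ (rooted $k$-colored stars: root color $i$, and $n_j$ leaves of color $j$). For a graphing $G$ and a measurable $f\colon X\to[k]$, $\operatorname{st}_{G,f}(x)\in\mathsf S_{d,k}$ has $i=f(x)$ and $n_j=|\{y\in N_G(x): f(y)=j\}|$; $\sigma(G,f)$ is the distribution of $\operatorname{st}_{G,f}(x)$ for $x\sim\nu$; and $\mathcal S_k(G)$ is the closure of $\{\sigma(G,f): f\colon X\to[k]\text{ measurable}\}$ in $\mathcal P(\mathsf S_{d,k})$. *)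

theory Defs
  imports "HOL-Probability.Probability"
begin

section \<open>Graphings and colorings\<close>

definition polish_topology :: "'a topology \<Rightarrow> bool" where
  "polish_topology T \<longleftrightarrow> completely_metrizable_space T \<and> separable_space T"

definition borel_algebra :: "'a topology \<Rightarrow> 'a measure" where
  "borel_algebra T = sigma (topspace T) {U. openin T U}"

text \<open>The vertex space is the carrier \<open>topspace (gtop G)\<close> of an abstract topology rather than a
  type, so that the members of a sequence of graphings can live on different Polish spaces.
  The edge set consists of ordered pairs, both orientations of an edge being present.\<close>

record 'a graphing =
  gtop :: "'a topology"
  gmeas :: "'a measure"
  gedges :: "('a \<times> 'a) set"

definition nbrs :: "'a graphing \<Rightarrow> 'a \<Rightarrow> 'a set" where
  "nbrs G x = {y. (x, y) \<in> gedges G}"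

definition edge_count :: "'a graphing \<Rightarrow> 'a \<Rightarrow> 'a set \<Rightarrow> nat" where
  "edge_count G x S = card (nbrs G x \<inter> S)"

definition is_graphing :: "nat \<Rightarrow> 'a graphing \<Rightarrow> bool" where
  "is_graphing d G \<longleftrightarrow>
     polish_topology (gtop G) \<and>
     prob_space (gmeas G) \<and> sets (gmeas G) = sets (borel_algebra (gtop G)) \<and>
     gedges G \<subseteq> topspace (gtop G) \<times> topspace (gtop G) \<and>
     gedges G \<in> sets (borel_algebra (prod_topology (gtop G) (gtop G))) \<and>
     sym (gedges G) \<and> irrefl (gedges G) \<and>
     (\<forall>x \<in> topspace (gtop G). finite (nbrs G x) \<and> card (nbrs G x) \<le> d) \<and>
     (\<forall>A \<in> sets (gmeas G). \<forall>B \<in> sets (gmeas G).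
        (LINT x:A|gmeas G. real (edge_count G x B)) = (LINT x:B|gmeas G. real (edge_count G x A)))"

definition colorings :: "nat \<Rightarrow> 'a graphing \<Rightarrow> ('a \<Rightarrow> nat) set" where
  "colorings k G = measurable (gmeas G) (count_space {1..k})"


section \<open>Probability measures on a finite set\<close>

definition prob_simplex :: "'b set \<Rightarrow> 'b measure set" where
  "prob_simplex \<Omega> = {\<mu>. prob_space \<mu> \<and> sets \<mu> = Pow \<Omega>}"

definition dTV :: "'b set \<Rightarrow> 'b measure \<Rightarrow> 'b measure \<Rightarrow> real" where
  "dTV \<Omega> \<mu> \<mu>' = (\<Sum>\<alpha>\<in>\<Omega>. \<bar>measure \<mu> {\<alpha>} - measure \<mu>' {\<alpha>}\<bar>) / 2"

lemma Metric_space_prob_simplex: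
  assumes fin: "finite \<Omega>"
  shows "Metric_space (prob_simplex \<Omega>) (dTV \<Omega>)"
proof
  show "0 \<le> dTV \<Omega> \<mu> \<mu>'" for \<mu> \<mu>'
    by (simp add: dTV_def sum_nonneg)
  show "dTV \<Omega> \<mu> \<mu>' = dTV \<Omega> \<mu>' \<mu>" for \<mu> \<mu>'
    by (simp add: dTV_def abs_minus_commute)
  show "dTV \<Omega> \<mu>1 \<mu>3 \<le> dTV \<Omega> \<mu>1 \<mu>2 + dTV \<Omega> \<mu>2 \<mu>3" for \<mu>1 \<mu>2 \<mu>3
    unfolding dTV_def add_divide_distrib[symmetric] sum.distrib[symmetric]
    by (intro divide_right_mono sum_mono) auto
  fix \<mu> \<mu>' assume mem: "\<mu> \<in> prob_simplex \<Omega>" "\<mu>' \<in> prob_simplex \<Omega>"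
  then interpret m: prob_space \<mu> + m': prob_space \<mu>' by (auto simp: prob_simplex_def)
  have sets: "sets \<mu> = Pow \<Omega>" "sets \<mu>' = Pow \<Omega>" using mem by (auto simp: prob_simplex_def)
  show "(dTV \<Omega> \<mu> \<mu>' = 0) = (\<mu> = \<mu>')"
  proof
    assume "dTV \<Omega> \<mu> \<mu>' = 0"
    then have "\<forall>\<alpha>\<in>\<Omega>. \<bar>measure \<mu> {\<alpha>} - measure \<mu>' {\<alpha>}\<bar> = 0"
      using fin by (simp add: dTV_def sum_nonneg_eq_0_iff)
    then show "\<mu> = \<mu>'"
      using fin by (intro measure_eqI_finite[OF sets])
        (auto simp: m.emeasure_eq_measure m'.emeasure_eq_measure)
  qed (simp add: dTV_def)
qed

abbreviation tv_topology :: "'b set \<Rightarrow> 'b measure topology" where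
  "tv_topology \<Omega> \<equiv> Metric_space.mtopology (prob_simplex \<Omega>) (dTV \<Omega>)"

text \<open>Only used for nonempty sets \<open>A\<close>, \<open>B\<close>; all suprema and infima are then over nonempty
  bounded sets of reals.\<close>

definition hausdorff_dist :: "'b set \<Rightarrow> 'b measure set \<Rightarrow> 'b measure set \<Rightarrow> real" where
  "hausdorff_dist \<Omega> A B =
     max (SUP \<mu>\<in>A. INF \<mu>'\<in>B. dTV \<Omega> \<mu> \<mu>') (SUP \<mu>'\<in>B. INF \<mu>\<in>A. dTV \<Omega> \<mu> \<mu>')"

definition hausdorff_convergent :: "'b set \<Rightarrow> (nat \<Rightarrow> 'b measure set) \<Rightarrow> bool" where
  "hausdorff_convergent \<Omega> Q \<longleftrightarrow>
     (\<exists>C. C \<noteq> {} \<and> closedin (tv_topology \<Omega>) C \<and> (\<lambda>n. hausdorff_dist \<Omega> (Q n) C) \<longlonglongrightarrow> 0)"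


section \<open>Rooted colored graphs and local-global convergence\<close>

record 'v rcgraph =
  verts :: "'v set"
  edges :: "('v \<times> 'v) set"
  root :: 'v
  col :: "'v \<Rightarrow> nat"

definition is_rcgraph :: "nat \<Rightarrow> 'v rcgraph \<Rightarrow> bool" where
  "is_rcgraph k g \<longleftrightarrow>
     root g \<in> verts g \<and> edges g \<subseteq> verts g \<times> verts g \<and> sym (edges g) \<and> irrefl (edges g) \<and>
     col g \<in> verts g \<rightarrow> {1..k}"

definition rc_iso :: "'v rcgraph \<Rightarrow> 'w rcgraph \<Rightarrow> bool" where
  "rc_iso g h \<longleftrightarrow>
     (\<exists>\<phi>. bij_betw \<phi> (verts g) (verts h) \<and> \<phi> (root g) = root h \<and>
        (\<forall>u\<in>verts g. \<forall>v\<in>verts g. (u, v) \<in> edges g \<longleftrightarrow> (\<phi> u, \<phi> v) \<in> edges h) \<and>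
        (\<forall>v\<in>verts g. col h (\<phi> v) = col g v))"

text \<open>The isomorphism class of \<open>g\<close> is represented by its members with vertices in \<open>nat\<close>, which
  makes classes of graphs with different vertex types comparable. All graphs considered here are
  finite, so every class has such members.\<close>

definition iso_class :: "nat \<Rightarrow> 'v rcgraph \<Rightarrow> nat rcgraph set" where
  "iso_class k g = {h. is_rcgraph k h \<and> rc_iso g h}"

text \<open>The vertices at distance at most \<open>r\<close> from \<open>x\<close>, i.e. reachable by a walk of length \<open>\<le> r\<close>.\<close>

definition ball_verts :: "('v \<times> 'v) set \<Rightarrow> nat \<Rightarrow> 'v \<Rightarrow> 'v set" where
  "ball_verts E r x = {y. \<exists>m\<le>r. (x, y) \<in> E ^^ m}"

definition ball_classes :: "nat \<Rightarrow> nat \<Rightarrow> nat \<Rightarrow> nat rcgraph set set" where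
  "ball_classes d k r =
     {iso_class k g | g :: nat rcgraph.
        is_rcgraph k g \<and>
        (\<forall>v\<in>verts g. finite (edges g `` {v}) \<and> card (edges g `` {v}) \<le> d) \<and>
        verts g \<subseteq> ball_verts (edges g) r (root g)}"

definition colored_ball :: "nat \<Rightarrow> 'a graphing \<Rightarrow> ('a \<Rightarrow> nat) \<Rightarrow> 'a \<Rightarrow> 'a rcgraph" where
  "colored_ball r G f x =
     (let B = ball_verts (gedges G) r x
      in \<lparr>verts = B, edges = gedges G \<inter> B \<times> B, root = x, col = f\<rparr>)"

definition ball_type :: "nat \<Rightarrow> nat \<Rightarrow> 'a graphing \<Rightarrow> ('a \<Rightarrow> nat) \<Rightarrow> 'a \<Rightarrow> nat rcgraph set" where
  "ball_type k r G f x = iso_class k (colored_ball r G f x)"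

definition ball_stat ::
    "nat \<Rightarrow> nat \<Rightarrow> nat \<Rightarrow> 'a graphing \<Rightarrow> ('a \<Rightarrow> nat) \<Rightarrow> nat rcgraph set measure" where
  "ball_stat d k r G f = distr (gmeas G) (count_space (ball_classes d k r)) (ball_type k r G f)"

definition ball_stats :: "nat \<Rightarrow> nat \<Rightarrow> nat \<Rightarrow> 'a graphing \<Rightarrow> nat rcgraph set measure set" where
  "ball_stats d k r G =
     tv_topology (ball_classes d k r) closure_of (ball_stat d k r G ` colorings k G)"

definition local_global_convergent :: "nat \<Rightarrow> (nat \<Rightarrow> 'a graphing) \<Rightarrow> bool" where
  "local_global_convergent d G \<longleftrightarrow>
     (\<forall>k\<ge>1. \<forall>r. hausdorff_convergent (ball_classes d k r) (\<lambda>n. ball_stats d k r (G n)))"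


section \<open>Star statistics\<close>

text \<open>A star \<open>(i, n\<^sub>1, \<dots>, n\<^sub>k)\<close> is encoded as a pair of \<open>i\<close> and an extensional
  function on \<open>{1..k}\<close>.\<close>

definition stars :: "nat \<Rightarrow> nat \<Rightarrow> (nat \<times> (nat \<Rightarrow> nat)) set" where
  "stars d k = {(i, n). i \<in> {1..k} \<and> n \<in> extensional {1..k} \<and> (\<Sum>j=1..k. n j) \<le> d}"

definition star_type :: "nat \<Rightarrow> 'a graphing \<Rightarrow> ('a \<Rightarrow> nat) \<Rightarrow> 'a \<Rightarrow> nat \<times> (nat \<Rightarrow> nat)" where
  "star_type k G f x = (f x, \<lambda>j\<in>{1..k}. card {y \<in> nbrs G x. f y = j})"

definition star_stat ::
    "nat \<Rightarrow> nat \<Rightarrow> 'a graphing \<Rightarrow> ('a \<Rightarrow> nat) \<Rightarrow> (nat \<times> (nat \<Rightarrow> nat)) measure" where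
  "star_stat d k G f = distr (gmeas G) (count_space (stars d k)) (star_type k G f)"

definition star_stats :: "nat \<Rightarrow> nat \<Rightarrow> 'a graphing \<Rightarrow> (nat \<times> (nat \<Rightarrow> nat)) measure set" where
  "star_stats d k G = tv_topology (stars d k) closure_of (star_stat d k G ` colorings k G)"

end

theory Submission
  imports Defs
begin

text \<open>A star statistic is a push-forward of a ball statistic of radius 1, which gives one direction.
  Conversely, label the vertices of \<open>G\<close> by \<open>(f, c)\<close> with \<open>c\<close> a Borel coloring that is injective on
  balls of radius \<open>r + 1\<close>, and color each vertex by the set of label words read along the short walks
  leaving it. If a coloring of \<open>H\<close> has nearly the same star statistics, then at most vertices the
  claimed set of words agrees with the claims of the neighbours; by mass transport this holds on whole
  balls around most vertices, and there the claims are true. This determines the balls of \<open>H\<close> only up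
  to coverings. A covering, however, can only increase the expected size of a ball, and since colorings
  can be copied from \<open>H\<close> to \<open>G\<close> as well, the expected sizes nearly agree. Hence the copied labels are
  injective on most balls, and an injectively labelled ball is determined by its label words.

  All this needs the neighbourhood of a Borel set to be Borel, which is the bounded case of the
  Lusin--Novikov theorem.\<close>


section \<open>Analytic sets\<close>

text \<open>A star sees a single step, so only data that can be checked step by step survive
  copying. Sets of label words are of this kind: a word read at \<open>x\<close> is the label of
  \<open>x\<close>, alone or followed by a word read at a neighbour. The closing of cycles is not
  visible in this way, and a global count has to recover it.

  The radius \<open>r + 1\<close> comes from edges joining two vertices at distance \<open>r\<close>
  from the root: a walk from the root needs \<open>r + 1\<close> steps to traverse them, and reading
  them off correctly requires labels that are distinct on the larger ball.

  The labels form a set of \<open>k * ((d + 1) ^ (2 * r + 2) + 1)\<close> elements, so the number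
  \<open>K\<close> of possible word sets depends on \<open>d\<close>, \<open>k\<close> and
  \<open>r\<close> only. Hence the star statistics with \<open>K\<close> colors control the
  \<open>r\<close>-balls of all members of the sequence with one error constant, and Hausdorff
  convergence can be treated as a Cauchy condition on pairs of members.

  The set-theoretic part is there because an edge set is merely Borel in the product: a
  neighbourhood of a Borel set is a projection, in general only analytic, and it is the degree bound
  that makes it Borel.\<close>

text \<open>Closed subsets of Baire space and continuous maps on them are spelled out in terms of initial
  segments, so that the fusion argument in Lusin separation needs no topology on sequences.\<close>

definition agree :: "nat \<Rightarrow> (nat \<Rightarrow> nat) \<Rightarrow> (nat \<Rightarrow> nat) \<Rightarrow> bool" where
  "agree n s t \<longleftrightarrow> (\<forall>i<n. s i = t i)"

definition baire_closed :: "(nat \<Rightarrow> nat) set \<Rightarrow> bool" where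
  "baire_closed L \<longleftrightarrow> (\<forall>s. (\<forall>n. \<exists>t\<in>L. agree n s t) \<longrightarrow> s \<in> L)"

definition baire_cont :: "'a topology \<Rightarrow> (nat \<Rightarrow> nat) set \<Rightarrow> ((nat \<Rightarrow> nat) \<Rightarrow> 'a) \<Rightarrow> bool" where
  "baire_cont T L f \<longleftrightarrow> f \<in> L \<rightarrow> topspace T \<and>
     (\<forall>s\<in>L. \<forall>U. openin T U \<longrightarrow> f s \<in> U \<longrightarrow> (\<exists>n. \<forall>t\<in>L. agree n s t \<longrightarrow> f t \<in> U))"

text \<open>Allowing any closed \<open>L\<close> instead of all of Baire space makes intersections
  easy, since they only cut down the domain, and admits the empty set.\<close>

definition analytic_in :: "'a topology \<Rightarrow> 'a set \<Rightarrow> bool" where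
  "analytic_in T A \<longleftrightarrow> (\<exists>L f. baire_closed L \<and> baire_cont T L f \<and> A = f ` L)"

lemma agree_mono: "agree n s t \<Longrightarrow> m \<le> n \<Longrightarrow> agree m s t"
  by (auto simp: agree_def)

lemma agree_refl [simp]: "agree n s s"
  by (auto simp: agree_def)

lemma baire_contD:
  assumes "baire_cont T L f" "s \<in> L" "openin T U" "f s \<in> U"
  shows "\<exists>n. \<forall>t\<in>L. agree n s t \<longrightarrow> f t \<in> U"
  using assms unfolding baire_cont_def by blast

lemma baire_cont_subset:
  assumes "baire_cont T L f" "L' \<subseteq> L"
  shows "baire_cont T L' f"
  unfolding baire_cont_def
proof (intro conjI ballI allI impI)
  show "f \<in> L' \<rightarrow> topspace T" using assms by (auto simp: baire_cont_def)
  fix s U assume "s \<in> L'" "openin T U" "f s \<in> U"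
  with baire_contD[OF assms(1), of s U] assms(2)
  obtain n where "\<forall>t\<in>L. agree n s t \<longrightarrow> f t \<in> U" by blast
  with assms(2) show "\<exists>n. \<forall>t\<in>L'. agree n s t \<longrightarrow> f t \<in> U" by blast
qed

lemma Hausdorff_spaceD:
  assumes "Hausdorff_space T" "x \<in> topspace T" "y \<in> topspace T" "x \<noteq> y"
  shows "\<exists>U V. openin T U \<and> openin T V \<and> x \<in> U \<and> y \<in> V \<and> disjnt U V"
  using assms unfolding Hausdorff_space_def by blast

lemma analytic_in_image:
  assumes "analytic_in T A" "continuous_map T T' h"
  shows "analytic_in T' (h ` A)"
proof -
  obtain L f where L: "baire_closed L" "baire_cont T L f" "A = f ` L"
    using assms(1) by (auto simp: analytic_in_def)
  have "baire_cont T' L (h \<circ> f)"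
    unfolding baire_cont_def
  proof (intro conjI ballI allI impI)
    show "h \<circ> f \<in> L \<rightarrow> topspace T'"
      using L(2) assms(2) by (auto simp: baire_cont_def continuous_map_def)
    fix s U assume s: "s \<in> L" and U: "openin T' U" "(h \<circ> f) s \<in> U"
    let ?V = "{x \<in> topspace T. h x \<in> U}"
    have V: "openin T ?V" using assms(2) U(1) by (simp add: continuous_map_def)
    have fL: "f \<in> L \<rightarrow> topspace T" using L(2) by (simp add: baire_cont_def)
    have "f s \<in> ?V" using U(2) fL s by auto
    with baire_contD[of T L f s ?V] L(2) s V show "\<exists>n. \<forall>t\<in>L. agree n s t \<longrightarrow> (h \<circ> f) t \<in> U"
      by auto
  qed
  then show ?thesis
    unfolding analytic_in_def using L by (intro exI[of _ L] exI[of _ "h \<circ> f"]) auto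
qed

lemma analytic_in_Int_closed:
  assumes "analytic_in T A" "closedin T C"
  shows "analytic_in T (A \<inter> C)"
proof -
  obtain L f where L: "baire_closed L" "baire_cont T L f" "A = f ` L"
    using assms(1) by (auto simp: analytic_in_def)
  define L' where "L' = {s \<in> L. f s \<in> C}"
  have fL: "f \<in> L \<rightarrow> topspace T" using L(2) by (simp add: baire_cont_def)
  have "baire_closed L'"
    unfolding baire_closed_def
  proof (intro allI impI)
    fix s assume s: "\<forall>n. \<exists>t\<in>L'. agree n s t"
    then have sL: "s \<in> L" using L(1) unfolding baire_closed_def L'_def by blast
    show "s \<in> L'"
    proof (rule ccontr)
      assume "s \<notin> L'"
      then have "f s \<in> topspace T - C" using sL fL by (auto simp: L'_def)
      moreover have "openin T (topspace T - C)" using assms(2) by blast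
      ultimately obtain n where n: "\<forall>t\<in>L. agree n s t \<longrightarrow> f t \<in> topspace T - C"
        using baire_contD[OF L(2) sL] by metis
      obtain t where "t \<in> L'" "agree n s t" using s by auto
      then show False using n by (auto simp: L'_def)
    qed
  qed
  moreover have "baire_cont T L' f"
    by (rule baire_cont_subset[OF L(2)]) (auto simp: L'_def)
  ultimately show ?thesis
    unfolding analytic_in_def using L(3)
    by (intro exI[of _ L'] exI[of _ f]) (auto simp: L'_def)
qed

lemma analytic_in_empty: "analytic_in T {}"
  unfolding analytic_in_def
  by (intro exI[of _ "{}"] exI[of _ undefined]) (auto simp: baire_closed_def baire_cont_def)

text \<open>The first entry of a sequence chooses the set, and the remaining entries are a parameter
  for the point in it.\<close>

lemma analytic_in_UN:
  assumes "\<And>n::nat. analytic_in T (A n)"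
  shows "analytic_in T (\<Union>n. A n)"
proof -
  obtain L f where L: "\<And>n. baire_closed (L n)" "\<And>n. baire_cont T (L n) (f n)" "\<And>n. A n = f n ` L n"
    using assms unfolding analytic_in_def by metis
  define sh where "sh s = (\<lambda>i. s (Suc i))" for s :: "nat \<Rightarrow> nat"
  define L' where "L' = {s. sh s \<in> L (s 0)}"
  define f' where "f' s = f (s 0) (sh s)" for s
  have ag: "agree (Suc n) s t \<longleftrightarrow> s 0 = t 0 \<and> agree n (sh s) (sh t)" for n s t
    by (auto simp: agree_def sh_def less_Suc_eq_0_disj)
  have "baire_closed L'"
    unfolding baire_closed_def
  proof (intro allI impI)
    fix s assume s: "\<forall>n. \<exists>t\<in>L'. agree n s t"
    have "\<exists>t\<in>L (s 0). agree n (sh s) t" for n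
      using s[rule_format, of "Suc n"] by (auto simp: ag L'_def)
    then show "s \<in> L'" using L(1)[of "s 0"] unfolding baire_closed_def L'_def by simp
  qed
  moreover have "baire_cont T L' f'"
    unfolding baire_cont_def
  proof (intro conjI ballI allI impI)
    show "f' \<in> L' \<rightarrow> topspace T" using L(2) by (auto simp: baire_cont_def L'_def f'_def Pi_iff)
    fix s U assume "s \<in> L'" "openin T U" "f' s \<in> U"
    then obtain n where n: "\<forall>t\<in>L (s 0). agree n (sh s) t \<longrightarrow> f (s 0) t \<in> U"
      using baire_contD[OF L(2)[of "s 0"], of "sh s" U] by (auto simp: L'_def f'_def)
    show "\<exists>n. \<forall>t\<in>L'. agree n s t \<longrightarrow> f' t \<in> U"
    proof (intro exI[of _ "Suc n"] ballI impI)
      fix t assume "t \<in> L'" "agree (Suc n) s t"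
      then show "f' t \<in> U" using n by (auto simp: ag L'_def f'_def)
    qed
  qed
  moreover have "(\<Union>n. A n) = f' ` L'"
  proof safe
    fix x n assume "x \<in> A n"
    then obtain s where s: "s \<in> L n" "x = f n s" using L(3) by auto
    have "sh (case_nat n s) = s" by (auto simp: sh_def)
    then show "x \<in> f' ` L'" using s by (intro image_eqI[of _ _ "case_nat n s"]) (auto simp: f'_def L'_def)
  next
    fix s assume "s \<in> L'"
    then show "f' s \<in> (\<Union>n. A n)" using L(3) by (auto simp: f'_def L'_def)
  qed
  ultimately show ?thesis unfolding analytic_in_def by blast
qed

text \<open>One sequence codes countably many, its rows. Requiring all rows to have the same image
  cuts out a closed set, because two different images would have disjoint neighbourhoods; the common
  image then parametrizes the intersection.\<close>

lemma analytic_in_INT: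
  assumes "\<And>n::nat. analytic_in T (A n)" and T: "Hausdorff_space T"
  shows "analytic_in T (\<Inter>n. A n)"
proof -
  obtain L f where L: "\<And>n. baire_closed (L n)" "\<And>n. baire_cont T (L n) (f n)" "\<And>n. A n = f n ` L n"
    using assms(1) unfolding analytic_in_def by metis
  define row where "row n s = (\<lambda>m. s (prod_encode (n, m)))" for n and s :: "nat \<Rightarrow> nat"
  define L' where "L' = {s. \<forall>n. row n s \<in> L n \<and> f n (row n s) = f 0 (row 0 s)}"
  define f' where "f' s = f 0 (row 0 s)" for s
  \<comment> \<open>\<open>ra n k\<close> is an initial length that covers the first
    \<open>k\<close> entries of row \<open>n\<close>: each position
    \<open>prod_encode (n, i)\<close> is at most the sum, and \<open>agree\<close> looks strictly
    below its bound, hence the \<open>Suc\<close>.\<close>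
  define ra where "ra n k = Suc (\<Sum>i<k. prod_encode (n, i))" for n k
  have rowag: "agree k (row n s) (row n t)" if "agree (ra n k) s t" for n k s t
  proof -
    show "agree k (row n s) (row n t)" unfolding agree_def row_def
    proof (intro allI impI)
      fix i assume "i < k"
      then have "prod_encode (n, i) \<le> (\<Sum>i<k. prod_encode (n, i))"
        using member_le_sum[of i "{..<k}" "\<lambda>i. prod_encode (n, i)"] by simp
      then show "s (prod_encode (n, i)) = t (prod_encode (n, i))"
        using that by (auto simp: agree_def ra_def)
    qed
  qed
  have fL: "f n s \<in> topspace T" if "s \<in> L n" for n s
    using L(2)[of n] that by (auto simp: baire_cont_def)
  have "baire_closed L'"
    unfolding baire_closed_def
  proof (intro allI impI)
    fix s assume s: "\<forall>n. \<exists>t\<in>L'. agree n s t"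
    have rL: "row n s \<in> L n" for n
    proof -
      have "\<exists>t\<in>L n. agree k (row n s) t" for k
        using rowag[of n k s] s[rule_format, of "ra n k"] unfolding L'_def by blast
      then show ?thesis using L(1)[of n] unfolding baire_closed_def by blast
    qed
    have "f n (row n s) = f 0 (row 0 s)" for n
    proof (rule ccontr)
      assume "f n (row n s) \<noteq> f 0 (row 0 s)"
      then obtain U V where UV: "openin T U" "openin T V" "f n (row n s) \<in> U" "f 0 (row 0 s) \<in> V" "disjnt U V"
        using Hausdorff_spaceD[OF T fL[OF rL] fL[OF rL]] by metis
      obtain a where a: "\<forall>t\<in>L n. agree a (row n s) t \<longrightarrow> f n t \<in> U"
        using baire_contD[of T "L n" "f n" "row n s" U] L(2) rL UV by blast
      obtain b where b: "\<forall>t\<in>L 0. agree b (row 0 s) t \<longrightarrow> f 0 t \<in> V"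
        using baire_contD[of T "L 0" "f 0" "row 0 s" V] L(2) rL UV by blast
      obtain t where t: "t \<in> L'" "agree (max (ra n a) (ra 0 b)) s t" using s by blast
      have "agree a (row n s) (row n t)" "agree b (row 0 s) (row 0 t)"
        using agree_mono[OF t(2)] by (auto intro: rowag)
      then have "f n (row n t) \<in> U" "f 0 (row 0 t) \<in> V"
        using a b t(1) by (auto simp: L'_def)
      moreover have "f n (row n t) = f 0 (row 0 t)" using t(1) by (simp add: L'_def)
      ultimately show False using UV(5) by (auto simp: disjnt_iff)
    qed
    then show "s \<in> L'" using rL by (auto simp: L'_def)
  qed
  moreover have "baire_cont T L' f'"
    unfolding baire_cont_def
  proof (intro conjI ballI allI impI)
    show "f' \<in> L' \<rightarrow> topspace T" using fL by (auto simp: L'_def f'_def)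
    fix s U assume s: "s \<in> L'" and U: "openin T U" "f' s \<in> U"
    then obtain a where a: "\<forall>t\<in>L 0. agree a (row 0 s) t \<longrightarrow> f 0 t \<in> U"
      using baire_contD[OF L(2)[of 0], of "row 0 s" U] by (auto simp: L'_def f'_def)
    show "\<exists>n. \<forall>t\<in>L'. agree n s t \<longrightarrow> f' t \<in> U"
      using a rowag[of 0 a s] unfolding L'_def f'_def by (intro exI[of _ "ra 0 a"]) auto
  qed
  moreover have "(\<Inter>n. A n) = f' ` L'"
  proof
    show "f' ` L' \<subseteq> (\<Inter>n. A n)"
    proof safe
      fix s n assume "s \<in> L'"
      then have "f n (row n s) = f' s" "row n s \<in> L n" by (simp_all add: L'_def f'_def)
      then show "f' s \<in> A n" using L(3) by (metis imageI)
    qed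
    show "(\<Inter>n. A n) \<subseteq> f' ` L'"
    proof
      fix x assume "x \<in> (\<Inter>n. A n)"
      then have "\<forall>n. \<exists>s. s \<in> L n \<and> x = f n s" using L(3) by blast
      then obtain s where s: "\<And>n. s n \<in> L n" "\<And>n. x = f n (s n)" by metis
      define t where "t k = (case prod_decode k of (n, m) \<Rightarrow> s n m)" for k
      have "row n t = s n" for n by (auto simp: row_def t_def)
      then show "x \<in> f' ` L'" using s by (intro image_eqI[of _ _ t]) (auto simp: L'_def f'_def)
    qed
  qed
  ultimately show ?thesis unfolding analytic_in_def by blast
qed

section \<open>Borel algebras, and Borel sets separating analytic sets\<close>

abbreviation "borel_sets T \<equiv> sets (borel_algebra T)"

lemma space_borel_algebra [simp]: "space (borel_algebra T) = topspace T"
  by (simp add: borel_algebra_def space_measure_of_conv)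

lemma sets_borel_algebra: "borel_sets T = sigma_sets (topspace T) {U. openin T U}"
  unfolding borel_algebra_def by (rule sets_measure_of) (auto dest: openin_subset)

lemma borel_algebra_open: "openin T U \<Longrightarrow> U \<in> borel_sets T"
  by (auto simp: sets_borel_algebra)

lemma borel_algebra_closed: "closedin T C \<Longrightarrow> C \<in> borel_sets T"
  using sets.compl_sets[OF borel_algebra_open, of T "topspace T - C"] closedin_subset[of T C]
  by (auto simp: double_diff)

lemma measurable_continuous_map:
  assumes "continuous_map S T f"
  shows "f \<in> measurable (borel_algebra S) (borel_algebra T)"
  unfolding borel_algebra_def[of T]
proof (rule measurable_measure_of)
  show "{U. openin T U} \<subseteq> Pow (topspace T)" by (auto dest: openin_subset)
  show "f \<in> space (borel_algebra S) \<rightarrow> topspace T"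
    using assms by (auto simp: continuous_map_def)
  fix U assume "U \<in> {U. openin T U}"
  then have "openin S {x \<in> topspace S. f x \<in> U}" using assms by (auto simp: continuous_map_def)
  moreover have "f -` U \<inter> space (borel_algebra S) = {x \<in> topspace S. f x \<in> U}" by auto
  ultimately show "f -` U \<inter> space (borel_algebra S) \<in> borel_sets S"
    using borel_algebra_open by metis
qed

lemma analytic_in_subset: "analytic_in T A \<Longrightarrow> A \<subseteq> topspace T"
  by (auto simp: analytic_in_def baire_cont_def)

definition borel_separated :: "'a topology \<Rightarrow> 'a set \<Rightarrow> 'a set \<Rightarrow> bool" where
  "borel_separated T A B \<longleftrightarrow> (\<exists>Z\<in>borel_sets T. A \<subseteq> Z \<and> Z \<inter> B = {})"

text \<open>To be read contrapositively: if two countable unions cannot be separated, then neither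
  can some pair of their pieces.\<close>

lemma borel_separated_UN:
  assumes "\<And>(i::nat) (j::nat). borel_separated T (A i) (B j)"
  shows "borel_separated T (\<Union>i. A i) (\<Union>j. B j)"
proof -
  obtain Z where Z: "\<And>i j. Z i j \<in> borel_sets T" "\<And>i j. A i \<subseteq> Z i j" "\<And>i j. Z i j \<inter> B j = {}"
    using assms unfolding borel_separated_def by metis
  have "(\<Union>i. \<Inter>j. Z i j) \<in> borel_sets T"
    by (intro sets.countable_UN' sets.countable_INT) (auto simp: Z(1))
  moreover have "(\<Union>i. A i) \<subseteq> (\<Union>i. \<Inter>j. Z i j)"
    by (rule UN_mono) (simp_all add: Z(2) le_INF_iff)
  moreover have "(\<Union>i. \<Inter>j. Z i j) \<inter> (\<Union>j. B j) = {}"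
  proof (rule ccontr)
    assume "(\<Union>i. \<Inter>j. Z i j) \<inter> (\<Union>j. B j) \<noteq> {}"
    then obtain x i j where "x \<in> Z i j" "x \<in> B j" by auto
    then show False using Z(3)[of i j] by auto
  qed
  ultimately show ?thesis unfolding borel_separated_def by (intro bexI[of _ "\<Union>i. \<Inter>j. Z i j"] conjI)
qed

text \<open>Fusion argument. If \<open>A\<close> and \<open>B\<close> are not separated, longer and
  longer initial segments \<open>s\<close>, \<open>t\<close> can be fixed such that the images of
  the two cylinders are still not separated. The limits lie in the closed domains and have different
  images; by continuity, disjoint open sets around these images separate two of the cylinders after
  all.\<close>

theorem lusin_separation:
  assumes A: "analytic_in T A" and B: "analytic_in T B" and T: "Hausdorff_space T" and AB: "A \<inter> B = {}"
  shows "borel_separated T A B"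
proof (rule ccontr)
  assume nsep: "\<not> borel_separated T A B"
  obtain L f where L: "baire_closed L" "baire_cont T L f" "A = f ` L"
    using A by (auto simp: analytic_in_def)
  obtain K g where K: "baire_closed K" "baire_cont T K g" "B = g ` K"
    using B by (auto simp: analytic_in_def)
  define P where "P n = (\<lambda>(s, t). \<not> borel_separated T (f ` {u\<in>L. agree n s u}) (g ` {u\<in>K. agree n t u}))" for n
  define Q where "Q n = (\<lambda>(s, t) (s', t'). agree n s s' \<and> agree n t t')"
    for n and x :: "(nat\<Rightarrow>nat)\<times>(nat\<Rightarrow>nat)" and y :: "(nat\<Rightarrow>nat)\<times>(nat\<Rightarrow>nat)"
  \<comment> \<open>Fixing entry \<open>n\<close> on both sides splits the two pieces into countably
    many; if every pair of parts were separated, so would be the pieces.\<close>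
  have step: "\<exists>y. P (Suc n) y \<and> Q n x y" if "P n x" for n x
  proof (rule ccontr)
    assume no: "\<not> (\<exists>y. P (Suc n) y \<and> Q n x y)"
    obtain s t where x: "x = (s, t)" by force
    have upd: "{u\<in>M. agree n s u} = (\<Union>i. {u\<in>M. agree (Suc n) (s(n:=i)) u})" for s and M :: "(nat \<Rightarrow> nat) set"
      by (auto simp: agree_def less_Suc_eq)
    have "borel_separated T (f ` {u\<in>L. agree (Suc n) (s(n:=i)) u}) (g ` {u\<in>K. agree (Suc n) (t(n:=j)) u})" for i j
    proof -
      have "Q n x (s(n:=i), t(n:=j))" by (simp add: x Q_def agree_def)
      then show ?thesis using no by (auto simp: P_def)
    qed
    then have "borel_separated T (\<Union>i. f ` {u\<in>L. agree (Suc n) (s(n:=i)) u}) (\<Union>j. g ` {u\<in>K. agree (Suc n) (t(n:=j)) u})"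
      by (rule borel_separated_UN)
    then show False using that x unfolding P_def by (simp add: upd[of L] upd[of K] image_UN)
  qed
  have "P 0 (\<lambda>_. 0, \<lambda>_. 0)" using nsep L K by (simp add: P_def agree_def)
  then obtain z where z: "\<And>n. P n (z n)" "\<And>n. Q n (z n) (z (Suc n))"
    using dependent_nat_choice[of P Q] step by metis
  \<comment> \<open>Stage \<open>Suc i\<close> settles entry \<open>i\<close> for good, since
    \<open>Q n\<close> preserves all entries below \<open>n\<close>.\<close>
  define s where "s i = fst (z (Suc i)) i" for i
  define t where "t i = snd (z (Suc i)) i" for i
  have zst: "agree n (fst (z n)) s \<and> agree n (snd (z n)) t" for n
  proof (induction n)
    case (Suc n)
    then show ?case using z(2)[of n] by (auto simp: Q_def agree_def s_def t_def less_Suc_eq split: prod.splits)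
  qed (auto simp: agree_def)
  have ag: "agree n (fst (z n)) u \<longleftrightarrow> agree n s u" "agree n (snd (z n)) u \<longleftrightarrow> agree n t u" for n u
    using zst[of n] by (auto simp: agree_def)
  have ns: "\<not> borel_separated T (f ` {u\<in>L. agree n s u}) (g ` {u\<in>K. agree n t u})" for n
    using z(1)[of n] by (simp add: P_def split_beta ag)
  have "\<exists>u\<in>L. agree n s u" for n
    using ns[of n] by (auto simp: borel_separated_def)
  then have sL: "s \<in> L" using L(1) by (auto simp: baire_closed_def)
  \<comment> \<open>An empty piece on this side is separated by the whole space; on the other side
    the empty set does it.\<close>
  have "\<exists>u\<in>K. agree n t u" for n
  proof (rule ccontr)
    assume "\<not> (\<exists>u\<in>K. agree n t u)"
    then have e: "{u\<in>K. agree n t u} = {}" by blast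
    have "f ` {u\<in>L. agree n s u} \<subseteq> topspace T" using analytic_in_subset[OF A] L(3) by blast
    moreover have "topspace T \<in> borel_sets T"
      by (rule borel_algebra_open) simp
    ultimately show False using ns[of n] unfolding e borel_separated_def image_empty by blast
  qed
  then have tK: "t \<in> K" using K(1) by (auto simp: baire_closed_def)
  have "f s \<noteq> g t" "f s \<in> topspace T" "g t \<in> topspace T"
    using AB L K sL tK analytic_in_subset[OF A] analytic_in_subset[OF B] by auto
  then obtain U V where UV: "openin T U" "openin T V" "f s \<in> U" "g t \<in> V" "disjnt U V"
    using T unfolding Hausdorff_space_def by meson
  obtain a where a: "\<forall>u\<in>L. agree a s u \<longrightarrow> f u \<in> U" using baire_contD[of T L f s U] L(2) sL UV by blast
  obtain b where b: "\<forall>u\<in>K. agree b t u \<longrightarrow> g u \<in> V" using baire_contD[of T K g t V] K(2) tK UV by blast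
  have "f ` {u\<in>L. agree (max a b) s u} \<subseteq> U" using a agree_mono[of "max a b" s _ a] by fastforce
  moreover have "g ` {u\<in>K. agree (max a b) t u} \<subseteq> V" using b agree_mono[of "max a b" t _ b] by fastforce
  ultimately have "borel_separated T (f ` {u\<in>L. agree (max a b) s u}) (g ` {u\<in>K. agree (max a b) t u})"
    unfolding borel_separated_def using UV(5)
    by (intro bexI[OF _ borel_algebra_open[OF UV(1)]]) (blast dest: disjnt_iff[THEN iffD1])
  then show False using ns by blast
qed

section \<open>Polish spaces: Borel sets are analytic\<close>

lemma (in Metric_space) geometric_limit:
  assumes comp: mcomplete and c: "c \<ge> 0" and u: "\<And>n. u n \<in> M" "\<And>n. d (u n) (u (Suc n)) \<le> c * (1/2)^n"
  shows "\<exists>x\<in>M. \<forall>n. d (u n) x \<le> 2 * c * (1/2)^n"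
proof -
  \<comment> \<open>Partial sum of the geometric series. The explicit rate, and not only the
    existence of a limit, is what later makes limit maps continuous or Borel.\<close>
  have fin: "d (u n) (u (n + k)) \<le> 2 * c * (1/2)^n * (1 - (1/2)^k)" for n k
  proof (induction k)
    case 0 then show ?case using u(1) by simp
  next
    case (Suc k)
    have "d (u n) (u (n + Suc k)) \<le> d (u n) (u (n + k)) + d (u (n + k)) (u (Suc (n + k)))"
      using triangle[OF u(1) u(1) u(1), of n "n + Suc k" "n + k"] by simp
    also have "\<dots> \<le> 2 * c * (1/2)^n * (1 - (1/2)^k) + c * (1/2)^(n+k)"
      using Suc u(2)[of "n + k"] by linarith
    also have "\<dots> = 2 * c * (1/2)^n * (1 - (1/2)^Suc k)"
      by (simp add: power_add algebra_simps)
    finally show ?case .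
  qed
  have fin': "d (u n) (u (n + k)) \<le> 2 * c * (1/2)^n" for n k
  proof -
    have "2 * c * (1/2)^n * (1 - (1/2)^k) \<le> 2 * c * (1/2)^n * 1"
      using c by (intro mult_left_mono) auto
    then show ?thesis using fin[of n k] by simp
  qed
  have small: "\<exists>N. \<forall>n\<ge>N. 2 * c * (1/2)^n < e" if "e > 0" for e :: real
  proof -
    have "(\<lambda>n. 2 * c * (1/2::real)^n) \<longlonglongrightarrow> 2 * c * 0"
      by (intro tendsto_intros LIMSEQ_realpow_zero) auto
    then have "eventually (\<lambda>n. 2 * c * (1/2::real)^n < e) sequentially"
      using that by (auto intro: order_tendstoD(2))
    then show ?thesis by (simp add: eventually_sequentially)
  qed
  have "MCauchy u"
    unfolding MCauchy_def
  proof (intro conjI allI impI)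
    show "range u \<subseteq> M" using u by auto
    fix e :: real assume "e > 0"
    then obtain N where N: "\<And>n. n \<ge> N \<Longrightarrow> 2 * c * (1/2)^n < e" using small by blast
    have "d (u n) (u n') < e" if "N \<le> n" "N \<le> n'" for n n'
    proof (cases "n \<le> n'")
      case True
      then show ?thesis using fin'[of n "n' - n"] N[OF that(1)] by simp
    next
      case False
      then show ?thesis using fin'[of n' "n - n'"] N[OF that(2)] by (simp add: commute)
    qed
    then show "\<exists>N. \<forall>n n'. N \<le> n \<longrightarrow> N \<le> n' \<longrightarrow> d (u n) (u n') < e" by blast
  qed
  then obtain x where x: "limitin mtopology u x sequentially"
    using comp unfolding mcomplete_def by blast
  then have xM: "x \<in> M" by (simp add: limitin_metric)
  have "d (u n) x \<le> 2 * c * (1/2)^n" for n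
  proof (rule field_le_epsilon)
    fix e :: real assume "e > 0"
    then have "\<forall>\<^sub>F k in sequentially. u k \<in> M \<and> d (u k) x < e" using x by (simp add: limitin_metric)
    then obtain N where "\<And>k. k \<ge> N \<Longrightarrow> d (u k) x < e" by (auto simp: eventually_sequentially)
    then have "d (u (n + N)) x < e" by simp
    then show "d (u n) x \<le> 2 * c * (1/2)^n + e"
      using triangle[OF u(1) u(1) xM, of n "n + N"] fin'[of n N] by linarith
  qed
  then show ?thesis using xM by blast
qed

lemma half_power_less: "e > 0 \<Longrightarrow> \<exists>n. c * (1/2::real)^n < e"
proof -
  assume "e > 0"
  have "(\<lambda>n. c * (1/2::real)^n) \<longlonglongrightarrow> c * 0"
    by (intro tendsto_intros LIMSEQ_realpow_zero) auto
  then have "eventually (\<lambda>n. c * (1/2::real)^n < e) sequentially"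
    using \<open>e > 0\<close> by (auto intro: order_tendstoD(2))
  then show ?thesis by (auto simp: eventually_sequentially)
qed

locale dense_metric = Metric_space M d for M :: "'a set" and d +
  fixes q :: "nat \<Rightarrow> 'a"
  assumes mcomplete: mcomplete and q: "q n \<in> M"
    and dense: "x \<in> M \<Longrightarrow> e > 0 \<Longrightarrow> \<exists>n. d (q n) x < e"

lemma polish_metric:
  assumes "polish_topology T" "topspace T \<noteq> {}"
  shows "\<exists>d q. dense_metric (topspace T) d q \<and> T = Metric_space.mtopology (topspace T) d"
proof -
  obtain M d where M: "Metric_space M d" "Metric_space.mcomplete M d" "T = Metric_space.mtopology M d"
    using assms(1) unfolding polish_topology_def completely_metrizable_space_def by blast
  interpret Metric_space M d by fact
  have top: "topspace T = M" using M(3) by simp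
  obtain C where C: "countable C" "C \<subseteq> M" "mtopology closure_of C = M"
    using assms(1) M(3) unfolding polish_topology_def separable_space_def by auto
  have "C \<noteq> {}" using C(3) assms(2) top by auto
  then have q: "range (from_nat_into C) = C" using C(1) by (simp add: range_from_nat_into)
  have "\<exists>n. d (from_nat_into C n) x < e" if x: "x \<in> M" "e > 0" for x and e :: real
  proof -
    have "x \<in> mtopology closure_of C" using C(3) x by simp
    then obtain y where "y \<in> C" "y \<in> mball x e"
      using x unfolding metric_closure_of by auto
    then show ?thesis using q by (metis commute in_mball rangeE)
  qed
  moreover have "from_nat_into C n \<in> M" for n using q C(2) by auto
  ultimately have "dense_metric M d (from_nat_into C)" using M(2) by unfold_locales
  then show ?thesis using M(3) top by auto
qed

text \<open>A sequence of indices is sent to the limit of the dense points that it names. Admitting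
  only geometric steps makes the domain closed, as each condition involves two entries, and makes
  the limit depend continuously on initial segments.\<close>

lemma analytic_in_topspace:
  assumes "polish_topology T"
  shows "analytic_in T (topspace T)"
proof (cases "topspace T = {}")
  case True then show ?thesis using analytic_in_empty by metis
next
  case False
  obtain d q where *: "dense_metric (topspace T) d q" and Td: "T = Metric_space.mtopology (topspace T) d"
    using polish_metric[OF assms False] by (elim exE conjE)
  interpret dense_metric "topspace T" d q by fact
  define K where "K = {s :: nat \<Rightarrow> nat. \<forall>n. d (q (s n)) (q (s (Suc n))) \<le> 1 * (1/2)^n}"
  define pi where "pi s = (SOME x. x \<in> topspace T \<and> (\<forall>n. d (q (s n)) x \<le> 2 * 1 * (1/2)^n))" for s
  have pi: "pi s \<in> topspace T" "d (q (s n)) (pi s) \<le> 2 * (1/2)^n" if "s \<in> K" for s n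
  proof -
    have "\<exists>x. x \<in> topspace T \<and> (\<forall>n. d (q (s n)) x \<le> 2 * 1 * (1/2)^n)"
      using geometric_limit[OF mcomplete, of 1 "\<lambda>n. q (s n)"] q that by (auto simp: K_def)
    from someI_ex[OF this] show "pi s \<in> topspace T" "d (q (s n)) (pi s) \<le> 2 * (1/2)^n"
      unfolding pi_def by auto
  qed
  have "baire_closed K"
    unfolding baire_closed_def
  proof (intro allI impI)
    fix s assume s: "\<forall>n. \<exists>t\<in>K. agree n s t"
    have "d (q (s n)) (q (s (Suc n))) \<le> 1 * (1/2)^n" for n
    proof -
      obtain t where t: "t \<in> K" "agree (Suc (Suc n)) s t" using s by blast
      then have "s n = t n" "s (Suc n) = t (Suc n)" by (auto simp: agree_def)
      then show ?thesis using t(1) by (simp add: K_def)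
    qed
    then show "s \<in> K" by (simp add: K_def)
  qed
  moreover have "baire_cont T K pi"
    unfolding baire_cont_def
  proof (intro conjI ballI allI impI)
    show "pi \<in> K \<rightarrow> topspace T" using pi by auto
    fix s U assume s: "s \<in> K" and U: "openin T U" "pi s \<in> U"
    have "openin mtopology U" using U(1) Td by simp
    then obtain r where r: "r > 0" "mball (pi s) r \<subseteq> U" using U(2) by (auto simp: openin_mtopology)
    \<comment> \<open>Twice the error \<open>2 * (1/2)^n\<close>: both limits are that close to
      their common point \<open>q (s n)\<close>.\<close>
    obtain n where n: "4 * (1/2::real)^n < r" using half_power_less[OF r(1)] by blast
    have "pi t \<in> U" if t: "t \<in> K" "agree (Suc n) s t" for t
    proof -
      have "s n = t n" using t by (auto simp: agree_def)
      then have "d (pi s) (pi t) \<le> 4 * (1/2)^n"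
        using pi(2)[OF s, of n] pi(2)[OF t(1), of n] pi(1)[OF s] pi(1)[OF t(1)] triangle[of "pi s" "q (s n)" "pi t"] q
        by (simp add: commute)
      then show ?thesis using n r(2) pi(1)[OF s] pi(1)[OF t(1)] by auto
    qed
    then show "\<exists>n. \<forall>t\<in>K. agree n s t \<longrightarrow> pi t \<in> U" by blast
  qed
  moreover have "topspace T = pi ` K"
  proof
    show "pi ` K \<subseteq> topspace T" using pi by auto
    show "topspace T \<subseteq> pi ` K"
    proof
      fix x assume x: "x \<in> topspace T"
      \<comment> \<open>The extra factor 1/2 lets the errors of two consecutive indices fit into one
        step \<open>(1/2)^n\<close>.\<close>
      have "\<forall>n. \<exists>k. d (q k) x < (1/2) * (1/2)^n" by (intro allI dense[OF x]) simp
      then obtain s where s: "\<And>n. d (q (s n)) x < (1/2) * (1/2)^n" by metis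
      have "d (q (s n)) (q (s (Suc n))) \<le> 1 * (1/2)^n" for n
        using triangle[OF q x q, of "s n" "s (Suc n)"] s[of n] s[of "Suc n"] commute[of x "q (s (Suc n))"] zero_less_power[of "1/2::real" n]
        by (simp del: zero_less_power)
      then have sK: "s \<in> K" by (simp add: K_def)
      have "d (pi s) x < e" if "e > 0" for e
      proof -
        obtain n where n: "3 * (1/2::real)^n < e" using half_power_less[OF \<open>e > 0\<close>] by blast
        then show ?thesis using triangle[OF pi(1)[OF sK] q x, of "s n"] pi(2)[OF sK, of n] s[of n]
            commute[of "pi s"] zero_less_power[of "1/2::real" n] by (simp del: zero_less_power)
      qed
      then have "d (pi s) x = 0" by (metis nonneg less_irrefl order_le_less)
      then show "x \<in> pi ` K" using sK x pi(1)[OF sK] by auto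
    qed
  qed
  ultimately show ?thesis unfolding analytic_in_def by blast
qed

lemma analytic_in_closed:
  assumes "polish_topology T" "closedin T C"
  shows "analytic_in T C"
  using analytic_in_Int_closed[OF analytic_in_topspace[OF assms(1)] assms(2)] closedin_subset[OF assms(2)]
  by (simp add: Int_absorb1)

lemma polish_Hausdorff: "polish_topology T \<Longrightarrow> Hausdorff_space T"
  by (simp add: polish_topology_def completely_metrizable_imp_metrizable_space metrizable_imp_Hausdorff_space)

lemma analytic_in_open:
  assumes "polish_topology T" "openin T U"
  shows "analytic_in T U"
proof -
  have "fsigma_in T U"
    using assms by (simp add: open_imp_fsigma_in polish_topology_def completely_metrizable_imp_metrizable_space)
  then obtain C :: "nat \<Rightarrow> _" where C: "\<And>n. closedin T (C n)" "\<Union> (range C) = U"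
    unfolding fsigma_in_ascending by blast
  have "analytic_in T (\<Union>n. C n)" by (intro analytic_in_UN analytic_in_closed[OF assms(1) C(1)])
  then show ?thesis using C(2) by simp
qed

text \<open>Complements of analytic sets need not be analytic, so the induction carries the
  complement along. The complement of a union is an intersection, which is where
  \<open>analytic_in_INT\<close> enters.\<close>

lemma analytic_in_borel:
  assumes T: "polish_topology T" and A: "A \<in> borel_sets T"
  shows "analytic_in T A"
proof -
  have "A \<in> sigma_sets (topspace T) {U. openin T U}" using A by (simp add: sets_borel_algebra)
  then have "A \<subseteq> topspace T \<and> analytic_in T A \<and> analytic_in T (topspace T - A)"
  proof induction
    case (Basic U)
    then show ?case using analytic_in_open[OF T] analytic_in_closed[OF T] openin_subset by blast
  next
    case Empty
    then show ?case using analytic_in_empty analytic_in_topspace[OF T] by auto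
  next
    case (Compl A)
    then show ?case by (auto simp: double_diff)
  next
    case (Union A)
    have "topspace T - (\<Union>i. A i) = (\<Inter>i. topspace T - A i)" by auto
    then show ?case using Union analytic_in_UN[of T A] analytic_in_INT[OF _ polish_Hausdorff[OF T], of "\<lambda>i. topspace T - A i"]
      by auto
  qed
  then show ?thesis by simp
qed

lemma polish_prod_topology:
  assumes "polish_topology S" "polish_topology T"
  shows "polish_topology (prod_topology S T)"
proof -
  obtain C where C: "countable C" "C \<subseteq> topspace S" "S closure_of C = topspace S"
    using assms(1) unfolding polish_topology_def separable_space_def by auto
  obtain D where D: "countable D" "D \<subseteq> topspace T" "T closure_of D = topspace T"
    using assms(2) unfolding polish_topology_def separable_space_def by auto
  have "separable_space (prod_topology S T)"
    unfolding separable_space_def using C D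
    by (intro exI[of _ "C \<times> D"]) (auto simp: closure_of_Times)
  then show ?thesis
    using assms by (simp add: polish_topology_def completely_metrizable_space_prod_topology)
qed

lemma analytic_in_Int:
  assumes "analytic_in T A" "analytic_in T B" "Hausdorff_space T"
  shows "analytic_in T (A \<inter> B)"
proof -
  have "analytic_in T (\<Inter>n::nat. if n = 0 then A else B)"
    using assms by (intro analytic_in_INT) auto
  moreover have "(\<Inter>n::nat. if n = 0 then A else B) = A \<inter> B" by (auto split: if_splits)
  ultimately show ?thesis by simp
qed

lemma analytic_in_INT_finite:
  assumes "finite I" "\<And>i. i \<in> I \<Longrightarrow> analytic_in T (A i)" "polish_topology T"
  shows "analytic_in T (topspace T \<inter> (\<Inter>i\<in>I. A i))"
  using assms(1,2)
proof (induction I)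
  case empty
  then show ?case using analytic_in_topspace[OF assms(3)] by simp
next
  case (insert i I)
  have "analytic_in T (A i \<inter> (topspace T \<inter> (\<Inter>i\<in>I. A i)))"
    by (rule analytic_in_Int) (use insert polish_Hausdorff[OF assms(3)] in auto)
  then show ?case by (simp add: Int_left_commute)
qed

lemma analytic_in_fst_borel:
  assumes "polish_topology X" "polish_topology Y" "E \<in> borel_sets (prod_topology X Y)"
  shows "analytic_in X (fst ` E)"
  using analytic_in_image[OF analytic_in_borel[OF polish_prod_topology[OF assms(1,2)] assms(3)] continuous_map_fst] .

lemma borel_algebra_Times:
  assumes A: "A \<in> borel_sets X" and B: "B \<in> borel_sets Y"
  shows "A \<times> B \<in> borel_sets (prod_topology X Y)"
proof -
  let ?P = "borel_algebra (prod_topology X Y)"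
  have "fst -` A \<inter> space ?P \<in> sets ?P" "snd -` B \<inter> space ?P \<in> sets ?P"
    using measurable_sets[OF measurable_continuous_map[OF continuous_map_fst] A]
      measurable_sets[OF measurable_continuous_map[OF continuous_map_snd] B] by blast+
  then have "(fst -` A \<inter> space ?P) \<inter> (snd -` B \<inter> space ?P) \<in> sets ?P" by blast
  moreover have "(fst -` A \<inter> space ?P) \<inter> (snd -` B \<inter> space ?P) = A \<times> B"
    using sets.sets_into_space[OF A] sets.sets_into_space[OF B] by auto
  ultimately show ?thesis by simp
qed


section \<open>Borel sets with finite sections\<close>

text \<open>The two sets of points of \<open>D\<close> whose partner lies inside or outside a basic set are disjoint and
  analytic. Borel sets separating them name the basic sets around the partner, whose limit exists by
  completeness, also at points outside \<open>D\<close>.\<close>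

lemma borel_selector:
  assumes X: "polish_topology X" and Y: "polish_topology Y"
    and E: "E \<in> borel_sets (prod_topology X Y)"
    and D: "analytic_in X D" and uniq: "\<And>x. x \<in> D \<Longrightarrow> \<exists>!y. (x, y) \<in> E"
  shows "\<exists>D1 g. D \<subseteq> D1 \<and> (\<forall>x\<in>D. (x, g x) \<in> E) \<and>
    (\<forall>Q\<in>borel_sets (prod_topology X Y). {x\<in>D1. (x, g x) \<in> Q} \<in> borel_sets X)"
proof (cases "topspace Y = {}")
  case True
  have "E \<subseteq> topspace X \<times> topspace Y" using sets.sets_into_space[OF E] by simp
  then have "D = {}" using True uniq by blast
  then show ?thesis by (intro exI[of _ "{}"]) auto
next
  case False
  obtain d q where *: "dense_metric (topspace Y) d q" and Td: "Y = Metric_space.mtopology (topspace Y) d"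
    using polish_metric[OF Y False] by (elim exE conjE)
  interpret dense_metric "topspace Y" d q by fact
  have EXY: "E \<subseteq> topspace X \<times> topspace Y" using sets.sets_into_space[OF E] by simp
  define V where "V n m = mball (q n) ((1/2)^m)" for n m :: nat
  have Vop: "openin Y (V n m)" for n m using openin_mball Td by (metis V_def)
  define A where "A n m = D \<inter> fst ` (E \<inter> topspace X \<times> V n m)" for n m
  define C where "C n m = D \<inter> fst ` (E \<inter> topspace X \<times> (topspace Y - V n m))" for n m
  have Xb: "topspace X \<in> borel_sets X" by (rule borel_algebra_open) simp
  have "borel_separated X (A n m) (C n m)" for n m
  proof (rule lusin_separation)
    show "analytic_in X (A n m)" unfolding A_def
      by (intro analytic_in_Int D analytic_in_fst_borel[OF X Y] sets.Int E borel_algebra_Times Xb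
          borel_algebra_open Vop polish_Hausdorff X)
    show "analytic_in X (C n m)" unfolding C_def
      by (intro analytic_in_Int D analytic_in_fst_borel[OF X Y] sets.Int E borel_algebra_Times Xb
          borel_algebra_closed closedin_diff closedin_topspace Vop polish_Hausdorff X)
    show "A n m \<inter> C n m = {}" using uniq unfolding A_def C_def by fastforce
  qed (rule polish_Hausdorff[OF X])
  then obtain B where B: "\<And>n m. B n m \<in> borel_sets X" "\<And>n m. A n m \<subseteq> B n m" "\<And>n m. B n m \<inter> C n m = {}"
    unfolding borel_separated_def by metis
  have hit: "x \<in> B n m \<longleftrightarrow> y \<in> V n m" if "x \<in> D" "(x, y) \<in> E" for x y n m
  proof -
    have xy: "x \<in> topspace X" "y \<in> topspace Y" using that EXY by auto
    show ?thesis
    proof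
      assume "y \<in> V n m"
      then have "x \<in> A n m" using that xy by (force simp: A_def)
      then show "x \<in> B n m" using B(2) by blast
    next
      assume b: "x \<in> B n m"
      show "y \<in> V n m"
      proof (rule ccontr)
        assume "y \<notin> V n m"
        then have "x \<in> C n m" using that xy by (force simp: C_def)
        then show False using B(3) b by blast
      qed
    qed
  qed
  \<comment> \<open>Made disjoint in \<open>n\<close>: at each level \<open>m\<close> a point has at
    most one name, the first \<open>n\<close> that applies.\<close>
  define H where "H n m = B n m - (\<Union>k<n. B k m)" for n m
  have Hs: "H n m \<in> borel_sets X" for n m
    unfolding H_def using B(1) by (intro sets.Diff sets.finite_UN) auto
  have Huniq: "n = n'" if "x \<in> H n m" "x \<in> H n' m" for x n n' m
    using that unfolding H_def by (metis DiffD1 DiffD2 UN_I lessThan_iff nat_neq_iff)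
  have Hex: "\<exists>n. x \<in> H n m" if "x \<in> B k m" for x k m
  proof -
    have "x \<in> B (LEAST n. x \<in> B n m) m" using that by (rule LeastI)
    moreover have "x \<notin> B k m" if "k < (LEAST n. x \<in> B n m)" for k using not_less_Least[OF that] .
    ultimately show ?thesis unfolding H_def by blast
  qed
  \<comment> \<open>On \<open>D\<close> the centres named at levels \<open>m\<close> and
    \<open>m + 1\<close> are within \<open>(1/2)^m\<close> and \<open>(1/2)^(m+1)\<close> of the
    partner. \<open>D1\<close> asks just for names that are compatible in this way, so it is Borel,
    and the named centres converge at all of its points.\<close>
  define R where "R m = {(n, n'). d (q n) (q n') \<le> 2 * (1/2)^m}" for m :: nat
  define D1 where "D1 = (\<Inter>m. \<Union>(n, n')\<in>R m. H n m \<inter> H n' (Suc m))"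
  have D1s: "D1 \<in> borel_sets X"
    unfolding D1_def using Hs
    by (intro sets.countable_INT sets.countable_UN' image_subsetI) (auto simp: case_prod_beta)
  \<comment> \<open>The 4 is the factor \<open>2 * c\<close> of \<open>geometric_limit\<close> for
    steps \<open>2 * (1/2)^m\<close>.\<close>
  define lim where "lim x y \<longleftrightarrow> y \<in> topspace Y \<and> (\<forall>m n. x \<in> H n m \<longrightarrow> d (q n) y \<le> 4 * (1/2)^m)" for x y
  define g where "g x = (SOME y. lim x y)" for x
  have glim: "lim x (g x)" if x: "x \<in> D1" for x
  proof -
    have "\<forall>m. \<exists>n. x \<in> H n m" using x unfolding D1_def by blast
    then obtain h where h: "\<And>m. x \<in> H (h m) m" by metis
    have "d (q (h m)) (q (h (Suc m))) \<le> 2 * (1/2)^m" for m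
    proof -
      obtain n n' where "(n, n') \<in> R m" "x \<in> H n m" "x \<in> H n' (Suc m)"
        using x unfolding D1_def by blast
      moreover have "n = h m" "n' = h (Suc m)" using calculation h Huniq by blast+
      ultimately show ?thesis by (simp add: R_def)
    qed
    then obtain y where y: "y \<in> topspace Y" "\<And>m. d (q (h m)) y \<le> 4 * (1/2)^m"
      using geometric_limit[OF mcomplete, of 2 "\<lambda>m. q (h m)"] q by auto
    have "lim x y" unfolding lim_def using y h Huniq by metis
    then show ?thesis unfolding g_def by (rule someI)
  qed
  have limuniq: "y = y'" if x: "x \<in> D1" and y: "lim x y" "lim x y'" for x y y'
  proof -
    have "d y y' < e" if "e > 0" for e
    proof -
      obtain m where m: "8 * (1/2::real)^m < e" using half_power_less[OF \<open>e > 0\<close>] by blast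
      obtain n where n: "x \<in> H n m" using x unfolding D1_def by blast
      show ?thesis using triangle[of y "q n" y'] y n m q commute[of y "q n"] unfolding lim_def by force
    qed
    then have "d y y' = 0" by (metis nonneg less_irrefl order_le_less)
    then show ?thesis using y by (simp add: lim_def)
  qed
  have DD1: "x \<in> D1 \<and> g x = y" if x: "x \<in> D" "(x, y) \<in> E" for x y
  proof -
    have y: "y \<in> topspace Y" using x EXY by auto
    have near: "d (q n) y < (1/2)^m" if "x \<in> H n m" for n m
      using that hit[OF x, of n m] unfolding H_def V_def by auto
    have ex: "\<exists>n. x \<in> H n m" for m
    proof -
      obtain n where "d (q n) y < (1/2)^m" using dense[OF y, of "(1/2)^m"] by auto
      then have "y \<in> V n m" using y q by (simp add: V_def)
      then show ?thesis using Hex hit[OF x] by blast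
    qed
    have "x \<in> D1" unfolding D1_def
    proof
      fix m
      obtain n n' where n: "x \<in> H n m" "x \<in> H n' (Suc m)" using ex by meson
      have "d (q n) (q n') \<le> 2 * (1/2)^m"
        using triangle[OF q y q, of n n'] near[OF n(1)] near[OF n(2)] commute[of y "q n'"]
          zero_less_power[of "1/2::real" m] by (simp del: zero_less_power)
      then show "x \<in> (\<Union>(n, n')\<in>R m. H n m \<inter> H n' (Suc m))" using n unfolding R_def by blast
    qed
    moreover have "lim x y" unfolding lim_def
    proof (intro conjI allI impI y)
      fix m n assume "x \<in> H n m"
      from near[OF this] show "d (q n) y \<le> 4 * (1/2)^m"
        using zero_le_power[of "1/2::real" m] by linarith
    qed
    ultimately show ?thesis using limuniq glim by blast
  qed
  have gY: "g x \<in> topspace Y" if "x \<in> D1" for x using glim[OF that] by (simp add: lim_def)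
  have gmeas: "{x\<in>D1. g x \<in> W} \<in> borel_sets X" if W: "openin Y W" for W
  proof -
    \<comment> \<open>The radius factor 5 exceeds the error factor 4 between \<open>g x\<close> and
      its name, so a named ball inside \<open>W\<close> contains \<open>g x\<close>. Conversely,
      such a ball lies within \<open>(5 + 4) * (1/2)^m\<close> of \<open>g x\<close>, whence the 9
      below.\<close>
    define I where "I m = {n. mball (q n) (5 * (1/2)^m) \<subseteq> W}" for m :: nat
    have "{x\<in>D1. g x \<in> W} = D1 \<inter> (\<Union>m. \<Union>n\<in>I m. H n m)"
    proof safe
      fix x assume x: "x \<in> D1" "g x \<in> W"
      have "openin mtopology W" using W Td by simp
      then obtain r where r: "r > 0" "mball (g x) r \<subseteq> W" using x(2) by (auto simp: openin_mtopology)
      obtain m where m: "9 * (1/2::real)^m < r" using half_power_less[OF r(1)] by blast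
      obtain n where n: "x \<in> H n m" using x(1) unfolding D1_def by blast
      have dn: "d (q n) (g x) \<le> 4 * (1/2)^m" using glim[OF x(1)] n by (auto simp: lim_def)
      have "z \<in> W" if z: "z \<in> mball (q n) (5 * (1/2)^m)" for z
      proof -
        have "d (g x) z < r"
          using triangle[OF gY[OF x(1)] q, of z n] z m dn commute[of "g x"] by auto
        then show ?thesis using r(2) z gY[OF x(1)] by auto
      qed
      then show "x \<in> (\<Union>m. \<Union>n\<in>I m. H n m)" using n unfolding I_def by blast
    next
      fix x m n assume x: "x \<in> D1" "n \<in> I m" "x \<in> H n m"
      have "d (q n) (g x) \<le> 4 * (1/2)^m" using glim[OF x(1)] x(3) by (auto simp: lim_def)
      then have "d (q n) (g x) < 5 * (1/2)^m" using zero_less_power[of "1/2::real" m] by linarith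
      then show "g x \<in> W" using x(2) q gY[OF x(1)] unfolding I_def by auto
    qed
    moreover have "D1 \<inter> (\<Union>m. \<Union>n\<in>I m. H n m) \<in> borel_sets X"
      using Hs by (intro sets.Int D1s sets.countable_UN' ) auto
    ultimately show ?thesis by simp
  qed
  have "{x\<in>D1. (x, g x) \<in> Q} \<in> borel_sets X"
    if Q: "Q \<in> borel_sets (prod_topology X Y)" for Q
  proof -
    have "Q \<in> sigma_sets (topspace (prod_topology X Y)) {U. openin (prod_topology X Y) U}"
      using Q by (simp add: sets_borel_algebra)
    then show ?thesis
    proof induction
      case (Basic Q)
      \<comment> \<open>With the countably many balls \<open>V n m\<close> in the second factor
        alone, an open set of the product is the union of the rectangles
        \<open>W n m \<times> V n m\<close>, where \<open>W n m\<close> is as large as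
        possible.\<close>
      define W where "W n m = \<Union>{U. openin X U \<and> U \<times> V n m \<subseteq> Q}" for n m
      have Wop: "openin X (W n m)" for n m unfolding W_def by auto
      have "{x\<in>D1. (x, g x) \<in> Q} = (\<Union>n. \<Union>m. W n m \<inter> {x\<in>D1. g x \<in> V n m})"
      proof safe
        fix x assume x: "x \<in> D1" "(x, g x) \<in> Q"
        have "\<exists>U W. openin X U \<and> openin Y W \<and> x \<in> U \<and> g x \<in> W \<and> U \<times> W \<subseteq> Q"
          using Basic x(2) openin_prod_topology_alt[of X Y Q] by simp
        then obtain U W' where UW: "openin X U" "openin Y W'" "x \<in> U" "g x \<in> W'" "U \<times> W' \<subseteq> Q" by blast
        have "openin mtopology W'" using UW(2) Td by simp
        then obtain r where r: "r > 0" "mball (g x) r \<subseteq> W'" using UW(4) by (auto simp: openin_mtopology)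
        obtain m where m: "2 * (1/2::real)^m < r" using half_power_less[OF r(1)] by blast
        obtain n where n: "d (q n) (g x) < (1/2)^m"
          using dense[OF gY[OF x(1)], of "(1/2)^m"] by auto
        have "V n m \<subseteq> W'"
        proof
          fix z assume z: "z \<in> V n m"
          then have "d (g x) z < r"
            using triangle[OF gY[OF x(1)] q, of z n] m n commute[of "g x"] by (auto simp: V_def)
          then show "z \<in> W'" using r(2) z gY[OF x(1)] by (auto simp: V_def)
        qed
        then have "x \<in> W n m" using UW unfolding W_def by blast
        moreover have "g x \<in> V n m" using n q gY[OF x(1)] by (simp add: V_def)
        ultimately show "x \<in> (\<Union>n. \<Union>m. W n m \<inter> {x\<in>D1. g x \<in> V n m})" using x(1) by blast
      qed (auto simp: W_def)
      moreover have "(\<Union>n. \<Union>m. W n m \<inter> {x\<in>D1. g x \<in> V n m}) \<in> borel_sets X"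
        using gmeas[OF Vop] borel_algebra_open[OF Wop]
        by (intro sets.countable_UN' sets.Int) auto
      ultimately show ?case by simp
    next
      case (Compl Q)
      have "D1 \<subseteq> topspace X" using sets.sets_into_space[OF D1s] by simp
      then have "{x\<in>D1. (x, g x) \<in> topspace (prod_topology X Y) - Q} = D1 - {x\<in>D1. (x, g x) \<in> Q}"
        using gY by auto
      then show ?case using D1s Compl by auto
    next
      case (Union Q)
      have "{x\<in>D1. (x, g x) \<in> (\<Union>i. Q i)} = (\<Union>i. {x\<in>D1. (x, g x) \<in> Q i})" by auto
      then show ?case using Union by auto
    qed simp
  qed
  moreover have "D \<subseteq> D1" "\<forall>x\<in>D. (x, g x) \<in> E" using DD1 uniq by blast+
  ultimately show ?thesis by blast
qed

text \<open>Where \<open>n + 1\<close> disjoint basic sets all meet the section, each of them contains exactly one of its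
  points. Removing these parts of the domain lowers the bound on the sections by one.\<close>

theorem borel_projection_bounded_sections:
  assumes X: "polish_topology X" and Y: "polish_topology Y"
    and E: "E \<in> borel_sets (prod_topology X Y)"
    and fin: "\<And>x. finite {y. (x, y) \<in> E} \<and> card {y. (x, y) \<in> E} \<le> n"
  shows "fst ` E \<in> borel_sets X"
proof (cases "topspace Y = {}")
  case True
  then have "E = {}" using sets.sets_into_space[OF E] by auto
  then show ?thesis by simp
next
  case False
  obtain d q where *: "dense_metric (topspace Y) d q" and Td: "Y = Metric_space.mtopology (topspace Y) d"
    using polish_metric[OF Y False] by (elim exE conjE)
  interpret dense_metric "topspace Y" d q by fact
  have Xb: "topspace X \<in> borel_sets X" by (rule borel_algebra_open) simp
  show ?thesis
    using E fin
  proof (induction n arbitrary: E)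
    case 0
    then have "{y. (x, y) \<in> E} = {}" for x by (metis card_0_eq le_zero_eq)
    then have "E = {}" by auto
    then show ?case by simp
  next
    case (Suc n)
    note E = Suc.prems(1) and fin = Suc.prems(2)
    have EXY: "E \<subseteq> topspace X \<times> topspace Y" using sets.sets_into_space[OF E] by simp
    \<comment> \<open>\<open>t\<close> packs a level and a list of centres. Its type is countable,
      so the union over all valid \<open>t\<close> below stays Borel.\<close>
    define U where "U t i = mball (q (snd t ! i)) ((1/2)^fst t)" for t :: "nat \<times> nat list" and i
    have Uop: "openin Y (U t i)" for t i using openin_mball Td by (metis U_def)
    define Ei where "Ei t i = E \<inter> topspace X \<times> U t i" for t i
    have Ei: "Ei t i \<in> borel_sets (prod_topology X Y)" for t i
      unfolding Ei_def by (intro sets.Int E borel_algebra_Times Xb borel_algebra_open Uop)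
    define D where "D t = topspace X \<inter> (\<Inter>i\<in>{..n}. fst ` Ei t i)" for t
    define val where "val = {t. \<forall>i\<le>n. \<forall>j\<le>n. i \<noteq> j \<longrightarrow> U t i \<inter> U t j = {}}"
    have Db: "D t \<in> borel_sets X" if t: "t \<in> val" for t
    proof -
      have an: "analytic_in X (D t)" unfolding D_def
        by (intro analytic_in_INT_finite X analytic_in_fst_borel[OF X Y] Ei) auto
      have uniq: "\<exists>!y. (x, y) \<in> Ei t i" if x: "x \<in> D t" and i: "i \<le> n" for x i
      proof -
        have "\<forall>i\<in>{..n}. \<exists>y. (x, y) \<in> Ei t i" using x unfolding D_def by force
        then obtain y where y: "\<And>i. i \<le> n \<Longrightarrow> (x, y i) \<in> Ei t i" by (metis atMost_iff)
        have yU: "y i \<in> U t i" "(x, y i) \<in> E" if "i \<le> n" for i using y[OF that] by (auto simp: Ei_def)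
        have inj: "inj_on y {..n}"
        proof (rule inj_onI)
          fix i j assume "i \<in> {..n}" "j \<in> {..n}" "y i = y j"
          then show "i = j" using yU(1)[of i] yU(1)[of j] t unfolding val_def by (cases "i = j") auto
        qed
        have sub: "y ` {..n} \<subseteq> {y. (x, y) \<in> E}" using yU by auto
        have "card (y ` {..n}) = Suc n" by (simp add: card_image[OF inj])
        then have eq: "y ` {..n} = {y. (x, y) \<in> E}"
          using fin[of x] sub by (metis card_seteq)
        have "z = y i" if z: "(x, z) \<in> Ei t i" for z
        proof -
          have "z \<in> y ` {..n}" using z eq by (auto simp: Ei_def)
          then obtain j where j: "j \<le> n" "z = y j" by auto
          have "z \<in> U t i" "z \<in> U t j" using z j yU(1)[of j] by (auto simp: Ei_def)
          then have "i = j" using t i j(1) unfolding val_def by blast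
          then show ?thesis using j by simp
        qed
        then show ?thesis using y[OF i] by blast
      qed
      have "\<forall>i\<in>{..n}. \<exists>D1 g. D t \<subseteq> D1 \<and> (\<forall>x\<in>D t. (x, g x) \<in> Ei t i) \<and>
          (\<forall>Q\<in>borel_sets (prod_topology X Y). {x\<in>D1. (x, g x) \<in> Q} \<in> borel_sets X)"
    proof
      fix i assume "i \<in> {..n}"
      then have "\<And>x. x \<in> D t \<Longrightarrow> \<exists>!y. (x, y) \<in> Ei t i" using uniq by simp
      then show "\<exists>D1 g. D t \<subseteq> D1 \<and> (\<forall>x\<in>D t. (x, g x) \<in> Ei t i) \<and>
          (\<forall>Q\<in>borel_sets (prod_topology X Y). {x\<in>D1. (x, g x) \<in> Q} \<in> borel_sets X)"
        by (rule borel_selector[OF X Y Ei an])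
    qed
      from bchoice[OF this] obtain D1 where "\<forall>i\<in>{..n}. \<exists>g. D t \<subseteq> D1 i \<and> (\<forall>x\<in>D t. (x, g x) \<in> Ei t i) \<and>
          (\<forall>Q\<in>borel_sets (prod_topology X Y). {x\<in>D1 i. (x, g x) \<in> Q} \<in> borel_sets X)"
        by (rule exE)
      from bchoice[OF this] obtain g where g: "\<forall>i\<in>{..n}. D t \<subseteq> D1 i \<and> (\<forall>x\<in>D t. (x, g i x) \<in> Ei t i) \<and>
          (\<forall>Q\<in>borel_sets (prod_topology X Y). {x\<in>D1 i. (x, g i x) \<in> Q} \<in> borel_sets X)"
        by (rule exE)
      \<comment> \<open>The domains \<open>D1 i\<close> may exceed \<open>D t\<close>. But a
        selector value in \<open>Ei t i\<close> is itself a witness that the section meets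
        \<open>U t i\<close>, so demanding this for all \<open>i\<close> gives back exactly
        \<open>D t\<close>.\<close>
      have "D t = topspace X \<inter> (\<Inter>i\<in>{..n}. {x\<in>D1 i. (x, g i x) \<in> Ei t i})"
      proof
        show "D t \<subseteq> topspace X \<inter> (\<Inter>i\<in>{..n}. {x\<in>D1 i. (x, g i x) \<in> Ei t i})"
          using g unfolding D_def by blast
        show "topspace X \<inter> (\<Inter>i\<in>{..n}. {x\<in>D1 i. (x, g i x) \<in> Ei t i}) \<subseteq> D t"
          unfolding D_def by force
      qed
      also have "\<dots> \<in> borel_sets X"
        using g Ei by (intro sets.Int Xb sets.finite_INT) auto
      finally show ?thesis .
    qed
    define DD where "DD = (\<Union>t\<in>val. D t)"
    have DDb: "DD \<in> borel_sets X"
      unfolding DD_def by (intro sets.countable_UN') (auto intro: Db)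
    define E' where "E' = E - DD \<times> topspace Y"
    have Yb: "topspace Y \<in> borel_sets Y" by (rule borel_algebra_open) simp
    have "fst ` E' \<in> borel_sets X"
    proof (rule Suc.IH)
      show "E' \<in> borel_sets (prod_topology X Y)"
        unfolding E'_def by (intro sets.Diff E borel_algebra_Times DDb Yb)
      fix x
      have sub: "{y. (x, y) \<in> E'} \<subseteq> {y. (x, y) \<in> E}" by (auto simp: E'_def)
      have f: "finite {y. (x, y) \<in> E'}" using finite_subset[OF sub] fin by blast
      have "card {y. (x, y) \<in> E'} \<noteq> Suc n"
      proof
        assume c: "card {y. (x, y) \<in> E'} = Suc n"
        obtain ys where ys: "set ys = {y. (x, y) \<in> E'}" "distinct ys"
          using finite_distinct_list[OF f] by blast
        have len: "length ys = Suc n" using c ys distinct_card[of ys] by simp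
        have ysY: "ys ! i \<in> topspace Y" "(x, ys ! i) \<in> E'" if "i \<le> n" for i
        proof -
          have "ys ! i \<in> set ys" using that len by simp
          then show "(x, ys ! i) \<in> E'" using ys by auto
          then show "ys ! i \<in> topspace Y" using EXY by (auto simp: E'_def)
        qed
        \<comment> \<open>The element 1 keeps \<open>S\<close> nonempty when
          \<open>n = 0\<close>.\<close>
        define S where "S = insert 1 ((\<lambda>(i, j). d (ys ! i) (ys ! j)) ` {(i, j). i \<le> n \<and> j \<le> n \<and> i \<noteq> j})"
        have "finite {(i, j). i \<le> n \<and> j \<le> n \<and> i \<noteq> j}"
          by (rule finite_subset[of _ "{..n} \<times> {..n}"]) auto
        then have Sfin: "finite S" by (simp add: S_def)
        have "s > 0" if "s \<in> S" for s
        proof -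
          have "d (ys ! i) (ys ! j) > 0" if "i \<le> n" "j \<le> n" "i \<noteq> j" for i j
            using ysY that ys(2) len by (simp add: nth_eq_iff_index_eq)
          then show ?thesis using that unfolding S_def by auto
        qed
        then have "Min S > 0" using Sfin by (simp add: S_def)
        \<comment> \<open>Centres will be chosen within \<open>(1/2)^m\<close> of their points. If
          two of the balls met, their points would be within \<open>4 * (1/2)^m\<close> of each
          other.\<close>
        then obtain m where m: "4 * (1/2::real)^m < Min S" using half_power_less by blast
        have md: "4 * (1/2::real)^m < d (ys ! i) (ys ! j)" if "i \<le> n" "j \<le> n" "i \<noteq> j" for i j
        proof -
          have "d (ys ! i) (ys ! j) \<in> S" using that unfolding S_def by (intro insertI2 image_eqI[of _ _ "(i, j)"]) auto
          then show ?thesis using m Min_le[OF Sfin] by fastforce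
        qed
        have "\<forall>i\<in>{..n}. \<exists>k. d (q k) (ys ! i) < (1/2)^m" using dense ysY by simp
        then obtain k where k: "\<And>i. i \<le> n \<Longrightarrow> d (q (k i)) (ys ! i) < (1/2)^m"
          unfolding bchoice_iff by (metis atMost_iff)
        define t where "t = (m, map k [0..<Suc n])"
        have tk: "U t i = mball (q (k i)) ((1/2)^m)" if "i \<le> n" for i
          using that by (simp add: U_def t_def nth_append del: upt_Suc)
        have "t \<in> val" unfolding val_def
        proof (intro CollectI allI impI)
          fix i j assume ij: "i \<le> n" "j \<le> n" "i \<noteq> j"
          show "U t i \<inter> U t j = {}"
          proof (rule ccontr)
            assume "U t i \<inter> U t j \<noteq> {}"
            then obtain z where z: "z \<in> topspace Y" "d (q (k i)) z < (1/2)^m" "d (q (k j)) z < (1/2)^m"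
              using tk ij by auto
            have "d (ys ! i) (ys ! j) \<le> d (ys ! i) (q (k i)) + d (q (k i)) (ys ! j)"
              using triangle ysY ij q by blast
            also have "d (q (k i)) (ys ! j) \<le> d (q (k i)) z + d z (ys ! j)"
              using triangle ysY ij q z by blast
            also have "d z (ys ! j) \<le> d z (q (k j)) + d (q (k j)) (ys ! j)"
              using triangle ysY ij q z by blast
            finally have "d (ys ! i) (ys ! j) < 4 * (1/2)^m"
              using z k[OF ij(1)] k[OF ij(2)] commute[of z "q (k j)"] commute[of "ys ! i" "q (k i)"] by simp
            then show False using md[OF ij] by simp
          qed
        qed
        moreover have "x \<in> D t"
        proof -
          have "(x, ys ! i) \<in> Ei t i" if "i \<le> n" for i
            using ysY[OF that] k[OF that] tk[OF that] q EXY by (auto simp: Ei_def E'_def)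
          moreover have "x \<in> topspace X" using ysY(2)[of 0] EXY by (auto simp: E'_def)
          ultimately show ?thesis unfolding D_def by force
        qed
        ultimately have "x \<in> DD" by (auto simp: DD_def)
        then show False using ysY[of 0] by (auto simp: E'_def)
      qed
      moreover have "card {y. (x, y) \<in> E'} \<le> Suc n"
        using card_mono[OF _ sub] fin[of x] by linarith
      ultimately show "finite {y. (x, y) \<in> E'} \<and> card {y. (x, y) \<in> E'} \<le> n" using f by simp
    qed
    moreover have "fst ` E = DD \<union> fst ` E'"
    proof
      show "fst ` E \<subseteq> DD \<union> fst ` E'"
      proof
        fix x assume "x \<in> fst ` E"
        then obtain y where "(x, y) \<in> E" by auto
        then show "x \<in> DD \<union> fst ` E'" by (cases "x \<in> DD") (force simp: E'_def)+
      qed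
      have "D t \<subseteq> fst ` E" for t unfolding D_def Ei_def by force
      then show "DD \<union> fst ` E' \<subseteq> fst ` E" unfolding DD_def E'_def by auto
    qed
    ultimately show ?case using DDb by simp
  qed
qed


section \<open>Measurability in graphings\<close>

text \<open>Serves to separate a vertex from finitely many others by one of countably many open
  sets.\<close>

lemma polish_countable_base:
  assumes T: "polish_topology T"
  shows "\<exists>U::nat \<Rightarrow> 'a set. (\<forall>n. openin T (U n)) \<and> (\<forall>W x. openin T W \<longrightarrow> x \<in> W \<longrightarrow> (\<exists>n. x \<in> U n \<and> U n \<subseteq> W))"
proof (cases "topspace T = {}")
  case True
  then show ?thesis by (intro exI[of _ "\<lambda>_. {}"]) (auto dest: openin_subset)
next
  case False
  obtain d q where *: "dense_metric (topspace T) d q" and Td: "T = Metric_space.mtopology (topspace T) d"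
    using polish_metric[OF T False] by (elim exE conjE)
  interpret dense_metric "topspace T" d q by fact
  define U where "U n = (case prod_decode n of (k, m) \<Rightarrow> mball (q k) ((1/2)^m))" for n
  have "openin T (U n)" for n using openin_mball Td by (metis U_def case_prod_beta)
  moreover have "\<exists>n. x \<in> U n \<and> U n \<subseteq> W" if W: "openin T W" and x: "x \<in> W" for W x
  proof -
    have "openin mtopology W" using W Td by simp
    then obtain r where r: "r > 0" "mball x r \<subseteq> W" using x by (auto simp: openin_mtopology)
    have xT: "x \<in> topspace T" using W x openin_subset by blast
    obtain m where m: "2 * (1/2::real)^m < r" using half_power_less[OF r(1)] by blast
    obtain k where k: "d (q k) x < (1/2)^m" using dense[OF xT, of "(1/2)^m"] by auto
    have "U (prod_encode (k, m)) \<subseteq> W"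
    proof
      fix z assume "z \<in> U (prod_encode (k, m))"
      then have z: "z \<in> topspace T" "d (q k) z < (1/2)^m" by (auto simp: U_def)
      then have "d x z < r" using triangle[OF xT q z(1), of k] m k commute[of x] by auto
      then show "z \<in> W" using r(2) z xT by auto
    qed
    moreover have "x \<in> U (prod_encode (k, m))" using k xT q by (simp add: U_def)
    ultimately show ?thesis by blast
  qed
  ultimately show ?thesis by blast
qed

text \<open>Kechris--Solecki--Todorcevic: maximal independent Borel sets are removed one after the
  other; each vertex left over has a neighbour in every set removed so far.\<close>

lemma measurable_proper_coloring:
  fixes M :: "'a measure" and F :: "('a \<times> 'a) set" and U :: "nat \<Rightarrow> 'a set"
  assumes F: "F \<subseteq> space M \<times> space M" "sym F"
    and deg: "\<And>x. x \<in> space M \<Longrightarrow> finite (F `` {x}) \<and> card (F `` {x}) \<le> D"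
    and nb: "\<And>A. A \<in> sets M \<Longrightarrow> {x\<in>space M. \<exists>y\<in>A. (x, y) \<in> F} \<in> sets M"
    and U: "\<And>n. U n \<in> sets M" "\<And>x. x \<in> space M \<Longrightarrow> \<exists>n. x \<in> U n \<and> F `` {x} \<inter> U n = {}"
  shows "\<exists>c\<in>measurable M (count_space {..D}). \<forall>(x, y)\<in>F. c x \<noteq> c y"
proof -
  define nF where "nF A = {x\<in>space M. \<exists>y\<in>A. (x, y) \<in> F}" for A
  have nF: "nF A \<in> sets M" if "A \<in> sets M" for A using nb[OF that] by (simp add: nF_def)
  \<comment> \<open>Countably many independent sets; by the hypothesis on \<open>U\<close> they
    cover the space.\<close>
  define A where "A n = U n - nF (U n)" for n
  have A: "A n \<in> sets M" for n unfolding A_def using U(1) nF by auto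
  have Aind: "(x, y) \<notin> F" if "x \<in> A n" "y \<in> A n" for x y n
    using that F unfolding A_def nF_def by blast
  have Acov: "\<exists>n. x \<in> A n" if x: "x \<in> space M" for x
    using U(2)[OF x] unfolding A_def nF_def by blast
  \<comment> \<open>Greedy choice inside \<open>Y\<close>: running through the independent sets
    \<open>A n\<close>, a vertex of \<open>Y\<close> is taken unless it has a neighbour taken
    before. The union over all stages is a maximal independent subset of \<open>Y\<close>.\<close>
  define J where "J Y = rec_nat {} (\<lambda>n J. J \<union> (A n \<inter> Y - nF J))" for Y
  have J0: "J Y 0 = {}" and JS: "J Y (Suc n) = J Y n \<union> (A n \<inter> Y - nF (J Y n))" for Y n
    by (simp_all add: J_def)
  define I where "I Y = (\<Union>n. J Y n)" for Y
  have Jm: "J Y n \<in> sets M" if "Y \<in> sets M" for Y n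
    by (induction n) (use that A nF in \<open>auto simp: J0 JS\<close>)
  have Im: "I Y \<in> sets M" if "Y \<in> sets M" for Y
    unfolding I_def using Jm[OF that] by auto
  have Jsub: "J Y n \<subseteq> Y" for Y n by (induction n) (auto simp: J0 JS)
  have Jmono: "J Y m \<subseteq> J Y n" if "m \<le> n" for Y m n
    using that by (induction n) (auto simp: JS le_Suc_eq)
  have Jind: "(x, y) \<notin> F" if "x \<in> J Y n" "y \<in> J Y n" for x y Y n
    using that
  proof (induction n)
    case (Suc n)
    have "(y, x) \<in> F \<longleftrightarrow> (x, y) \<in> F" using F(2) by (auto dest: symD)
    then show ?case using Suc Aind[of x n y] F(1) unfolding JS nF_def by blast
  qed (simp add: J0)
  have Iind: "(x, y) \<notin> F" if xy: "x \<in> I Y" "y \<in> I Y" for x y Y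
  proof -
    obtain m n where "x \<in> J Y m" "y \<in> J Y n" using xy unfolding I_def by blast
    then have "x \<in> J Y (max m n)" "y \<in> J Y (max m n)" using Jmono[of m "max m n"] Jmono[of n "max m n"] by auto
    then show ?thesis by (rule Jind)
  qed
  have Imax: "\<exists>y\<in>I Y. (x, y) \<in> F" if x: "x \<in> Y" "x \<in> space M" "x \<notin> I Y" for x Y
  proof -
    obtain n where n: "x \<in> A n" using Acov x(2) by blast
    have "x \<notin> J Y (Suc n)" using x(3) unfolding I_def by blast
    then have "x \<in> nF (J Y n)" using n x(1) unfolding JS by blast
    then show ?thesis unfolding nF_def I_def by blast
  qed
  have Isub: "I Y \<subseteq> Y" for Y using Jsub unfolding I_def by blast
  define Y where "Y = rec_nat (space M) (\<lambda>_ Y. Y - I Y)"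
  have Y0: "Y 0 = space M" and YS: "Y (Suc n) = Y n - I (Y n)" for n by (simp_all add: Y_def)
  have Ym: "Y n \<in> sets M" for n by (induction n) (use Im in \<open>auto simp: Y0 YS\<close>)
  have Yanti: "Y n \<subseteq> Y m" if "m \<le> n" for m n
    using that by (induction n) (auto simp: YS le_Suc_eq)
  have cov: "\<exists>i\<le>D. x \<in> I (Y i)" if x: "x \<in> space M" for x
  proof (rule ccontr)
    assume "\<not> (\<exists>i\<le>D. x \<in> I (Y i))"
    then have no: "x \<notin> I (Y i)" if "i \<le> D" for i using that by blast
    have xY: "x \<in> Y i" if "i \<le> Suc D" for i
      using that by (induction i) (use x no in \<open>auto simp: Y0 YS\<close>)
    have "\<forall>i\<in>{..D}. \<exists>y\<in>I (Y i). (x, y) \<in> F" using Imax[OF xY x no] by simp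
    then have "\<forall>i\<in>{..D}. \<exists>y. y \<in> I (Y i) \<and> (x, y) \<in> F" by blast
    from bchoice[OF this] obtain y where "\<forall>i\<in>{..D}. y i \<in> I (Y i) \<and> (x, y i) \<in> F" by (rule exE)
    then have y: "y i \<in> I (Y i) \<and> (x, y i) \<in> F" if "i \<le> D" for i using that by simp
    have disj: "I (Y i) \<inter> I (Y j) = {}" if "i < j" for i j
      using Yanti[of "Suc i" j] Isub[of "Y j"] that unfolding YS by auto
    have "inj_on y {..D}"
    proof (rule inj_onI)
      fix i j assume "i \<in> {..D}" "j \<in> {..D}" "y i = y j"
      then show "i = j" using y[of i] y[of j] disj[of i j] disj[of j i] by (cases i j rule: linorder_cases) auto
    qed
    then have "Suc D = card (y ` {..D})" by (simp add: card_image)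
    also have "\<dots> \<le> card (F `` {x})" using y deg[OF x] by (intro card_mono) auto
    finally show False using deg[OF x] by simp
  qed
  define c where "c x = (LEAST i. x \<in> I (Y i))" for x
  have cI: "x \<in> I (Y (c x))" "c x \<le> D" if x: "x \<in> space M" for x
  proof -
    obtain i where i: "i \<le> D" "x \<in> I (Y i)" using cov[OF x] by blast
    show "x \<in> I (Y (c x))" unfolding c_def using i(2) by (rule LeastI)
    show "c x \<le> D" unfolding c_def using Least_le[of "\<lambda>i. x \<in> I (Y i)", OF i(2)] i(1) by simp
  qed
  have "c \<in> measurable M (count_space {..D})"
  proof (rule measurable_count_space_eq2[THEN iffD2], simp, intro conjI ballI)
    show "c \<in> space M \<rightarrow> {..D}" using cI by auto
    fix i assume "i \<in> {..D}"
    have "c x = i \<longleftrightarrow> x \<in> I (Y i) \<and> (\<forall>j<i. x \<notin> I (Y j))" if "x \<in> space M" for x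
    proof
      show "x \<in> I (Y i) \<and> (\<forall>j<i. x \<notin> I (Y j))" if "c x = i"
        using cI(1)[OF \<open>x \<in> space M\<close>] that unfolding c_def by (auto dest: not_less_Least)
      show "c x = i" if "x \<in> I (Y i) \<and> (\<forall>j<i. x \<notin> I (Y j))"
        unfolding c_def using that by (intro Least_equality) (auto simp: not_less[symmetric])
    qed
    then have "c -` {i} \<inter> space M = (I (Y i) - (\<Union>j<i. I (Y j))) \<inter> space M" by auto
    then show "c -` {i} \<inter> space M \<in> sets M" using Im[OF Ym] by auto
  qed
  moreover have "\<forall>(x, y)\<in>F. c x \<noteq> c y"
  proof safe
    fix x y assume xy: "(x, y) \<in> F" "c x = c y"
    then have "x \<in> space M" "y \<in> space M" using F(1) by auto
    then show False using cI(1)[of x] cI(1)[of y] Iind xy by metis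
  qed
  ultimately show ?thesis by blast
qed

section \<open>Balls, walks, and the label words read along walks\<close>

lemma ball_verts_0 [simp]: "ball_verts E 0 x = {x}"
  by (auto simp: ball_verts_def)

lemma ball_verts_self [simp]: "x \<in> ball_verts E r x"
  by (auto simp: ball_verts_def intro!: exI[of _ 0])

lemma ball_verts_mono: "r \<le> s \<Longrightarrow> ball_verts E r x \<subseteq> ball_verts E s x"
  by (auto simp: ball_verts_def intro: order_trans)

lemma ball_verts_trans:
  assumes "y \<in> ball_verts E r x" "z \<in> ball_verts E s y"
  shows "z \<in> ball_verts E (r + s) x"
proof -
  obtain m n where "m \<le> r" "(x, y) \<in> E ^^ m" "n \<le> s" "(y, z) \<in> E ^^ n"
    using assms by (auto simp: ball_verts_def)
  then show ?thesis unfolding ball_verts_def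
    by (intro CollectI exI[of _ "m + n"]) (auto simp: relpow_add)
qed

lemma ball_verts_edge: "(x, y) \<in> E \<Longrightarrow> y \<in> ball_verts E (Suc 0) x"
  by (auto simp: ball_verts_def intro!: exI[of _ "Suc 0"])

lemma ball_verts_Suc: "ball_verts E (Suc r) x = insert x (\<Union>y\<in>E `` {x}. ball_verts E r y)"
proof (intro equalityI subsetI)
  fix z assume "z \<in> ball_verts E (Suc r) x"
  then obtain m where m: "m \<le> Suc r" "(x, z) \<in> E ^^ m" by (auto simp: ball_verts_def)
  show "z \<in> insert x (\<Union>y\<in>E `` {x}. ball_verts E r y)"
  proof (cases m)
    case (Suc l)
    then obtain y where "(x, y) \<in> E" "(y, z) \<in> E ^^ l" using m(2) by (meson relpow_Suc_D2)
    then show ?thesis using m(1) Suc by (auto simp: ball_verts_def)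
  qed (use m in auto)
next
  fix z assume "z \<in> insert x (\<Union>y\<in>E `` {x}. ball_verts E r y)"
  then show "z \<in> ball_verts E (Suc r) x"
    using ball_verts_trans[OF ball_verts_edge, of x _ E z r] by auto
qed

lemma ball_verts_Suc': "ball_verts E (Suc r) x = ball_verts E r x \<union> E `` ball_verts E r x"
proof (intro equalityI subsetI)
  fix z assume "z \<in> ball_verts E (Suc r) x"
  then obtain m where m: "m \<le> Suc r" "(x, z) \<in> E ^^ m" by (auto simp: ball_verts_def)
  show "z \<in> ball_verts E r x \<union> E `` ball_verts E r x"
  proof (cases "m = Suc r")
    case True
    then obtain y where "(x, y) \<in> E ^^ r" "(y, z) \<in> E" using m(2) by auto
    then show ?thesis by (auto simp: ball_verts_def)
  qed (use m in \<open>auto simp: ball_verts_def\<close>)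
next
  fix z assume "z \<in> ball_verts E r x \<union> E `` ball_verts E r x"
  then show "z \<in> ball_verts E (Suc r) x"
    using ball_verts_trans[of _ E r x z 1] ball_verts_edge[of _ z E] ball_verts_mono[of r "Suc r" E x] by auto
qed

lemma relpow_sym: "sym E \<Longrightarrow> (x, y) \<in> E ^^ n \<Longrightarrow> (y, x) \<in> E ^^ n"
proof (induction n arbitrary: x y)
  case (Suc n)
  then obtain z where "(x, z) \<in> E ^^ n" "(z, y) \<in> E" by auto
  then show ?case using Suc.IH Suc.prems(1) by (meson relpow_Suc_I2 symD)
qed simp

lemma ball_verts_sym: "sym E \<Longrightarrow> y \<in> ball_verts E r x \<Longrightarrow> x \<in> ball_verts E r y"
  by (auto simp: ball_verts_def intro: relpow_sym)

lemma card_ball_verts: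
  assumes "\<And>x. finite (E `` {x}) \<and> card (E `` {x}) \<le> d"
  shows "finite (ball_verts E r x) \<and> card (ball_verts E r x) \<le> (d + 1) ^ r"
proof (induction r)
  case (Suc r)
  let ?B = "ball_verts E r x"
  have eq: "E `` ?B = (\<Union>y\<in>?B. E `` {y})" by auto
  have "finite (E `` ?B)" unfolding eq using Suc assms by blast
  moreover have "card (E `` ?B) \<le> card ?B * d"
  proof -
    have "card (E `` ?B) \<le> (\<Sum>y\<in>?B. card (E `` {y}))"
      unfolding eq using Suc by (intro card_UN_le) simp
    also have "\<dots> \<le> card ?B * d" using sum_bounded_above[of ?B "\<lambda>y. card (E `` {y})" d] assms by simp
    finally show ?thesis .
  qed
  moreover have "card (ball_verts E (Suc r) x) \<le> card ?B + card (E `` ?B)"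
    unfolding ball_verts_Suc' by (rule card_Un_le)
  moreover have "card ?B * (d + 1) \<le> (d + 1) ^ r * (d + 1)" using Suc mult_le_mono1 by blast
  ultimately show ?case using Suc by (simp add: ball_verts_Suc' algebra_simps)
qed simp

text \<open>Lists of vertices, so \<open>Suc n\<close> entries mean \<open>n\<close> steps. Shorter
  walks are included, which lets the word sets for smaller radii be recovered by a length
  bound.\<close>

definition walks :: "('v \<times> 'v) set \<Rightarrow> nat \<Rightarrow> 'v \<Rightarrow> 'v list set" where
  "walks E n x = {p. p \<noteq> [] \<and> hd p = x \<and> successively (\<lambda>u v. (u, v) \<in> E) p \<and> length p \<le> Suc n}"

definition words :: "('v \<times> 'v) set \<Rightarrow> ('v \<Rightarrow> 'l) \<Rightarrow> nat \<Rightarrow> 'v \<Rightarrow> 'l list set" where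
  "words E l n x = map l ` walks E n x"

lemma Cons_in_walks:
  "v # p \<in> walks E n x \<longleftrightarrow> v = x \<and> (p = [] \<or> (0 < n \<and> (\<exists>y. (x, y) \<in> E \<and> p \<in> walks E (n - 1) y)))"
  by (cases p) (auto simp: walks_def)

text \<open>The one-step recursion on which both the consistency check in stars and the
  measurability of word sets rest.\<close>

lemma Cons_in_words:
  "a # w \<in> words E l n x \<longleftrightarrow> a = l x \<and> (w = [] \<or> (0 < n \<and> (\<exists>y. (x, y) \<in> E \<and> w \<in> words E l (n - 1) y)))"
proof
  assume "a # w \<in> words E l n x"
  then obtain p where p: "p \<in> walks E n x" "a # w = map l p" by (auto simp: words_def)
  then obtain v q where q: "p = v # q" by (cases p) auto
  show "a = l x \<and> (w = [] \<or> (0 < n \<and> (\<exists>y. (x, y) \<in> E \<and> w \<in> words E l (n - 1) y)))"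
    using p unfolding q Cons_in_walks by (auto simp: words_def)
next
  assume "a = l x \<and> (w = [] \<or> (0 < n \<and> (\<exists>y. (x, y) \<in> E \<and> w \<in> words E l (n - 1) y)))"
  then consider "a = l x" "w = []" | y p where "a = l x" "0 < n" "(x, y) \<in> E" "p \<in> walks E (n - 1) y" "w = map l p"
    by (auto simp: words_def)
  then show "a # w \<in> words E l n x"
  proof cases
    case 1
    then show ?thesis unfolding words_def by (intro image_eqI[of _ _ "[x]"]) (auto simp: Cons_in_walks)
  next
    case 2
    then show ?thesis unfolding words_def by (intro image_eqI[of _ _ "x # p"]) (auto simp: Cons_in_walks)
  qed
qed

lemma Nil_notin_words [simp]: "[] \<notin> words E l n x"
  by (auto simp: words_def walks_def)

lemma length_words: "w \<in> words E l n x \<Longrightarrow> length w \<le> Suc n"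
  by (auto simp: words_def walks_def)

lemma last_walks: "last ` walks E n x = ball_verts E n x"
proof (induction n arbitrary: x)
  case 0
  show ?case
  proof (intro equalityI subsetI)
    fix y assume "y \<in> last ` walks E 0 x"
    then obtain p where "p \<in> walks E 0 x" "y = last p" by blast
    then show "y \<in> ball_verts E 0 x" by (cases p) (auto simp: walks_def)
  qed (auto intro!: image_eqI[of _ _ "[x]"] simp: Cons_in_walks)
next
  case (Suc n)
  show ?case
  proof (intro equalityI subsetI)
    fix z assume "z \<in> last ` walks E (Suc n) x"
    then obtain p where p: "p \<in> walks E (Suc n) x" "z = last p" by blast
    then obtain v q where q: "p = v # q" by (cases p) (auto simp: walks_def)
    show "z \<in> ball_verts E (Suc n) x"
    proof (cases "q = []")
      case False
      then obtain y where "(x, y) \<in> E" "q \<in> walks E n y" using p(1) unfolding q Cons_in_walks by auto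
      moreover have "z = last q" using p(2) q False by simp
      ultimately show ?thesis using Suc[of y] unfolding ball_verts_Suc by blast
    qed (use p q Cons_in_walks[of v q] in auto)
  next
    fix z assume "z \<in> ball_verts E (Suc n) x"
    then consider "z = x" | y where "(x, y) \<in> E" "z \<in> ball_verts E n y" unfolding ball_verts_Suc by auto
    then show "z \<in> last ` walks E (Suc n) x"
    proof cases
      case 1
      then show ?thesis by (intro image_eqI[of _ _ "[x]"]) (auto simp: Cons_in_walks)
    next
      case 2
      then obtain p where p: "p \<in> walks E n y" "z = last p" using Suc[of y] by blast
      then have "p \<noteq> []" by (auto simp: walks_def)
      then show ?thesis using p 2 by (intro image_eqI[of _ _ "x # p"]) (auto simp: Cons_in_walks)
    qed
  qed
qed

text \<open>Makes the number of labels on a ball a function of the word set; for a labelling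
  injective on the ball it is the number of vertices.\<close>

lemma last_words: "last ` words E l n x = l ` ball_verts E n x"
proof -
  have "last ` words E l n x = (\<lambda>p. l (last p)) ` walks E n x"
    unfolding words_def image_image
    by (intro image_cong refl) (auto simp: last_map walks_def)
  then show ?thesis by (simp add: last_walks[symmetric] image_image)
qed

lemma set_walks: "p \<in> walks E n x \<Longrightarrow> set p \<subseteq> insert x (E `` UNIV)"
proof (induction p arbitrary: n x)
  case (Cons v p)
  then show ?case by (fastforce simp: Cons_in_walks)
qed simp

section \<open>Graphings: Borel neighbourhoods, ball-injective colorings, edge counts\<close>

locale bounded_graphing =
  fixes d :: nat and G :: "'a graphing"
  assumes graphing: "is_graphing d G"
begin

abbreviation "M \<equiv> gmeas G"
abbreviation "E \<equiv> gedges G"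

sublocale prob_space M
  using graphing by (simp add: is_graphing_def)

lemma polish: "polish_topology (gtop G)"
  and sets_M: "sets M = borel_sets (gtop G)"
  and E_borel: "E \<in> sets (borel_algebra (prod_topology (gtop G) (gtop G)))"
  and sym_E: "sym E" and irrefl_E: "irrefl E"
  using graphing by (simp_all add: is_graphing_def)

lemma space_M: "space M = topspace (gtop G)"
  using sets_eq_imp_space_eq[OF sets_M] by simp

lemma E_space: "(x, y) \<in> E \<Longrightarrow> x \<in> space M \<and> y \<in> space M"
  using graphing unfolding is_graphing_def space_M by blast

lemma degree: "finite (E `` {x}) \<and> card (E `` {x}) \<le> d"
proof (cases "x \<in> space M")
  case True
  have "nbrs G x = E `` {x}" by (auto simp: nbrs_def)
  then show ?thesis using True graphing unfolding is_graphing_def space_M by metis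
next
  case False
  then have "E `` {x} = {}" using E_space by blast
  then show ?thesis by simp
qed

lemma finite_ball: "finite (ball_verts E r x)" and card_ball: "card (ball_verts E r x) \<le> (d + 1) ^ r"
  using card_ball_verts[of E d r x] degree by auto

lemma ball_space: "x \<in> space M \<Longrightarrow> ball_verts E r x \<subseteq> space M"
  by (induction r) (use E_space in \<open>auto simp: ball_verts_Suc'\<close>)

definition nbhd :: "'a set \<Rightarrow> 'a set" where
  "nbhd A = {x\<in>space M. \<exists>y\<in>A. (x, y) \<in> E}"

text \<open>\<open>nbhd A\<close> is the projection of the set of edges ending in \<open>A\<close>,
  a Borel set whose sections have at most \<open>d\<close> points.\<close>

lemma nbhd_measurable [measurable]:
  assumes A: "A \<in> sets M"
  shows "nbhd A \<in> sets M"
proof -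
  let ?F = "E \<inter> topspace (gtop G) \<times> A"
  have "fst ` ?F \<in> borel_sets (gtop G)"
  proof (rule borel_projection_bounded_sections[OF polish polish])
    show "?F \<in> sets (borel_algebra (prod_topology (gtop G) (gtop G)))"
      using A sets.Int[OF E_borel borel_algebra_Times[OF borel_algebra_open[OF openin_topspace]]]
      by (simp add: sets_M)
    fix x
    have sub: "{y. (x, y) \<in> ?F} \<subseteq> E `` {x}" by auto
    show "finite {y. (x, y) \<in> ?F} \<and> card {y. (x, y) \<in> ?F} \<le> d"
      using finite_subset[OF sub] card_mono[OF _ sub] degree[of x] by force
  qed
  moreover have "nbhd A = fst ` ?F"
    unfolding nbhd_def space_M using E_space space_M by force
  ultimately show ?thesis by (simp add: sets_M)
qed

definition reach :: "nat \<Rightarrow> 'a set \<Rightarrow> 'a set" where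
  "reach r A = {x\<in>space M. ball_verts E r x \<inter> A \<noteq> {}}"

lemma reach_0: "A \<subseteq> space M \<Longrightarrow> reach 0 A = A"
  by (auto simp: reach_def)

lemma reach_Suc: "A \<subseteq> space M \<Longrightarrow> reach (Suc r) A = A \<union> nbhd (reach r A)"
  using E_space by (fastforce simp: reach_def nbhd_def ball_verts_Suc)

lemma reach_measurable [measurable]: "A \<in> sets M \<Longrightarrow> reach r A \<in> sets M"
  by (induction r) (auto simp: reach_0 reach_Suc sets.sets_into_space)

text \<open>Two vertices of a common \<open>r\<close>-ball are at distance at most
  \<open>r + r\<close>. So a proper coloring of the graph \<open>F\<close> joining distinct vertices
  at that distance suffices, and the degrees of \<open>F\<close> are bounded by the size of a ball
  of radius \<open>r + r\<close>.\<close>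

lemma ex_ball_injective_coloring:
  "\<exists>c\<in>measurable M (count_space {..(d + 1) ^ (r + r)}). \<forall>x\<in>space M. inj_on c (ball_verts E r x)"
proof -
  obtain U :: "nat \<Rightarrow> 'a set" where U: "\<And>n. openin (gtop G) (U n)"
    "\<And>W x. openin (gtop G) W \<Longrightarrow> x \<in> W \<Longrightarrow> \<exists>n. x \<in> U n \<and> U n \<subseteq> W"
    using polish_countable_base[OF polish] by blast
  have t1: "closedin (gtop G) S" if "finite S" "S \<subseteq> space M" for S
    using that polish_Hausdorff[OF polish] by (simp add: closedin_Hausdorff_finite space_M)
  have Um: "U n \<in> sets M" for n unfolding sets_M by (rule borel_algebra_open[OF U(1)])
  define F where "F = {(x, y). x \<in> space M \<and> y \<in> space M \<and> x \<noteq> y \<and> y \<in> ball_verts E (r + r) x}"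
  have Fsub: "F `` {x} \<subseteq> ball_verts E (r + r) x - {x}" for x by (auto simp: F_def)
  have "\<exists>c\<in>measurable M (count_space {..(d + 1) ^ (r + r)}). \<forall>(x, y)\<in>F. c x \<noteq> c y"
  proof (rule measurable_proper_coloring[where U = U])
    show "F \<subseteq> space M \<times> space M" by (auto simp: F_def)
    show "sym F" unfolding sym_def F_def using ball_verts_sym[OF sym_E] by blast
    show "finite (F `` {x}) \<and> card (F `` {x}) \<le> (d + 1) ^ (r + r)" for x
    proof -
      have s: "F `` {x} \<subseteq> ball_verts E (r + r) x" using Fsub by blast
      show ?thesis using finite_subset[OF s finite_ball] card_mono[OF finite_ball s] card_ball order_trans by blast
    qed
    show "U n \<in> sets M" for n by (rule Um)
    fix A assume A: "A \<in> sets M"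
    \<comment> \<open>The condition \<open>x \<noteq> y\<close> is witnessed by a basic set
      containing \<open>x\<close> but not \<open>y\<close>. This turns a neighbourhood in
      \<open>F\<close> into a countable union of Borel sets formed with
      \<open>reach\<close>.\<close>
    have "{x\<in>space M. \<exists>y\<in>A. (x, y) \<in> F} = (\<Union>n. U n \<inter> reach (r + r) (A - U n))"
    proof safe
      fix x y assume xy: "x \<in> space M" "y \<in> A" "(x, y) \<in> F"
      then have y: "y \<in> space M" "x \<noteq> y" "y \<in> ball_verts E (r + r) x" by (auto simp: F_def)
      have "openin (gtop G) (topspace (gtop G) - {y})" using t1[of "{y}"] y by blast
      then obtain n where "x \<in> U n" "U n \<subseteq> topspace (gtop G) - {y}" using U(2) xy(1) y by (metis DiffI space_M singletonD)
      then show "x \<in> (\<Union>n. U n \<inter> reach (r + r) (A - U n))" using xy y unfolding reach_def by blast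
    next
      fix x n assume x: "x \<in> U n" "x \<in> reach (r + r) (A - U n)"
      then show "x \<in> space M" by (simp add: reach_def)
      from x obtain y where y: "y \<in> A" "y \<notin> U n" "y \<in> ball_verts E (r + r) x" by (auto simp: reach_def)
      then have "(x, y) \<in> F" using x \<open>x \<in> space M\<close> sets.sets_into_space[OF A] by (auto simp: F_def)
      then show "\<exists>y\<in>A. (x, y) \<in> F" using y by blast
    qed
    then show "{x\<in>space M. \<exists>y\<in>A. (x, y) \<in> F} \<in> sets M" using A Um by auto
  next
    fix x assume x: "x \<in> space M"
    have s: "F `` {x} \<subseteq> ball_verts E (r + r) x" using Fsub by blast
    have "F `` {x} \<subseteq> space M" by (auto simp: F_def)
    then have "openin (gtop G) (topspace (gtop G) - F `` {x})"
      using t1[OF finite_subset[OF s finite_ball]] by blast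
    then obtain n where "x \<in> U n" "U n \<subseteq> topspace (gtop G) - F `` {x}"
      using U(2)[of "topspace (gtop G) - F `` {x}" x] x Fsub[of x] space_M by blast
    then show "\<exists>n. x \<in> U n \<and> F `` {x} \<inter> U n = {}" by blast
  qed
  then obtain c where c: "c \<in> measurable M (count_space {..(d + 1) ^ (r + r)})" "\<forall>(x, y)\<in>F. c x \<noteq> c y" by blast
  have "inj_on c (ball_verts E r x)" if x: "x \<in> space M" for x
  proof (rule inj_onI, rule ccontr)
    fix u v assume uv: "u \<in> ball_verts E r x" "v \<in> ball_verts E r x" "c u = c v" "u \<noteq> v"
    have "v \<in> ball_verts E (r + r) u" using ball_verts_trans[OF ball_verts_sym[OF sym_E uv(1)] uv(2)] .
    then have "(u, v) \<in> F" using uv ball_space[OF x] unfolding F_def by blast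
    then show False using c(2) uv by blast
  qed
  then show ?thesis using c(1) by blast
qed

text \<open>Under a coloring that is injective on 1-balls the neighbours of \<open>x\<close> have
  distinct colors. Counting neighbours in \<open>A\<close> thus means counting colors
  \<open>a\<close> such that \<open>x\<close> has a neighbour in the part of \<open>A\<close>
  colored \<open>a\<close>.\<close>

lemma edge_count_measurable:
  assumes A: "A \<in> sets M"
  shows "(\<lambda>x. real (edge_count G x A)) \<in> borel_measurable M"
proof -
  let ?D = "(d + 1) ^ (1 + 1)"
  obtain c where c: "c \<in> measurable M (count_space {..?D})" "\<And>x. x \<in> space M \<Longrightarrow> inj_on c (ball_verts E 1 x)"
    using ex_ball_injective_coloring[of 1] by blast
  define S where "S a = A \<inter> (c -` {a} \<inter> space M)" for a
  have S: "S a \<in> sets M" if "a \<le> ?D" for a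
    unfolding S_def using A measurable_sets[OF c(1), of "{a}"] that by auto
  have eq: "real (edge_count G x A) = (\<Sum>a\<le>?D. indicat_real (nbhd (S a)) x)" if x: "x \<in> space M" for x
  proof -
    have nb: "nbrs G x \<subseteq> ball_verts E 1 x" using ball_verts_edge by (auto simp: nbrs_def)
    have "edge_count G x A = card (c ` (nbrs G x \<inter> A))"
      unfolding edge_count_def using nb
      by (intro card_image[symmetric] inj_on_subset[OF c(2)[OF x]]) auto
    also have "c ` (nbrs G x \<inter> A) = {..?D} \<inter> {a. x \<in> nbhd (S a)}"
    proof (intro equalityI subsetI)
      fix a assume "a \<in> c ` (nbrs G x \<inter> A)"
      then obtain y where "(x, y) \<in> E" "y \<in> A" "a = c y" by (auto simp: nbrs_def)
      then show "a \<in> {..?D} \<inter> {a. x \<in> nbhd (S a)}"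
        using x E_space[of x y] measurable_space[OF c(1), of y] by (auto simp: nbhd_def S_def)
    next
      fix a assume "a \<in> {..?D} \<inter> {a. x \<in> nbhd (S a)}"
      then obtain y where "(x, y) \<in> E" "y \<in> A" "a = c y" by (auto simp: nbhd_def S_def)
      then show "a \<in> c ` (nbrs G x \<inter> A)" by (auto simp: nbrs_def)
    qed
    finally show ?thesis
      by (simp only: indicator_def sum_of_bool_eq finite_atMost)
  qed
  have Sm: "nbhd (S a) \<in> sets M" if "a \<in> {..?D}" for a
    using S nbhd_measurable that by (simp only: atMost_iff)
  have "(\<lambda>x. \<Sum>a\<le>?D. indicat_real (nbhd (S a)) x) \<in> borel_measurable M"
    by (intro borel_measurable_sum borel_measurable_indicator Sm)
  then show ?thesis using measurable_cong[of M "\<lambda>x. real (edge_count G x A)", OF eq] by simp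
qed

end

section \<open>Mass transport bounds, and measurability of stars, words and ball sizes\<close>

lemma measurable_finite_valued:
  assumes "finite X" "\<And>x. x \<in> space M \<Longrightarrow> f x \<in> X"
    and "\<And>a. a \<in> X \<Longrightarrow> {x\<in>space M. f x = a} \<in> sets M"
  shows "f \<in> measurable M (count_space X)"
proof -
  have "f -` {a} \<inter> space M = {x\<in>space M. f x = a}" for a by auto
  then show ?thesis using assms by (simp add: measurable_count_space_eq2)
qed

lemma sets_space_Int_INT:
  assumes "finite I" "\<And>i. i \<in> I \<Longrightarrow> A i \<in> sets M"
  shows "space M \<inter> (\<Inter>i\<in>I. A i) \<in> sets M"
proof (cases "I = {}")
  case False
  then show ?thesis using sets.finite_INT[of I A M] assms by auto
qed simp

lemma finite_stars: "finite (stars d k)"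
proof -
  have "stars d k \<subseteq> {1..k} \<times> PiE {1..k} (\<lambda>_. {..d})"
  proof
    fix s assume "s \<in> stars d k"
    then obtain i n where s: "s = (i, n)" "i \<in> {1..k}" "n \<in> extensional {1..k}" "(\<Sum>j=1..k. n j) \<le> d"
      by (auto simp: stars_def)
    have "n j \<le> d" if "j \<in> {1..k}" for j
      using member_le_sum[of j "{1..k}" n] that s(4) by (simp del: atLeastAtMost_iff)
    then show "s \<in> {1..k} \<times> PiE {1..k} (\<lambda>_. {..d})" using s by (auto simp: PiE_def)
  qed
  moreover have "finite ({1..k} \<times> PiE {1..k} (\<lambda>_. {..d}))" by (intro finite_cartesian_product finite_PiE) auto
  ultimately show ?thesis by (rule finite_subset)
qed

definition word_set :: "'l set \<Rightarrow> nat \<Rightarrow> 'l list set" where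
  "word_set L n = {w. set w \<subseteq> L \<and> length w \<le> Suc n}"

lemma finite_word_set: "finite L \<Longrightarrow> finite (word_set L n)"
  unfolding word_set_def by (rule finite_lists_length_le)

context bounded_graphing
begin

lemma edge_count_le: "edge_count G x A \<le> d"
proof -
  have "nbrs G x = E `` {x}" by (auto simp: nbrs_def)
  then have "finite (nbrs G x)" "card (nbrs G x) \<le> d" using degree[of x] by auto
  then show ?thesis unfolding edge_count_def by (meson card_mono inf_le1 order_trans)
qed

text \<open>Mass transport between \<open>A\<close> and the whole space: each vertex of
  \<open>nbhd A\<close> sends at least one edge into \<open>A\<close>, and each vertex of
  \<open>A\<close> receives at most \<open>d\<close>.\<close>

lemma measure_nbhd_le:
  assumes A: "A \<in> sets M"
  shows "measure M (nbhd A) \<le> d * measure M A"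
proof -
  have int: "integrable M (\<lambda>x. real (edge_count G x B))" if "B \<in> sets M" for B
    by (rule integrable_const_bound[where B = d]) (use edge_count_measurable[OF that] edge_count_le in auto)
  have "measure M (nbhd A) = (LINT x|M. indicator (nbhd A) x)"
    using nbhd_measurable[OF A] sets.sets_into_space by (simp add: Int_absorb2)
  also have "\<dots> \<le> (LINT x:space M|M. real (edge_count G x A))"
    unfolding set_lebesgue_integral_def
  proof (rule integral_mono)
    show "integrable M (indicat_real (nbhd A))"
      by (rule integrable_real_indicator[OF nbhd_measurable[OF A]]) (simp add: emeasure_eq_measure)
    show "integrable M (\<lambda>x. indicat_real (space M) x *\<^sub>R real (edge_count G x A))"
      using integrable_mult_indicator[OF sets.top int[OF A]] .
    fix x assume x: "x \<in> space M"
    show "indicat_real (nbhd A) x \<le> indicat_real (space M) x *\<^sub>R real (edge_count G x A)"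
    proof (cases "x \<in> nbhd A")
      case True
      then have "nbrs G x \<inter> A \<noteq> {}" by (auto simp: nbhd_def nbrs_def)
      moreover have "finite (nbrs G x)" using degree[of x] by (auto simp: nbrs_def Image_def)
      ultimately have "edge_count G x A \<ge> 1" by (simp add: edge_count_def Suc_le_eq card_gt_0_iff)
      then show ?thesis using x True by simp
    qed (use x in simp)
  qed
  also have "\<dots> = (LINT x:A|M. real (edge_count G x (space M)))"
    using graphing A unfolding is_graphing_def by blast
  also have "\<dots> \<le> (LINT x|M. real d * indicat_real A x)"
    unfolding set_lebesgue_integral_def
  proof (rule integral_mono)
    show "integrable M (\<lambda>x. indicat_real A x *\<^sub>R real (edge_count G x (space M)))"
      using integrable_mult_indicator[OF A int[OF sets.top]] .
    show "integrable M (\<lambda>x. d * indicat_real A x)"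
      by (intro integrable_mult_right integrable_real_indicator[OF A]) (simp add: emeasure_eq_measure)
    show "indicat_real A x *\<^sub>R real (edge_count G x (space M)) \<le> d * indicat_real A x" for x
      using edge_count_le[of x "space M"] by (simp add: indicator_def)
  qed
  also have "\<dots> = d * measure M A"
    using A sets.sets_into_space[OF A] by (simp add: Int_absorb2)
  finally show ?thesis .
qed

text \<open>Bounds the set of vertices that see a rare defect within \<open>r\<close> steps, by
  iterating the bound for one step.\<close>

lemma measure_reach_le:
  assumes A: "A \<in> sets M"
  shows "measure M (reach r A) \<le> (d + 1) ^ r * measure M A"
proof (induction r)
  case 0
  then show ?case using reach_0[OF sets.sets_into_space[OF A]] by simp
next
  case (Suc r)
  have "measure M (reach (Suc r) A) \<le> measure M A + measure M (nbhd (reach r A))"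
    unfolding reach_Suc[OF sets.sets_into_space[OF A]]
    by (intro measure_Un_le A nbhd_measurable reach_measurable)
  also have "\<dots> \<le> measure M A + d * ((d + 1) ^ r * measure M A)"
    using measure_nbhd_le[OF reach_measurable[OF A], of r] mult_left_mono[OF Suc, of "real d"] by simp
  also have "\<dots> \<le> (d + 1) ^ r * measure M A + d * ((d + 1) ^ r * measure M A)"
    using mult_right_mono[of 1 "real (d + 1) ^ r" "measure M A"] by simp
  also have "\<dots> = (d + 1) ^ Suc r * measure M A" by (simp add: algebra_simps)
  finally show ?case .
qed

lemma coloring_range: "f \<in> colorings k G \<Longrightarrow> x \<in> space M \<Longrightarrow> f x \<in> {1..k}"
  using measurable_space[of f M "count_space {1..k}" x] by (simp add: colorings_def)

lemma coloring_vimage: "f \<in> colorings k G \<Longrightarrow> {x\<in>space M. f x = j} \<in> sets M"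
proof -
  assume f: "f \<in> colorings k G"
  show "{x\<in>space M. f x = j} \<in> sets M"
  proof (cases "j \<in> {1..k}")
    case True
    then have "f -` {j} \<inter> space M \<in> sets M"
      using f measurable_sets[of f M "count_space {1..k}" "{j}"] by (simp add: colorings_def)
    moreover have "f -` {j} \<inter> space M = {x\<in>space M. f x = j}" by auto
    ultimately show ?thesis by simp
  next
    case False
    then have "{x\<in>space M. f x = j} = {}" using coloring_range[OF f] by blast
    then show ?thesis by (simp only: sets.empty_sets)
  qed
qed

lemma star_type_measurable:
  assumes f: "f \<in> colorings k G"
  shows "star_type k G f \<in> measurable M (count_space (stars d k))"
proof (rule measurable_finite_valued[OF finite_stars])
  have fin: "finite (nbrs G x)" "card (nbrs G x) \<le> d" for x
    using degree[of x] by (auto simp: nbrs_def Image_def)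
  fix x assume x: "x \<in> space M"
  have "(\<Sum>j=1..k. card {y \<in> nbrs G x. f y = j}) = card (\<Union>j\<in>{1..k}. {y \<in> nbrs G x. f y = j})"
    using fin by (intro card_UN_disjoint[symmetric]) auto
  also have "\<dots> \<le> card (nbrs G x)" using fin by (intro card_mono) auto
  finally show "star_type k G f x \<in> stars d k"
    using fin(2)[of x] coloring_range[OF f x] by (auto simp: star_type_def stars_def)
next
  fix s assume "s \<in> stars d k"
  then obtain i n where s: "s = (i, n)" "n \<in> extensional {1..k}" by (auto simp: stars_def)
  define F where "F j = {x\<in>space M. f x = j}" for j
  have F: "F j \<in> sets M" for j unfolding F_def by (rule coloring_vimage[OF f])
  have cF: "card {y \<in> nbrs G x. f y = j} = edge_count G x (F j)" for x j
    unfolding edge_count_def F_def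
    using E_space by (intro arg_cong[of _ _ card]) (auto simp: nbrs_def)
  have "{x\<in>space M. star_type k G f x = s} = F i \<inter> (space M \<inter> (\<Inter>j\<in>{1..k}. {x\<in>space M. real (edge_count G x (F j)) = real (n j)}))"
  proof -
    have "(\<lambda>j\<in>{1..k}. card {y \<in> nbrs G x. f y = j}) = n \<longleftrightarrow> (\<forall>j\<in>{1..k}. real (edge_count G x (F j)) = real (n j))" for x
      using s(2) unfolding cF by (auto simp: fun_eq_iff extensional_def restrict_def)
    then show ?thesis unfolding s star_type_def F_def by auto
  qed
  moreover have "{x\<in>space M. real (edge_count G x (F j)) = real (n j)} \<in> sets M" for j
    using edge_count_measurable[OF F] by measurable
  ultimately show "{x\<in>space M. star_type k G f x = s} \<in> sets M"
    by (simp only:) (intro sets.Int F sets_space_Int_INT finite_atLeastAtMost)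
qed

lemma walks_space: "x \<in> space M \<Longrightarrow> p \<in> walks E n x \<Longrightarrow> set p \<subseteq> space M"
  using set_walks[of p E n x] E_space by blast

lemma words_subset:
  assumes "\<And>y. y \<in> space M \<Longrightarrow> l y \<in> L" "x \<in> space M"
  shows "words E l n x \<subseteq> word_set L n"
  using walks_space[OF assms(2)] assms(1) length_words[of _ E l n x]
  by (fastforce simp: words_def word_set_def)

text \<open>Induction on the word: reading a longer word means carrying its first label and having a
  neighbour that reads the rest, and the latter is a \<open>nbhd\<close> set.\<close>

lemma in_words_measurable:
  assumes l: "\<And>a. {x\<in>space M. l x = a} \<in> sets M"
  shows "{x\<in>space M. w \<in> words E l n x} \<in> sets M"
proof (induction w arbitrary: n)
  case (Cons a w)
  show ?case
  proof (cases "w = []")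
    case True
    then have "{x\<in>space M. a # w \<in> words E l n x} = {x\<in>space M. l x = a}"
      by (auto simp: Cons_in_words)
    then show ?thesis using l by simp
  next
    case False
    show ?thesis
    proof (cases "0 < n")
      case True
      have "{x\<in>space M. a # w \<in> words E l n x} =
        {x\<in>space M. l x = a} \<inter> nbhd {x\<in>space M. w \<in> words E l (n - 1) x}"
        using True False E_space by (auto simp: Cons_in_words nbhd_def)
      then show ?thesis using l Cons nbhd_measurable by auto
    qed (use False in \<open>simp add: Cons_in_words\<close>)
  qed
qed simp

lemma words_measurable:
  assumes L: "finite L" and l: "l \<in> measurable M (count_space L)"
  shows "words E l n \<in> measurable M (count_space (Pow (word_set L n)))"
proof (rule measurable_finite_valued)
  have lL: "l y \<in> L" if "y \<in> space M" for y using measurable_space[OF l that] by simp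
  have lm: "{x\<in>space M. l x = a} \<in> sets M" for a
  proof (cases "a \<in> L")
    case True
    have "{x\<in>space M. l x = a} = l -` {a} \<inter> space M" by auto
    then show ?thesis using measurable_sets[OF l, of "{a}"] True by simp
  next
    case False
    then have "{x\<in>space M. l x = a} = {}" using lL by blast
    then show ?thesis by (simp only: sets.empty_sets)
  qed
  show "finite (Pow (word_set L n))" using finite_word_set[OF L] by simp
  show sub: "words E l n x \<in> Pow (word_set L n)" if "x \<in> space M" for x
    using words_subset[of l L x n, OF lL that] by simp
  fix W assume "W \<in> Pow (word_set L n)"
  then have W: "W \<subseteq> word_set L n" by simp
  let ?T = "\<lambda>w. {x\<in>space M. w \<in> words E l n x \<longleftrightarrow> w \<in> W}"
  have "words E l n x = W \<longleftrightarrow> (\<forall>w\<in>word_set L n. w \<in> words E l n x \<longleftrightarrow> w \<in> W)" if "x \<in> space M" for x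
    using sub[OF that] W by blast
  then have "{x\<in>space M. words E l n x = W} = space M \<inter> (\<Inter>w\<in>word_set L n. ?T w)"
    by auto
  moreover have "?T w \<in> sets M" for w
  proof (cases "w \<in> W")
    case True
    then show ?thesis using in_words_measurable[OF lm] by simp
  next
    case False
    then have "?T w = space M - {x\<in>space M. w \<in> words E l n x}" by auto
    then show ?thesis using in_words_measurable[OF lm] by simp
  qed
  then have "space M \<inter> (\<Inter>w\<in>word_set L n. ?T w) \<in> sets M"
    by (intro sets_space_Int_INT finite_word_set L)
  ultimately show "{x\<in>space M. words E l n x = W} \<in> sets M" by simp
qed

text \<open>The size of a ball is the number of end labels of the words of a ball-injective
  coloring, hence a function of a measurable word set.\<close>

lemma card_ball_measurable: "(\<lambda>x. real (card (ball_verts E r x))) \<in> borel_measurable M"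
proof -
  let ?L = "{..(d + 1) ^ (r + r)}"
  obtain c where c: "c \<in> measurable M (count_space ?L)" "\<And>x. x \<in> space M \<Longrightarrow> inj_on c (ball_verts E r x)"
    using ex_ball_injective_coloring by blast
  have "(\<lambda>x. real (card (last ` words E c r x))) \<in> borel_measurable M"
    by (rule measurable_compose[OF words_measurable[OF _ c(1)], of "\<lambda>W. real (card (last ` W))"]) auto
  moreover have "card (last ` words E c r x) = card (ball_verts E r x)" if "x \<in> space M" for x
    unfolding last_words using card_image[OF c(2)[OF that]] .
  ultimately show ?thesis
    using measurable_cong[of M "\<lambda>x. real (card (last ` words E c r x))" "\<lambda>x. real (card (ball_verts E r x))"] by simp
qed

end


section \<open>Total variation and Hausdorff distance\<close>

lemma (in prob_space) distr_count_space:
  assumes "f \<in> measurable M (count_space X)"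
  shows "distr M (count_space X) f \<in> prob_simplex X"
    and "a \<in> X \<Longrightarrow> measure (distr M (count_space X) f) {a} = prob {x\<in>space M. f x = a}"
proof -
  show "distr M (count_space X) f \<in> prob_simplex X"
    using prob_space_distr[OF assms] by (simp add: prob_simplex_def)
  have "f -` {a} \<inter> space M = {x\<in>space M. f x = a}" by auto
  then show "a \<in> X \<Longrightarrow> measure (distr M (count_space X) f) {a} = prob {x\<in>space M. f x = a}"
    using assms by (simp add: measure_distr)
qed

lemma measurable_count_space_sets:
  assumes "f \<in> measurable M (count_space X)"
  shows "{x\<in>space M. f x \<in> S} \<in> sets M"
proof -
  have "{x\<in>space M. f x \<in> S} = f -` (S \<inter> X) \<inter> space M"
    using measurable_space[OF assms] by auto
  then show ?thesis using measurable_sets[OF assms, of "S \<inter> X"] by simp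
qed

lemma measurable_count_space_neq:
  assumes f: "f \<in> measurable M (count_space X)" and g: "g \<in> measurable M (count_space X)" and "finite X"
  shows "{x\<in>space M. f x \<noteq> g x} \<in> sets M"
proof -
  have "{x\<in>space M. f x \<noteq> g x} = (\<Union>a\<in>X. {x\<in>space M. f x \<in> {a}} - {x\<in>space M. g x \<in> {a}})"
    using measurable_space[OF f] measurable_space[OF g] by auto
  then show ?thesis
    using measurable_count_space_sets[OF f] measurable_count_space_sets[OF g] assms(3)
    by (simp only:) (intro sets.finite_UN sets.Diff; blast)
qed

lemma (in prob_space) prob_finite_valued:
  assumes f: "f \<in> measurable M (count_space X)" and "finite X" "A \<in> sets M"
  shows "prob {x\<in>A. f x \<in> S} = (\<Sum>a\<in>X \<inter> S. prob {x\<in>A. f x = a})"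
proof -
  have AM: "A \<subseteq> space M" by (rule sets.sets_into_space[OF assms(3)])
  have "prob (\<Union>a\<in>X \<inter> S. {x\<in>A. f x = a}) = (\<Sum>a\<in>X \<inter> S. prob {x\<in>A. f x = a})"
  proof (rule finite_measure_finite_Union)
    show "(\<lambda>a. {x\<in>A. f x = a}) ` (X \<inter> S) \<subseteq> sets M"
    proof safe
      fix a
      have "{x\<in>A. f x = a} = A \<inter> {x\<in>space M. f x \<in> {a}}" using AM by auto
      then show "{x\<in>A. f x = a} \<in> sets M" using measurable_count_space_sets[OF f] assms(3) by (metis sets.Int)
    qed
  qed (use assms(2) in \<open>auto simp: disjoint_family_on_def\<close>)
  moreover have "(\<Union>a\<in>X \<inter> S. {x\<in>A. f x = a}) = {x\<in>A. f x \<in> S}"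
    using AM measurable_space[OF f] by fastforce
  ultimately show ?thesis by simp
qed

definition law :: "'a measure \<Rightarrow> ('a \<Rightarrow> 'b) \<Rightarrow> 'b \<Rightarrow> real" where
  "law M f a = measure M {x\<in>space M. f x = a}"

abbreviation law_dist :: "'b set \<Rightarrow> 'a measure \<Rightarrow> ('a \<Rightarrow> 'b) \<Rightarrow> 'c measure \<Rightarrow> ('c \<Rightarrow> 'b) \<Rightarrow> real" where
  "law_dist X M f N g \<equiv> dTV X (distr M (count_space X) f) (distr N (count_space X) g)"

lemma dTV_distr:
  assumes "prob_space M" "prob_space N" "f \<in> measurable M (count_space X)" "g \<in> measurable N (count_space X)"
  shows "law_dist X M f N g = (\<Sum>a\<in>X. \<bar>law M f a - law N g a\<bar>) / 2"
  unfolding dTV_def law_def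
  using prob_space.distr_count_space(2)[OF assms(1,3)] prob_space.distr_count_space(2)[OF assms(2,4)] by simp

text \<open>A push-forward does not increase total variation: the fibres of \<open>\<psi>\<close>
  are disjoint, and the triangle inequality applies on each of them.\<close>

lemma dTV_distr_compose_le:
  assumes MN: "prob_space M" "prob_space N" and fg: "f \<in> measurable M (count_space X)" "g \<in> measurable N (count_space X)"
    and fin: "finite X" "finite X'" and \<psi>: "\<And>x. x \<in> space M \<Longrightarrow> \<psi> (f x) \<in> X'" "\<And>x. x \<in> space N \<Longrightarrow> \<psi> (g x) \<in> X'"
  shows "law_dist X' M (\<lambda>x. \<psi> (f x)) N (\<lambda>x. \<psi> (g x))
    \<le> law_dist X M f N g"
proof -
  interpret M: prob_space M by fact
  interpret N: prob_space N by fact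
  have m: "(\<lambda>x. \<psi> (f x)) \<in> measurable M (count_space X')"
  proof (rule measurable_finite_valued[OF fin(2) \<psi>(1)])
    show "{x\<in>space M. \<psi> (f x) = a} \<in> sets M" for a
      using measurable_count_space_sets[OF fg(1), of "\<psi> -` {a}"] by simp
  qed
  have n: "(\<lambda>x. \<psi> (g x)) \<in> measurable N (count_space X')"
  proof (rule measurable_finite_valued[OF fin(2) \<psi>(2)])
    show "{x\<in>space N. \<psi> (g x) = a} \<in> sets N" for a
      using measurable_count_space_sets[OF fg(2), of "\<psi> -` {a}"] by simp
  qed
  have lm: "law M (\<lambda>x. \<psi> (f x)) b = (\<Sum>a\<in>X \<inter> \<psi> -` {b}. law M f a)" for b
    using M.prob_finite_valued[OF fg(1) fin(1) sets.top, of "\<psi> -` {b}"] by (simp add: law_def)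
  have ln: "law N (\<lambda>x. \<psi> (g x)) b = (\<Sum>a\<in>X \<inter> \<psi> -` {b}. law N g a)" for b
    using N.prob_finite_valued[OF fg(2) fin(1) sets.top, of "\<psi> -` {b}"] by (simp add: law_def)
  have "(\<Sum>b\<in>X'. \<bar>law M (\<lambda>x. \<psi> (f x)) b - law N (\<lambda>x. \<psi> (g x)) b\<bar>)
      \<le> (\<Sum>b\<in>X'. \<Sum>a\<in>X \<inter> \<psi> -` {b}. \<bar>law M f a - law N g a\<bar>)"
    unfolding lm ln sum_subtractf[symmetric] by (intro sum_mono sum_abs)
  also have "\<dots> = (\<Sum>a\<in>(\<Union>b\<in>X'. X \<inter> \<psi> -` {b}). \<bar>law M f a - law N g a\<bar>)"
    using fin by (intro sum.UNION_disjoint[symmetric]) auto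
  also have "\<dots> \<le> (\<Sum>a\<in>X. \<bar>law M f a - law N g a\<bar>)"
    using fin by (intro sum_mono2) auto
  finally show ?thesis unfolding dTV_distr[OF MN m n] dTV_distr[OF MN fg] by simp
qed

text \<open>The coupling inequality. Where \<open>f\<close> and \<open>g\<close> agree, they
  contribute equally to both laws.\<close>

lemma dTV_distr_same_space:
  assumes M: "prob_space M" and f: "f \<in> measurable M (count_space X)" and g: "g \<in> measurable M (count_space X)"
    and fin: "finite X"
  shows "law_dist X M f M g \<le> measure M {x\<in>space M. f x \<noteq> g x}"
proof -
  interpret prob_space M by fact
  let ?N = "{x\<in>space M. f x \<noteq> g x}"
  have N: "?N \<in> sets M" by (rule measurable_count_space_neq[OF f g fin])
  have s: "{x\<in>space M. f x = a} \<in> sets M" "{x\<in>space M. g x = a} \<in> sets M" for a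
    using measurable_count_space_sets[OF f, of "{a}"] measurable_count_space_sets[OF g, of "{a}"] by auto
  have Nf: "{x\<in>?N. f x = a} \<in> sets M" and Ng: "{x\<in>?N. g x = a} \<in> sets M" for a
  proof -
    have "{x\<in>?N. f x = a} = ?N \<inter> {x\<in>space M. f x = a}" by auto
    then show "{x\<in>?N. f x = a} \<in> sets M" using sets.Int[OF N s(1)] by simp
    have "{x\<in>?N. g x = a} = ?N \<inter> {x\<in>space M. g x = a}" by auto
    then show "{x\<in>?N. g x = a} \<in> sets M" using sets.Int[OF N s(2)] by simp
  qed
  have "\<bar>law M f a - law M g a\<bar> \<le> prob {x\<in>?N. f x = a} + prob {x\<in>?N. g x = a}" for a
  proof -
    have "law M f a \<le> prob ({x\<in>space M. g x = a} \<union> {x\<in>?N. f x = a})"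
      unfolding law_def by (intro finite_measure_mono sets.Un s Nf) auto
    also have "\<dots> \<le> law M g a + prob {x\<in>?N. f x = a}"
      unfolding law_def by (intro measure_Un_le s Nf)
    finally have 1: "law M f a \<le> law M g a + prob {x\<in>?N. f x = a}" .
    have "law M g a \<le> prob ({x\<in>space M. f x = a} \<union> {x\<in>?N. g x = a})"
      unfolding law_def by (intro finite_measure_mono sets.Un s Ng) auto
    also have "\<dots> \<le> law M f a + prob {x\<in>?N. g x = a}"
      unfolding law_def by (intro measure_Un_le s Ng)
    finally show ?thesis
      using 1 measure_nonneg[of M "{x\<in>?N. f x = a}"] measure_nonneg[of M "{x\<in>?N. g x = a}"] by linarith
  qed
  then have "(\<Sum>a\<in>X. \<bar>law M f a - law M g a\<bar>) \<le> (\<Sum>a\<in>X. prob {x\<in>?N. f x = a} + prob {x\<in>?N. g x = a})"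
    by (rule sum_mono)
  also have "\<dots> = 2 * prob ?N"
    using prob_finite_valued[OF f fin N, of UNIV] prob_finite_valued[OF g fin N, of UNIV]
    by (simp add: sum.distrib)
  finally show ?thesis unfolding dTV_distr[OF M M f g] by simp
qed

text \<open>The factor 2 undoes the 1/2 in \<open>dTV\<close>: the difference is bounded by the full
  sum of absolute differences.\<close>

lemma prob_diff_le_dTV:
  assumes MN: "prob_space M" "prob_space N" and fg: "f \<in> measurable M (count_space X)" "g \<in> measurable N (count_space X)"
    and fin: "finite X"
  shows "measure M {x\<in>space M. f x \<in> S} \<le> measure N {x\<in>space N. g x \<in> S}
    + 2 * law_dist X M f N g"
proof -
  have "measure M {x\<in>space M. f x \<in> S} - measure N {x\<in>space N. g x \<in> S} = (\<Sum>a\<in>X \<inter> S. law M f a - law N g a)"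
    using prob_space.prob_finite_valued[OF MN(1) fg(1) fin sets.top, of S] prob_space.prob_finite_valued[OF MN(2) fg(2) fin sets.top, of S]
    by (simp add: law_def sum_subtractf)
  also have "\<dots> \<le> (\<Sum>a\<in>X \<inter> S. \<bar>law M f a - law N g a\<bar>)" by (intro sum_mono) auto
  also have "\<dots> \<le> (\<Sum>a\<in>X. \<bar>law M f a - law N g a\<bar>)" using fin by (intro sum_mono2) auto
  finally show ?thesis unfolding dTV_distr[OF MN fg] by simp
qed

lemma (in prob_space) integral_finite_valued:
  fixes h :: "'b \<Rightarrow> real"
  assumes f: "f \<in> measurable M (count_space X)" and fin: "finite X"
  shows "integrable M (\<lambda>x. h (f x))" "(LINT x|M. h (f x)) = (\<Sum>a\<in>X. h a * law M f a)"
proof -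
  have s: "{x\<in>space M. f x = a} \<in> sets M" for a
    using measurable_count_space_sets[OF f, of "{a}"] by auto
  have eq: "h (f x) = (\<Sum>a\<in>X. h a * indicator {x\<in>space M. f x = a} x)" if x: "x \<in> space M" for x
  proof -
    have "(\<Sum>a\<in>X. h a * indicator {x\<in>space M. f x = a} x) = (\<Sum>a\<in>X. if f x = a then h a else 0)"
      using x by (intro sum.cong) (auto simp: indicator_def)
    then show ?thesis using fin measurable_space[OF f x] by simp
  qed
  have int: "integrable M (\<lambda>x. h a * indicat_real {x\<in>space M. f x = a} x)" for a
    using s by (intro integrable_mult_right integrable_real_indicator) (auto simp: emeasure_eq_measure)
  have "integrable M (\<lambda>x. \<Sum>a\<in>X. h a * indicat_real {x\<in>space M. f x = a} x)"
    by (intro Bochner_Integration.integrable_sum int)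
  then show "integrable M (\<lambda>x. h (f x))"
    using Bochner_Integration.integrable_cong[OF refl eq, of M "\<lambda>x. x"] by simp
  have "(LINT x|M. h (f x)) = (LINT x|M. (\<Sum>a\<in>X. h a * indicat_real {x\<in>space M. f x = a} x))"
    by (intro Bochner_Integration.integral_cong refl eq)
  also have "\<dots> = (\<Sum>a\<in>X. LINT x|M. h a * indicat_real {x\<in>space M. f x = a} x)"
    by (intro Bochner_Integration.integral_sum int)
  also have "\<dots> = (\<Sum>a\<in>X. h a * law M f a)"
    using s by (simp add: law_def Int_absorb2)
  finally show "(LINT x|M. h (f x)) = (\<Sum>a\<in>X. h a * law M f a)" .
qed

lemma integral_diff_le_dTV:
  fixes h :: "'b \<Rightarrow> real"
  assumes MN: "prob_space M" "prob_space N" and fg: "f \<in> measurable M (count_space X)" "g \<in> measurable N (count_space X)"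
    and fin: "finite X" and h: "\<And>a. a \<in> X \<Longrightarrow> \<bar>h a\<bar> \<le> B"
  shows "(LINT x|M. h (f x)) \<le> (LINT x|N. h (g x))
    + 2 * B * law_dist X M f N g"
proof -
  have "(LINT x|M. h (f x)) - (LINT x|N. h (g x)) = (\<Sum>a\<in>X. h a * (law M f a - law N g a))"
    unfolding prob_space.integral_finite_valued(2)[OF MN(1) fg(1) fin]
      prob_space.integral_finite_valued(2)[OF MN(2) fg(2) fin]
    by (simp add: sum_subtractf right_diff_distrib)
  also have "\<dots> \<le> (\<Sum>a\<in>X. B * \<bar>law M f a - law N g a\<bar>)"
  proof (rule sum_mono)
    fix a assume "a \<in> X"
    have "h a * (law M f a - law N g a) \<le> \<bar>h a\<bar> * \<bar>law M f a - law N g a\<bar>"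
      by (metis abs_ge_self abs_mult)
    also have "\<dots> \<le> B * \<bar>law M f a - law N g a\<bar>" using h[OF \<open>a \<in> X\<close>] by (intro mult_right_mono) auto
    finally show "h a * (law M f a - law N g a) \<le> B * \<bar>law M f a - law N g a\<bar>" .
  qed
  finally show ?thesis unfolding dTV_distr[OF MN fg] by (simp add: sum_distrib_left[symmetric])
qed

section \<open>Compactness of the simplex and Hausdorff convergence of closures\<close>

lemma dTV_nonneg: "0 \<le> dTV X \<mu> \<mu>'"
  by (simp add: dTV_def sum_nonneg)

lemma dTV_commute: "dTV X \<mu> \<mu>' = dTV X \<mu>' \<mu>"
  by (simp add: dTV_def abs_minus_commute)

lemma dTV_triangle: "dTV X \<mu>1 \<mu>3 \<le> dTV X \<mu>1 \<mu>2 + dTV X \<mu>2 \<mu>3"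
  unfolding dTV_def add_divide_distrib[symmetric] sum.distrib[symmetric]
  by (intro divide_right_mono sum_mono) auto

text \<open>A crude bound whose purpose is to make the suprema in \<open>hausdorff_dist\<close>
  suprema of bounded sets.\<close>

lemma dTV_le_card:
  assumes "\<mu> \<in> prob_simplex X" "\<mu>' \<in> prob_simplex X"
  shows "dTV X \<mu> \<mu>' \<le> card X"
proof -
  interpret m: prob_space \<mu> + m': prob_space \<mu>' using assms by (auto simp: prob_simplex_def)
  have "\<bar>measure \<mu> {a} - measure \<mu>' {a}\<bar> \<le> 1" for a
    using m.prob_le_1[of "{a}"] m'.prob_le_1[of "{a}"] measure_nonneg[of \<mu> "{a}"] measure_nonneg[of \<mu>' "{a}"] by linarith
  then have "(\<Sum>a\<in>X. \<bar>measure \<mu> {a} - measure \<mu>' {a}\<bar>) \<le> card X * 1"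
    by (metis (no_types, lifting) sum_bounded_above of_nat_mult mult.right_neutral)
  then show ?thesis by (simp add: dTV_def)
qed

lemma finite_subseq_convergent:
  fixes p :: "nat \<Rightarrow> 'b \<Rightarrow> real"
  assumes "finite A" "\<And>n a. \<bar>p n a\<bar> \<le> 1"
  shows "\<exists>s::nat\<Rightarrow>nat. strict_mono s \<and> (\<forall>a\<in>A. convergent (\<lambda>n. p (s n) a))"
  using assms(1)
proof (induction A)
  case empty
  then show ?case by (intro exI[of _ id]) (auto simp: strict_mono_def)
next
  case (insert b A)
  then obtain s :: "nat \<Rightarrow> nat" where s: "strict_mono s" "\<And>a. a \<in> A \<Longrightarrow> convergent (\<lambda>n. p (s n) a)" by auto
  have "bounded (range (\<lambda>n. p (s n) b))"
    unfolding bounded_iff using assms(2) by (intro exI[of _ 1]) auto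
  then obtain l t where t: "strict_mono t" "((\<lambda>n. p (s n) b) \<circ> t) \<longlonglongrightarrow> l"
    using bounded_imp_convergent_subsequence by blast
  have "convergent (\<lambda>n. p (s (t n)) a)" if "a \<in> insert b A" for a
  proof (cases "a = b")
    case True
    then show ?thesis using t(2) by (auto simp: convergent_def o_def)
  next
    case False
    then show ?thesis using convergent_subseq_convergent[OF s(2) t(1), of a] that by (simp add: o_def)
  qed
  then show ?case using strict_mono_o[OF s(1) t(1)] by (intro exI[of _ "s \<circ> t"]) (simp add: o_def)
qed

lemma prob_simplex_sum: "\<mu> \<in> prob_simplex X \<Longrightarrow> finite X \<Longrightarrow> (\<Sum>a\<in>X. measure \<mu> {a}) = 1"
proof -
  assume mu: "\<mu> \<in> prob_simplex X" and fin: "finite X"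
  interpret prob_space \<mu> using mu by (simp add: prob_simplex_def)
  have sets: "sets \<mu> = Pow X" using mu by (simp add: prob_simplex_def)
  then have "space \<mu> = X" using sets.sets_into_space[of X \<mu>] sets.top[of \<mu>] by auto
  then show ?thesis
    using finite_measure_eq_sum_singleton[OF fin] sets prob_space by auto
qed

text \<open>Bolzano-Weierstrass in finitely many coordinates. Finite sums pass to the limit, so no
  mass is lost.\<close>

lemma prob_simplex_seq_compact:
  assumes fin: "finite X" and \<mu>: "\<And>n. \<mu> n \<in> prob_simplex X"
  shows "\<exists>(s::nat\<Rightarrow>nat) c. strict_mono s \<and> c \<in> prob_simplex X \<and> (\<lambda>n. dTV X (\<mu> (s n)) c) \<longlonglongrightarrow> 0"
proof -
  have le1: "\<bar>measure (\<mu> n) {a}\<bar> \<le> 1" for n a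
  proof -
    interpret prob_space "\<mu> n" using \<mu>[of n] by (simp add: prob_simplex_def)
    show ?thesis by simp
  qed
  obtain s :: "nat \<Rightarrow> nat" where s: "strict_mono s" "\<And>a. a \<in> X \<Longrightarrow> convergent (\<lambda>n. measure (\<mu> (s n)) {a})"
    using finite_subseq_convergent[OF fin, of "\<lambda>n a. measure (\<mu> n) {a}"] le1 by blast
  define l where "l a = lim (\<lambda>n. measure (\<mu> (s n)) {a})" for a
  have l: "(\<lambda>n. measure (\<mu> (s n)) {a}) \<longlonglongrightarrow> l a" if "a \<in> X" for a
    using s(2)[OF that] unfolding l_def by (simp add: convergent_LIMSEQ_iff)
  have l0: "l a \<ge> 0" if "a \<in> X" for a
    using LIMSEQ_le_const[OF l[OF that]] by simp
  have "(\<lambda>n. \<Sum>a\<in>X. measure (\<mu> (s n)) {a}) \<longlonglongrightarrow> (\<Sum>a\<in>X. l a)"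
    by (intro tendsto_sum l)
  then have l1: "(\<Sum>a\<in>X. l a) = 1"
    using prob_simplex_sum[OF \<mu> fin] by (simp add: LIMSEQ_const_iff)
  define c where "c = point_measure X (\<lambda>a. ennreal (l a))"
  have "emeasure c (space c) = 1"
    unfolding c_def using fin l0 l1 by (simp add: emeasure_point_measure_finite space_point_measure sum_ennreal)
  then have "prob_space c" by (rule prob_spaceI)
  then have cs: "c \<in> prob_simplex X" by (simp add: prob_simplex_def c_def sets_point_measure)
  have cm: "measure c {a} = l a" if "a \<in> X" for a
    unfolding c_def using fin that l0 by (simp add: measure_def emeasure_point_measure_finite)
  have "(\<lambda>n. (\<Sum>a\<in>X. \<bar>measure (\<mu> (s n)) {a} - l a\<bar>) / 2) \<longlonglongrightarrow> (\<Sum>a\<in>X. \<bar>l a - l a\<bar>) / 2"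
    by (intro tendsto_intros l) auto
  then have "(\<lambda>n. dTV X (\<mu> (s n)) c) \<longlonglongrightarrow> 0" using cm by (simp add: dTV_def)
  then show ?thesis using s(1) cs by blast
qed

lemma hausdorff_dist_lessD:
  assumes A: "A \<noteq> {}" "A \<subseteq> prob_simplex X" and B: "B \<noteq> {}" "B \<subseteq> prob_simplex X"
    and less: "hausdorff_dist X A B < e"
  shows "p \<in> A \<Longrightarrow> \<exists>q\<in>B. dTV X p q < e" and "p \<in> B \<Longrightarrow> \<exists>q\<in>A. dTV X p q < e"
proof -
  have *: "\<exists>q\<in>B. dTV X p q < e" if p: "p \<in> A"
    and A: "A \<subseteq> prob_simplex X" and B: "B \<noteq> {}" "B \<subseteq> prob_simplex X"
    and less: "(SUP p\<in>A. INF q\<in>B. dTV X p q) < e" for A B p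
  proof -
    have bb: "bdd_below ((\<lambda>q. dTV X p q) ` B)" for p by (rule bdd_belowI2[of _ 0]) (rule dTV_nonneg)
    have "bdd_above ((\<lambda>p. INF q\<in>B. dTV X p q) ` A)"
    proof (rule bdd_aboveI2[where M = "real (card X)"])
      fix p assume "p \<in> A"
      obtain q where m': "q \<in> B" using B(1) by blast
      have "(INF q\<in>B. dTV X p q) \<le> dTV X p q" by (rule cINF_lower[OF bb m'])
      also have "\<dots> \<le> card X" using \<open>p \<in> A\<close> m' A B(2) by (intro dTV_le_card) auto
      finally show "(INF q\<in>B. dTV X p q) \<le> card X" .
    qed
    then have "(INF q\<in>B. dTV X p q) \<le> (SUP p\<in>A. INF q\<in>B. dTV X p q)"
      by (rule cSUP_upper[OF p])
    then have "(INF q\<in>B. dTV X p q) < e" using less by linarith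
    then show ?thesis using cINF_less_iff[OF B(1) bb] by blast
  qed
  show "p \<in> A \<Longrightarrow> \<exists>q\<in>B. dTV X p q < e"
    using *[of p A B] A B less by (simp add: hausdorff_dist_def)
  show "p \<in> B \<Longrightarrow> \<exists>q\<in>A. dTV X p q < e"
    using *[of p B A] A B less by (simp add: hausdorff_dist_def dTV_commute)
qed

lemma hausdorff_dist_leI:
  assumes A: "A \<noteq> {}" and B: "B \<noteq> {}"
    and 1: "\<And>p. p \<in> A \<Longrightarrow> \<exists>q\<in>B. dTV X p q \<le> e" and 2: "\<And>p. p \<in> B \<Longrightarrow> \<exists>q\<in>A. dTV X p q \<le> e"
  shows "hausdorff_dist X A B \<le> e"
proof -
  have *: "(SUP p\<in>A. INF q\<in>B. dTV X p q) \<le> e"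
    if "A \<noteq> {}" and 1: "\<And>p. p \<in> A \<Longrightarrow> \<exists>q\<in>B. dTV X p q \<le> e" for A B
  proof (rule cSUP_least[OF \<open>A \<noteq> {}\<close>])
    fix p assume "p \<in> A"
    then obtain q where m': "q \<in> B" "dTV X p q \<le> e" using 1 by blast
    have "(INF q\<in>B. dTV X p q) \<le> dTV X p q"
      by (rule cINF_lower[OF _ m'(1)]) (rule bdd_belowI2[of _ 0], rule dTV_nonneg)
    then show "(INF q\<in>B. dTV X p q) \<le> e" using m'(2) by linarith
  qed
  show ?thesis
    unfolding hausdorff_dist_def using *[OF A 1] *[OF B, of A] 2 by (simp add: dTV_commute)
qed

lemma hausdorff_dist_nonneg:
  assumes A: "A \<noteq> {}" "A \<subseteq> prob_simplex X" and B: "B \<noteq> {}" "B \<subseteq> prob_simplex X"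
  shows "0 \<le> hausdorff_dist X A B"
proof (rule ccontr)
  assume "\<not> 0 \<le> hausdorff_dist X A B"
  then have "hausdorff_dist X A B < 0" by simp
  from hausdorff_dist_lessD(1)[OF A B this] A(1) show False using dTV_nonneg by (metis all_not_in_conv not_less)
qed

lemma in_tv_closure_iff:
  assumes "finite X" "P \<subseteq> prob_simplex X"
  shows "\<nu> \<in> tv_topology X closure_of P \<longleftrightarrow> \<nu> \<in> prob_simplex X \<and> (\<forall>e>0. \<exists>p\<in>P. dTV X \<nu> p < e)"
proof -
  interpret Metric_space "prob_simplex X" "dTV X" by (rule Metric_space_prob_simplex[OF assms(1)])
  show ?thesis using assms(2) unfolding metric_closure_of by (auto; blast)
qed

text \<open>The direction from right to left is the completeness of the hyperspace of a compact space.\<close>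

theorem hausdorff_convergent_closure_iff:
  assumes fin: "finite X" and P: "\<And>n. n \<ge> 1 \<Longrightarrow> P n \<noteq> {}" "\<And>n. n \<ge> 1 \<Longrightarrow> P n \<subseteq> prob_simplex X"
  shows "hausdorff_convergent X (\<lambda>n. tv_topology X closure_of P n) \<longleftrightarrow>
    (\<forall>e>0. \<exists>N\<ge>1. \<forall>m\<ge>N. \<forall>n\<ge>N. \<forall>p\<in>P m. \<exists>q\<in>P n. dTV X p q < e)"
proof -
  interpret Metric_space "prob_simplex X" "dTV X" by (rule Metric_space_prob_simplex[OF fin])
  let ?Q = "\<lambda>n. tv_topology X closure_of P n"
  have cl: "\<nu> \<in> ?Q n \<longleftrightarrow> \<nu> \<in> prob_simplex X \<and> (\<forall>e>0. \<exists>p\<in>P n. dTV X \<nu> p < e)" if "n \<ge> 1" for \<nu> n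
    by (rule in_tv_closure_iff[OF fin P(2)[OF that]])
  have PQ: "P n \<subseteq> ?Q n" if "n \<ge> 1" for n
  proof
    fix p assume p: "p \<in> P n"
    then have "p \<in> prob_simplex X" using P(2)[OF that] by blast
    moreover have "dTV X p p = 0" by (simp add: dTV_def)
    ultimately show "p \<in> ?Q n" unfolding cl[OF that] using p by (metis)
  qed
  have Q: "?Q n \<noteq> {}" "?Q n \<subseteq> prob_simplex X" if "n \<ge> 1" for n
    using PQ[OF that] P(1)[OF that] cl[OF that] by auto
  show ?thesis
  proof
    assume "hausdorff_convergent X ?Q"
    then obtain C where C: "C \<noteq> {}" "closedin mtopology C" and lim: "(\<lambda>n. hausdorff_dist X (?Q n) C) \<longlonglongrightarrow> 0"
      unfolding hausdorff_convergent_def by blast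
    have Csub: "C \<subseteq> prob_simplex X" using closedin_subset[OF C(2)] by simp
    show "\<forall>e>0. \<exists>N\<ge>1. \<forall>m\<ge>N. \<forall>n\<ge>N. \<forall>p\<in>P m. \<exists>q\<in>P n. dTV X p q < e"
    proof (intro allI impI)
      fix e :: real assume e: "e > 0"
      then have "\<forall>\<^sub>F n in sequentially. hausdorff_dist X (?Q n) C < e / 3"
        using order_tendstoD(2)[OF lim, of "e / 3"] by simp
      then obtain N where N: "\<And>n. n \<ge> N \<Longrightarrow> hausdorff_dist X (?Q n) C < e / 3"
        unfolding eventually_sequentially by blast
      have "\<exists>q\<in>P n. dTV X p q < e" if mn: "m \<ge> max N 1" "n \<ge> max N 1" and p: "p \<in> P m" for m n p
      proof -
        have m1: "m \<ge> 1" "n \<ge> 1" "m \<ge> N" "n \<ge> N" using mn by auto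
        have "p \<in> ?Q m" using PQ[OF m1(1)] p by blast
        from hausdorff_dist_lessD(1)[OF Q[OF m1(1)] C(1) Csub N[OF m1(3)] this]
        obtain c where c: "c \<in> C" "dTV X p c < e / 3" by blast
        from hausdorff_dist_lessD(2)[OF Q[OF m1(2)] C(1) Csub N[OF m1(4)] this(1)]
        obtain \<nu> where \<nu>: "\<nu> \<in> ?Q n" "dTV X c \<nu> < e / 3" by blast
        have "\<forall>e>0. \<exists>p\<in>P n. dTV X \<nu> p < e" using \<nu>(1) cl[OF m1(2)] by blast
        then obtain q where q: "q \<in> P n" "dTV X \<nu> q < e / 3" using e by (meson divide_pos_pos zero_less_numeral)
        have "dTV X p q < e"
          using dTV_triangle[of X p q c] dTV_triangle[of X c q \<nu>] c \<nu> q by linarith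
        then show ?thesis using q by blast
      qed
      then show "\<exists>N\<ge>1. \<forall>m\<ge>N. \<forall>n\<ge>N. \<forall>p\<in>P m. \<exists>q\<in>P n. dTV X p q < e"
        by (intro exI[of _ "max N 1"]) auto
    qed
  next
    assume cauchy: "\<forall>e>0. \<exists>N\<ge>1. \<forall>m\<ge>N. \<forall>n\<ge>N. \<forall>p\<in>P m. \<exists>q\<in>P n. dTV X p q < e"
    \<comment> \<open>\<open>C\<close> is the upper limit of the sets: the points that
      \<open>P n\<close> approaches for arbitrarily large \<open>n\<close>. The Cauchy condition
      makes it the limit.\<close>
    define T where "T N = (\<Union>n\<in>{N..}. P n)" for N
    define C where "C = (\<Inter>N\<in>{1..}. tv_topology X closure_of T N)"
    have T: "T N \<subseteq> prob_simplex X" if "N \<ge> 1" for N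
      using P(2) that unfolding T_def by (meson UN_least atLeast_iff order_trans)
    have Cclosed: "closedin (tv_topology X) C" unfolding C_def by (rule closedin_Inter) auto
    have inC: "c \<in> C \<longleftrightarrow> c \<in> prob_simplex X \<and> (\<forall>N\<ge>1. \<forall>e>0. \<exists>n\<ge>N. \<exists>p\<in>P n. dTV X c p < e)" for c
    proof -
      have "c \<in> C \<longleftrightarrow> (\<forall>N\<ge>1. c \<in> prob_simplex X \<and> (\<forall>e>0. \<exists>p\<in>T N. dTV X c p < e))"
        unfolding C_def using in_tv_closure_iff[OF fin T] by (simp add: atLeast_def)
      then show ?thesis unfolding T_def by (metis (no_types, lifting) UN_E UN_I atLeast_iff order_refl)
    qed
    have 1: "\<exists>p\<in>P n. dTV X c p < 2 * e"
      if N: "N \<ge> 1" "\<forall>m\<ge>N. \<forall>n\<ge>N. \<forall>p\<in>P m. \<exists>q\<in>P n. dTV X p q < e" and e: "e > 0" and c: "c \<in> C" and n: "n \<ge> N" for N e c n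
    proof -
      obtain m \<nu> where m: "m \<ge> N" "\<nu> \<in> P m" "dTV X c \<nu> < e" using c e N(1) unfolding inC by blast
      obtain p where p: "p \<in> P n" "dTV X \<nu> p < e" using N(2) m n by blast
      then show ?thesis using dTV_triangle[of X c p \<nu>] m by force
    qed
    \<comment> \<open>A point of \<open>P n\<close> is within \<open>e\<close> of some point in
      every later set; a limit of a subsequence of those belongs to \<open>C\<close> and is still
      within \<open>e\<close>.\<close>
    have 2: "\<exists>c\<in>C. dTV X p c \<le> e"
      if N: "N \<ge> 1" "\<forall>m\<ge>N. \<forall>n\<ge>N. \<forall>p\<in>P m. \<exists>q\<in>P n. dTV X p q < e" and p: "p \<in> P n" and n: "n \<ge> N" for N e p n
    proof -
      have "\<exists>\<nu>. \<nu> \<in> P (N + m) \<and> dTV X p \<nu> < e" for m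
      proof -
        have "\<exists>q\<in>P (N + m). dTV X p q < e" using N(2) n p le_add1[of N m] by blast
        then show ?thesis by blast
      qed
      then have "\<forall>m. \<exists>\<nu>. \<nu> \<in> P (N + m) \<and> dTV X p \<nu> < e" by blast
      from choice[OF this] obtain \<nu> where \<nu>0: "\<forall>m. \<nu> m \<in> P (N + m) \<and> dTV X p (\<nu> m) < e" by (rule exE)
      have \<nu>: "\<nu> m \<in> P (N + m)" "dTV X p (\<nu> m) < e" for m
        using spec[OF \<nu>0, of m] by simp_all
      have "\<nu> m \<in> prob_simplex X" for m
        using \<nu>(1)[of m] P(2)[of "N + m"] N(1) by (simp add: subset_iff)
      from prob_simplex_seq_compact[where \<mu> = \<nu>, OF fin this]
      obtain s c where s: "strict_mono s" "c \<in> prob_simplex X" "(\<lambda>m. dTV X (\<nu> (s m)) c) \<longlonglongrightarrow> 0"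
        by (elim exE conjE)
      have near: "\<exists>M. \<forall>m\<ge>M. dTV X (\<nu> (s m)) c < r" if "r > 0" for r
        using order_tendstoD(2)[OF s(3) that] by (simp add: eventually_sequentially)
      have "c \<in> C" unfolding inC
      proof (intro conjI allI impI s(2))
        fix K :: nat and r :: real assume "K \<ge> 1" "r > 0"
        then obtain M where M: "\<forall>m\<ge>M. dTV X (\<nu> (s m)) c < r" using near[OF \<open>r > 0\<close>] by (elim exE)
        let ?m = "max M K"
        have "N + s ?m \<ge> K" using seq_suble[OF s(1), of ?m] by linarith
        moreover have "dTV X c (\<nu> (s ?m)) < r" using M by (simp add: dTV_commute)
        ultimately show "\<exists>n\<ge>K. \<exists>p\<in>P n. dTV X c p < r"
          using \<nu>(1)[of "s ?m"] by blast
      qed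
      moreover have "dTV X p c \<le> e"
      proof (rule field_le_epsilon)
        fix r :: real assume "r > 0"
        then obtain M where "\<forall>m\<ge>M. dTV X (\<nu> (s m)) c < r" using near[OF \<open>r > 0\<close>] by (elim exE)
        then have "dTV X (\<nu> (s M)) c < r" by simp
        then show "dTV X p c \<le> e + r"
          using dTV_triangle[of X p c "\<nu> (s M)"] \<nu>(2)[of "s M"] by linarith
      qed
      ultimately show ?thesis by blast
    qed
    have "C \<noteq> {}"
    proof -
      obtain N where N: "N \<ge> 1" "\<forall>m\<ge>N. \<forall>n\<ge>N. \<forall>p\<in>P m. \<exists>q\<in>P n. dTV X p q < 1"
        using cauchy zero_less_one by blast
      obtain p where "p \<in> P N" using P(1)[OF N(1)] by blast
      from 2[OF N this order_refl] show ?thesis by blast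
    qed
    moreover have "(\<lambda>n. hausdorff_dist X (?Q n) C) \<longlonglongrightarrow> 0"
    proof (rule LIMSEQ_I)
      fix r :: real assume r: "r > 0"
      define e where "e = r / 4"
      have e: "e > 0" using r by (simp add: e_def)
      obtain N where N: "N \<ge> 1" "\<forall>m\<ge>N. \<forall>n\<ge>N. \<forall>p\<in>P m. \<exists>q\<in>P n. dTV X p q < e"
        using cauchy e by blast
      have "norm (hausdorff_dist X (?Q n) C - 0) < r" if n: "n \<ge> N" for n
      proof -
        have n1: "n \<ge> 1" using N(1) n by linarith
        have "hausdorff_dist X (?Q n) C \<le> 2 * e"
        proof (rule hausdorff_dist_leI[OF Q(1)[OF n1] \<open>C \<noteq> {}\<close>])
          fix \<nu> assume "\<nu> \<in> ?Q n"
          then have "\<forall>e>0. \<exists>p\<in>P n. dTV X \<nu> p < e" using cl[OF n1] by blast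
          then obtain p where p: "p \<in> P n" "dTV X \<nu> p < e" using e by blast
          obtain c where "c \<in> C" "dTV X p c \<le> e" using 2[OF N p(1) n] by blast
          then show "\<exists>c\<in>C. dTV X \<nu> c \<le> 2 * e"
            using dTV_triangle[of X \<nu> c p] p(2) by (intro bexI[of _ c]) linarith+
        next
          fix c assume "c \<in> C"
          then obtain p where p: "p \<in> P n" "dTV X c p < 2 * e" using 1[OF N e _ n] by blast
          then show "\<exists>\<nu>\<in>?Q n. dTV X c \<nu> \<le> 2 * e" using PQ[OF n1] by (intro bexI[of _ p]) auto
        qed
        moreover have "C \<subseteq> prob_simplex X" using inC by blast
        ultimately show ?thesis
          using hausdorff_dist_nonneg[OF Q[OF n1] \<open>C \<noteq> {}\<close>] r by (simp add: e_def)
      qed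
      then show "\<exists>N. \<forall>n\<ge>N. norm (hausdorff_dist X (?Q n) C - 0) < r" by blast
    qed
    ultimately show "hausdorff_convergent X ?Q"
      unfolding hausdorff_convergent_def using Cclosed by blast
  qed
qed

text \<open>Through the Cauchy criterion only pairs of late members need comparison, provided that
  \<open>\<delta>\<close> does not depend on the pair. Approximability is assumed in both
  directions, as copying ball statistics one way also uses copies made the other way.\<close>

lemma hausdorff_convergent_transfer:
  assumes fin: "finite X" "finite X'"
    and C: "\<And>n. n \<ge> 1 \<Longrightarrow> C n \<noteq> {} \<and> S n ` C n \<subseteq> prob_simplex X"
    and C': "\<And>n. n \<ge> 1 \<Longrightarrow> C' n \<noteq> {} \<and> S' n ` C' n \<subseteq> prob_simplex X'"
    and transfer: "\<And>e. e > 0 \<Longrightarrow> \<exists>\<delta>>0. \<forall>m\<ge>1. \<forall>n\<ge>1.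
      (\<forall>f\<in>C m. \<exists>g\<in>C n. dTV X (S m f) (S n g) < \<delta>) \<longrightarrow>
      (\<forall>f\<in>C n. \<exists>g\<in>C m. dTV X (S n f) (S m g) < \<delta>) \<longrightarrow>
      (\<forall>f\<in>C' m. \<exists>g\<in>C' n. dTV X' (S' m f) (S' n g) < e)"
    and conv: "hausdorff_convergent X (\<lambda>n. tv_topology X closure_of S n ` C n)"
  shows "hausdorff_convergent X' (\<lambda>n. tv_topology X' closure_of S' n ` C' n)"
proof -
  have cauchy: "\<exists>N\<ge>1. \<forall>m\<ge>N. \<forall>n\<ge>N. \<forall>f\<in>C m. \<exists>g\<in>C n. dTV X (S m f) (S n g) < e" if "e > 0" for e
    using conv that C by (subst (asm) hausdorff_convergent_closure_iff[OF fin(1)]) auto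
  show ?thesis
  proof (subst hausdorff_convergent_closure_iff[OF fin(2)])
    show "\<forall>e>0. \<exists>N\<ge>1. \<forall>m\<ge>N. \<forall>n\<ge>N. \<forall>p\<in>S' m ` C' m. \<exists>q\<in>S' n ` C' n. dTV X' p q < e"
    proof (intro allI impI)
      fix e :: real assume "e > 0"
      from transfer[OF this] obtain \<delta> where \<delta>: "\<delta> > 0" and t: "\<forall>m\<ge>1. \<forall>n\<ge>1.
        (\<forall>f\<in>C m. \<exists>g\<in>C n. dTV X (S m f) (S n g) < \<delta>) \<longrightarrow> (\<forall>f\<in>C n. \<exists>g\<in>C m. dTV X (S n f) (S m g) < \<delta>) \<longrightarrow>
        (\<forall>f\<in>C' m. \<exists>g\<in>C' n. dTV X' (S' m f) (S' n g) < e)" by (elim exE conjE)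
      obtain N where N: "N \<ge> 1" "\<forall>m\<ge>N. \<forall>n\<ge>N. \<forall>f\<in>C m. \<exists>g\<in>C n. dTV X (S m f) (S n g) < \<delta>"
        using cauchy[OF \<delta>] by (elim exE conjE)
      have "\<forall>f\<in>C' m. \<exists>g\<in>C' n. dTV X' (S' m f) (S' n g) < e" if "m \<ge> N" "n \<ge> N" for m n
      proof -
        have "m \<ge> 1" "n \<ge> 1" using that N(1) by linarith+
        then show ?thesis using t N(2) that by simp
      qed
      then show "\<exists>N\<ge>1. \<forall>m\<ge>N. \<forall>n\<ge>N. \<forall>p\<in>S' m ` C' m. \<exists>q\<in>S' n ` C' n. dTV X' p q < e"
        using N(1) by (intro exI[of _ N]) simp
    qed
  qed (use C' in auto)
qed


section \<open>Ball types\<close>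

lemma rc_iso_trans: "rc_iso g h \<Longrightarrow> rc_iso h k \<Longrightarrow> rc_iso g k"
proof -
  assume "rc_iso g h" "rc_iso h k"
  then obtain \<phi> \<psi> where \<phi>: "bij_betw \<phi> (verts g) (verts h)" "\<phi> (root g) = root h"
    "\<forall>u\<in>verts g. \<forall>v\<in>verts g. (u, v) \<in> edges g \<longleftrightarrow> (\<phi> u, \<phi> v) \<in> edges h" "\<forall>v\<in>verts g. col h (\<phi> v) = col g v"
    and \<psi>: "bij_betw \<psi> (verts h) (verts k)" "\<psi> (root h) = root k"
    "\<forall>u\<in>verts h. \<forall>v\<in>verts h. (u, v) \<in> edges h \<longleftrightarrow> (\<psi> u, \<psi> v) \<in> edges k" "\<forall>v\<in>verts h. col k (\<psi> v) = col h v"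
    unfolding rc_iso_def by blast
  have in_h: "\<phi> u \<in> verts h" if "u \<in> verts g" for u using \<phi>(1) that bij_betwE by blast
  show ?thesis unfolding rc_iso_def
  proof (intro exI[of _ "\<psi> \<circ> \<phi>"] conjI ballI)
    show "bij_betw (\<psi> \<circ> \<phi>) (verts g) (verts k)" using \<phi>(1) \<psi>(1) by (rule bij_betw_trans)
  qed (use \<phi> \<psi> in_h in auto)
qed

lemma rc_iso_sym:
  assumes "rc_iso g h" "root g \<in> verts g"
  shows "rc_iso h g"
proof -
  obtain \<phi> where \<phi>: "bij_betw \<phi> (verts g) (verts h)" "\<phi> (root g) = root h"
    "\<forall>u\<in>verts g. \<forall>v\<in>verts g. (u, v) \<in> edges g \<longleftrightarrow> (\<phi> u, \<phi> v) \<in> edges h" "\<forall>v\<in>verts g. col h (\<phi> v) = col g v"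
    using assms(1) unfolding rc_iso_def by blast
  let ?\<psi> = "inv_into (verts g) \<phi>"
  have inv: "?\<psi> v \<in> verts g" "\<phi> (?\<psi> v) = v" if "v \<in> verts h" for v
    using that \<phi>(1) by (auto simp: bij_betw_def inv_into_into f_inv_into_f)
  show ?thesis unfolding rc_iso_def
  proof (intro exI[of _ ?\<psi>] conjI ballI)
    show "bij_betw ?\<psi> (verts h) (verts g)" using \<phi>(1) by (rule bij_betw_inv_into)
    show "?\<psi> (root h) = root g" using \<phi>(1,2) assms(2) by (metis bij_betw_def inv_into_f_f)
    show "col g (?\<psi> v) = col h v" if "v \<in> verts h" for v
      using \<phi>(4) inv[OF that] by metis
  qed (use \<phi> inv in auto)
qed

lemma iso_class_cong:
  assumes "rc_iso g h" "root g \<in> verts g"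
  shows "iso_class k g = iso_class k h"
proof -
  have "rc_iso g h' \<longleftrightarrow> rc_iso h h'" for h' :: "nat rcgraph"
    using rc_iso_trans[OF rc_iso_sym[OF assms], of h'] rc_iso_trans[OF assms(1), of h'] by blast
  then show ?thesis by (simp add: iso_class_def)
qed

text \<open>The color 0 off the vertex set removes the arbitrary values of \<open>col\<close> there,
  so that a copy on a bounded set of numbers is determined by finite data.\<close>

definition image_graph :: "('v \<Rightarrow> 'w) \<Rightarrow> 'v rcgraph \<Rightarrow> 'w rcgraph" where
  "image_graph \<phi> g = \<lparr>verts = \<phi> ` verts g, edges = map_prod \<phi> \<phi> ` edges g, root = \<phi> (root g),
     col = (\<lambda>w. if w \<in> \<phi> ` verts g then col g (inv_into (verts g) \<phi> w) else 0)\<rparr>"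

lemma map_prod_image_mem:
  assumes "inj_on \<phi> V" "F \<subseteq> V \<times> V" "u \<in> V" "v \<in> V"
  shows "(\<phi> u, \<phi> v) \<in> map_prod \<phi> \<phi> ` F \<longleftrightarrow> (u, v) \<in> F"
proof
  assume "(\<phi> u, \<phi> v) \<in> map_prod \<phi> \<phi> ` F"
  then obtain u' v' where *: "(u', v') \<in> F" "\<phi> u = \<phi> u'" "\<phi> v = \<phi> v'" by auto
  then have "u = u'" "v = v'" using assms inj_onD[OF assms(1)] by blast+
  then show "(u, v) \<in> F" using * by simp
qed (intro image_eqI[of _ _ "(u, v)"]; simp)

lemma rc_iso_image_graph:
  assumes "inj_on \<phi> (verts g)" "edges g \<subseteq> verts g \<times> verts g"
  shows "rc_iso g (image_graph \<phi> g)"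
  unfolding rc_iso_def image_graph_def
  using assms map_prod_image_mem[OF assms]
  by (intro exI[of _ \<phi>]) (auto simp: bij_betw_def)

lemma is_rcgraph_image_graph:
  assumes g: "is_rcgraph k g" and inj: "inj_on \<phi> (verts g)"
  shows "is_rcgraph k (image_graph \<phi> g)"
proof -
  have sub: "edges g \<subseteq> verts g \<times> verts g" and s: "sym (edges g)" and ir: "irrefl (edges g)"
    and r: "root g \<in> verts g" and c: "col g \<in> verts g \<rightarrow> {1..k}"
    using g by (simp_all add: is_rcgraph_def)
  have "sym (map_prod \<phi> \<phi> ` edges g)" using s by (force simp: sym_def)
  moreover have "irrefl (map_prod \<phi> \<phi> ` edges g)"
    unfolding irrefl_def
  proof (intro allI notI)
    fix a assume "(a, a) \<in> map_prod \<phi> \<phi> ` edges g"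
    then obtain u v where uv: "(u, v) \<in> edges g" "\<phi> u = \<phi> v" by auto
    then have "u = v" using sub inj by (auto simp: inj_on_def)
    then show False using ir uv by (auto simp: irrefl_def)
  qed
  ultimately show ?thesis
    using sub r c inj unfolding is_rcgraph_def image_graph_def by (force simp: inv_into_f_f)
qed

lemma relpow_map_prod: "(x, y) \<in> F ^^ n \<Longrightarrow> (\<phi> x, \<phi> y) \<in> (map_prod \<phi> \<phi> ` F) ^^ n"
proof (induction n arbitrary: y)
  case (Suc n)
  then obtain z where "(x, z) \<in> F ^^ n" "(z, y) \<in> F" by auto
  then have "(\<phi> x, \<phi> z) \<in> (map_prod \<phi> \<phi> ` F) ^^ n" "(\<phi> z, \<phi> y) \<in> map_prod \<phi> \<phi> ` F" using Suc.IH by force+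
  then show ?case by (rule relpow_Suc_I)
qed simp

text \<open>The condition in \<open>ball_classes\<close>, for arbitrary vertex types, so that it
  applies to balls in a graphing.\<close>

definition is_ball_graph :: "nat \<Rightarrow> nat \<Rightarrow> nat \<Rightarrow> 'v rcgraph \<Rightarrow> bool" where
  "is_ball_graph d k r g \<longleftrightarrow> is_rcgraph k g \<and>
     (\<forall>v\<in>verts g. finite (edges g `` {v}) \<and> card (edges g `` {v}) \<le> d) \<and>
     verts g \<subseteq> ball_verts (edges g) r (root g)"

lemma is_ball_graph_image_graph:
  assumes g: "is_ball_graph d k r g" and inj: "inj_on \<phi> (verts g)"
  shows "is_ball_graph d k r (image_graph \<phi> g)"
proof -
  have rc: "is_rcgraph k g" using g by (simp add: is_ball_graph_def)
  then have sub: "edges g \<subseteq> verts g \<times> verts g" by (simp add: is_rcgraph_def)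
  have "(map_prod \<phi> \<phi> ` edges g) `` {\<phi> v} = \<phi> ` (edges g `` {v})" if v: "v \<in> verts g" for v
  proof (intro equalityI subsetI)
    fix b assume "b \<in> (map_prod \<phi> \<phi> ` edges g) `` {\<phi> v}"
    then obtain u w where u: "(u, w) \<in> edges g" "\<phi> u = \<phi> v" "b = \<phi> w" by auto
    then have "u = v" using sub v inj by (auto simp: inj_on_def)
    then show "b \<in> \<phi> ` (edges g `` {v})" using u by auto
  qed force
  then have "\<forall>v\<in>verts g. finite ((map_prod \<phi> \<phi> ` edges g) `` {\<phi> v}) \<and> card ((map_prod \<phi> \<phi> ` edges g) `` {\<phi> v}) \<le> d"
    using g unfolding is_ball_graph_def by (simp add: card_image_le order_trans[OF card_image_le])
  moreover have "\<phi> ` verts g \<subseteq> ball_verts (map_prod \<phi> \<phi> ` edges g) r (\<phi> (root g))"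
    using g relpow_map_prod[where F = "edges g" and \<phi> = \<phi>] unfolding is_ball_graph_def ball_verts_def by blast
  ultimately show ?thesis
    using is_rcgraph_image_graph[OF rc inj] unfolding is_ball_graph_def by (simp add: image_graph_def)
qed

lemma is_ball_graph_finite:
  assumes "is_ball_graph d k r g"
  shows "finite (verts g)" "card (verts g) \<le> (d + 1) ^ r"
proof -
  have "finite (edges g `` {v}) \<and> card (edges g `` {v}) \<le> d" for v
  proof (cases "v \<in> verts g")
    case False
    then have "edges g `` {v} = {}" using assms by (auto simp: is_ball_graph_def is_rcgraph_def)
    then show ?thesis by simp
  qed (use assms in \<open>simp add: is_ball_graph_def\<close>)
  from card_ball_verts[of "edges g" d r "root g", OF this]
  have f: "finite (ball_verts (edges g) r (root g))" "card (ball_verts (edges g) r (root g)) \<le> (d + 1) ^ r" by auto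
  have s: "verts g \<subseteq> ball_verts (edges g) r (root g)" using assms by (simp add: is_ball_graph_def)
  show "finite (verts g)" using finite_subset[OF s f(1)] .
  show "card (verts g) \<le> (d + 1) ^ r" using card_mono[OF f(1) s] f(2) by linarith
qed

text \<open>The vertices can be numbered below the bound on ball sizes. This yields both that
  isomorphism classes have representatives and that there are finitely many of them.\<close>

lemma ball_graph_nat_copy:
  assumes g: "is_ball_graph d k r g"
  obtains h :: "nat rcgraph" where "rc_iso g h" "is_ball_graph d k r h"
    "verts h \<subseteq> {..<(d + 1) ^ r}" "\<And>v. v \<notin> verts h \<Longrightarrow> col h v = 0"
proof -
  obtain \<phi> where \<phi>: "bij_betw \<phi> (verts g) {0..<card (verts g)}"
    using ex_bij_betw_finite_nat[OF is_ball_graph_finite(1)[OF g]] by blast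
  then have inj: "inj_on \<phi> (verts g)" by (simp add: bij_betw_def)
  have sub: "edges g \<subseteq> verts g \<times> verts g" using g by (simp add: is_ball_graph_def is_rcgraph_def)
  show ?thesis
  proof (rule that[of "image_graph \<phi> g"])
    show "verts (image_graph \<phi> g) \<subseteq> {..<(d + 1) ^ r}"
      using \<phi> is_ball_graph_finite(2)[OF g] by (auto simp: image_graph_def bij_betw_def)
  qed (use rc_iso_image_graph[OF inj sub] is_ball_graph_image_graph[OF g inj] in \<open>auto simp: image_graph_def\<close>)
qed

lemma ball_classes_alt: "ball_classes d k r = {iso_class k g | g :: nat rcgraph. is_ball_graph d k r g}"
  by (simp add: ball_classes_def is_ball_graph_def)

lemma is_ball_graph_root: "is_ball_graph d k r g \<Longrightarrow> root g \<in> verts g"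
  by (simp add: is_ball_graph_def is_rcgraph_def)

lemma iso_class_in_ball_classes:
  assumes "is_ball_graph d k r g"
  shows "iso_class k g \<in> ball_classes d k r"
proof -
  obtain h :: "nat rcgraph" where h: "rc_iso g h" "is_ball_graph d k r h" using ball_graph_nat_copy[OF assms] by metis
  then show ?thesis using iso_class_cong[OF h(1) is_ball_graph_root[OF assms]] unfolding ball_classes_alt by blast
qed

lemma finite_ball_classes: "finite (ball_classes d k r)"
proof -
  let ?K = "(d + 1) ^ r"
  let ?H = "(\<lambda>(V, F, \<rho>, c). \<lparr>verts = V, edges = F, root = \<rho>, col = c\<rparr>) `
    (Pow {..<?K} \<times> Pow ({..<?K} \<times> {..<?K}) \<times> {..<?K} \<times> {c. \<forall>x. (x \<in> {..<?K} \<longrightarrow> c x \<in> {..k}) \<and> (x \<notin> {..<?K} \<longrightarrow> c x = (0::nat))})"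
  have "finite ?H"
    by (intro finite_imageI finite_cartesian_product finite_set_of_finite_funs) auto
  moreover have "ball_classes d k r \<subseteq> iso_class k ` ?H"
  proof
    fix T assume "T \<in> ball_classes d k r"
    then obtain g :: "nat rcgraph" where g: "is_ball_graph d k r g" "T = iso_class k g" unfolding ball_classes_alt by blast
    obtain h :: "nat rcgraph" where h: "rc_iso g h" "is_ball_graph d k r h" "verts h \<subseteq> {..<?K}"
      "\<And>v. v \<notin> verts h \<Longrightarrow> col h v = 0" using ball_graph_nat_copy[OF g(1)] by metis
    have h': "edges h \<subseteq> verts h \<times> verts h" "root h \<in> verts h" "col h \<in> verts h \<rightarrow> {1..k}"
      using h(2) by (simp_all add: is_ball_graph_def is_rcgraph_def)
    have "col h x \<le> k" for x using h'(3) h(4)[of x] by (cases "x \<in> verts h") auto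
    then have hH: "h \<in> ?H"
      using h(3,4) h' by (intro image_eqI[of _ _ "(verts h, edges h, root h, col h)"]) auto
    have "T = iso_class k h" using g iso_class_cong[OF h(1) is_ball_graph_root[OF g(1)]] by simp
    from this hH show "T \<in> iso_class k ` ?H" by (rule image_eqI)
  qed
  ultimately show ?thesis by (meson finite_imageI finite_subset)
qed

section \<open>Colored balls of a graphing and their recovery from label words\<close>

lemma ball_verts_restrict:
  "r \<le> s \<Longrightarrow> ball_verts E r x \<subseteq> ball_verts (E \<inter> ball_verts E s x \<times> ball_verts E s x) r x"
proof (induction r)
  case (Suc r)
  \<comment> \<open>A walk of at most \<open>s\<close> steps from \<open>x\<close> never leaves the
    \<open>s\<close>-ball, so passing to the induced subgraph loses none of these walks.\<close>
  let ?F = "E \<inter> ball_verts E s x \<times> ball_verts E s x"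
  have IH: "ball_verts E r x \<subseteq> ball_verts ?F r x" using Suc by simp
  show ?case
  proof
    fix z assume z: "z \<in> ball_verts E (Suc r) x"
    then have zs: "z \<in> ball_verts E s x" using ball_verts_mono[OF Suc.prems, of E x] by blast
    from z consider "z \<in> ball_verts E r x" | y where "y \<in> ball_verts E r x" "(y, z) \<in> E"
      unfolding ball_verts_Suc' by blast
    then show "z \<in> ball_verts ?F (Suc r) x"
    proof cases
      case 1
      then show ?thesis using IH ball_verts_mono[of r "Suc r" ?F x] by auto
    next
      case 2
      then have "(y, z) \<in> ?F" using zs ball_verts_mono[of r s E x] Suc.prems by auto
      then show ?thesis using 2 IH unfolding ball_verts_Suc' by blast
    qed
  qed
qed simp

text \<open>Meant for the words of radius \<open>Suc r\<close> of an injective labelling: labels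
  stand for vertices, the last letters of words with at most \<open>r\<close> steps give the ball,
  and the last two letters of any word give an edge. \<open>\<pi>\<close> extracts the color from a
  label.\<close>

definition word_graph :: "('l \<Rightarrow> nat) \<Rightarrow> nat \<Rightarrow> 'l list set \<Rightarrow> 'l rcgraph" where
  "word_graph \<pi> r W =
     (let V = last ` {w\<in>W. length w \<le> Suc r}
      in \<lparr>verts = V, edges = {(last (butlast w), last w) | w. w \<in> W \<and> 2 \<le> length w} \<inter> V \<times> V,
          root = (THE a. [a] \<in> W), col = \<pi>\<rparr>)"

lemma words_length_le: "{w \<in> words E l (Suc r) x. length w \<le> Suc r} = words E l r x"
  by (auto simp: words_def walks_def)

lemma last_two_words:
  "{(last (butlast w), last w) | w. w \<in> words E l (Suc r) x \<and> 2 \<le> length w} =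
   {(l u, l v) | u v. u \<in> ball_verts E r x \<and> (u, v) \<in> E}" (is "?L = ?R")
proof (intro equalityI subsetI)
  fix ab assume "ab \<in> ?L"
  then obtain p where p: "p \<in> walks E (Suc r) x" "2 \<le> length p" "ab = (last (butlast (map l p)), last (map l p))"
    unfolding words_def by auto
  define q v where "q = butlast p" and "v = last p"
  have pq: "p = q @ [v]" "q \<noteq> []" using p(2) unfolding q_def v_def by (cases p rule: rev_cases; auto)+
  have "q \<in> walks E r x" "(last q, v) \<in> E"
    using p(1) pq(2) unfolding pq(1) walks_def by (auto simp: successively_append_iff)
  moreover have "last q \<in> ball_verts E r x" using imageI[OF calculation(1), of last] unfolding last_walks .
  moreover have "ab = (l (last q), l v)" using p(3) pq by (simp add: butlast_append last_map)
  ultimately show "ab \<in> ?R" by blast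
next
  fix ab assume "ab \<in> ?R"
  then obtain u v where uv: "u \<in> ball_verts E r x" "(u, v) \<in> E" "ab = (l u, l v)" by blast
  then obtain q where q: "q \<in> walks E r x" "u = last q" unfolding last_walks[symmetric] by blast
  then have "q \<noteq> []" by (simp add: walks_def)
  then have "q @ [v] \<in> walks E (Suc r) x"
    using q uv(2) by (auto simp: walks_def successively_append_iff)
  then have "map l (q @ [v]) \<in> words E l (Suc r) x" unfolding words_def by blast
  then show "ab \<in> ?L" using q uv \<open>q \<noteq> []\<close>
    by (intro CollectI exI[of _ "map l (q @ [v])"]) (auto simp: butlast_append last_map Suc_le_eq)
qed

text \<open>Injectivity is required one step beyond the ball, because an edge is read off a walk
  that may end there: a vertex just outside sharing its label with one inside would create a false
  edge.\<close>

lemma rc_iso_word_graph: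
  assumes inj: "inj_on l (ball_verts (gedges G) (Suc r) x)"
  shows "rc_iso (colored_ball r G (\<lambda>y. \<pi> (l y)) x) (word_graph \<pi> r (words (gedges G) l (Suc r) x))"
proof -
  let ?E = "gedges G"
  let ?B = "ball_verts ?E r x"
  let ?W = "words ?E l (Suc r) x"
  have sub: "?B \<subseteq> ball_verts ?E (Suc r) x" by (rule ball_verts_mono) simp
  have inj': "inj_on l ?B" using inj_on_subset[OF inj sub] .
  have V: "last ` {w\<in>?W. length w \<le> Suc r} = l ` ?B" by (simp only: words_length_le last_words)
  have root: "(THE a. [a] \<in> ?W) = l x" by (rule the_equality) (auto simp: Cons_in_words)
  have E: "(u, v) \<in> ?E \<longleftrightarrow> (l u, l v) \<in> {(l u, l v) | u v. u \<in> ?B \<and> (u, v) \<in> ?E}" if uv: "u \<in> ?B" "v \<in> ?B" for u v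
  proof
    assume "(l u, l v) \<in> {(l u, l v) | u v. u \<in> ?B \<and> (u, v) \<in> ?E}"
    then obtain u' v' where u': "u' \<in> ?B" "(u', v') \<in> ?E" "l u' = l u" "l v' = l v" by auto
    have "v' \<in> ball_verts ?E (Suc r) x" using u' unfolding ball_verts_Suc' by blast
    then have "u' = u" "v' = v" using inj u' uv sub by (auto simp: inj_on_def)
    then show "(u, v) \<in> ?E" using u' by simp
  qed (use uv in blast)
  show ?thesis
    unfolding rc_iso_def colored_ball_def word_graph_def Let_def last_two_words V root
    using E inj' by (intro exI[of _ l]) (auto simp: bij_betw_def)
qed

text \<open>The value does not depend on the representative chosen, and no isomorphism class is empty.\<close>

definition class_star :: "nat \<Rightarrow> nat rcgraph set \<Rightarrow> nat \<times> (nat \<Rightarrow> nat)" where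
  "class_star k T = (let h = SOME h. h \<in> T
     in (col h (root h), \<lambda>j\<in>{1..k}. card {y \<in> edges h `` {root h}. col h y = j}))"

context bounded_graphing
begin

lemma is_ball_graph_colored_ball:
  assumes f: "f \<in> colorings k G" and x: "x \<in> space M"
  shows "is_ball_graph d k r (colored_ball r G f x)"
proof -
  let ?B = "ball_verts E r x"
  have deg: "finite ((E \<inter> ?B \<times> ?B) `` {v}) \<and> card ((E \<inter> ?B \<times> ?B) `` {v}) \<le> d" for v
  proof -
    have s: "(E \<inter> ?B \<times> ?B) `` {v} \<subseteq> E `` {v}" by auto
    show ?thesis using finite_subset[OF s] card_mono[OF _ s] degree[of v] by force
  qed
  have "sym (E \<inter> ?B \<times> ?B)" using sym_E by (auto simp: sym_def)
  moreover have "irrefl (E \<inter> ?B \<times> ?B)" using irrefl_E by (auto simp: irrefl_def)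
  moreover have "f \<in> ?B \<rightarrow> {1..k}" using coloring_range[OF f] ball_space[OF x] by blast
  ultimately show ?thesis
    unfolding is_ball_graph_def is_rcgraph_def colored_ball_def Let_def
    using deg ball_verts_restrict[of r r E x] by simp
qed

lemma ball_type_in_ball_classes:
  "f \<in> colorings k G \<Longrightarrow> x \<in> space M \<Longrightarrow> ball_type k r G f x \<in> ball_classes d k r"
  unfolding ball_type_def by (rule iso_class_in_ball_classes[OF is_ball_graph_colored_ball])

lemma ball_type_eq_words:
  assumes "inj_on l (ball_verts E (Suc r) x)"
  shows "ball_type k r G (\<lambda>y. \<pi> (l y)) x = iso_class k (word_graph \<pi> r (words E l (Suc r) x))"
  unfolding ball_type_def
  by (rule iso_class_cong[OF rc_iso_word_graph[OF assms]]) (simp add: colored_ball_def Let_def)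

lemma ex_injective_labelling:
  assumes f: "f \<in> colorings k G"
  shows "\<exists>l\<in>measurable M (count_space ({1..k} \<times> {..(d + 1) ^ (R + R)})).
    (\<forall>x\<in>space M. inj_on l (ball_verts E R x)) \<and> (\<forall>x. fst (l x) = f x)"
proof -
  obtain c where c: "c \<in> measurable M (count_space {..(d + 1) ^ (R + R)})" "\<forall>x\<in>space M. inj_on c (ball_verts E R x)"
    using ex_ball_injective_coloring by blast
  have "(\<lambda>x. (f x, c x)) \<in> measurable M (count_space ({1..k} \<times> {..(d + 1) ^ (R + R)}))"
  proof (rule measurable_finite_valued)
    fix ab
    have "{x\<in>space M. (f x, c x) = ab} = {x\<in>space M. f x = fst ab} \<inter> {x\<in>space M. c x \<in> {snd ab}}" by auto
    then show "{x\<in>space M. (f x, c x) = ab} \<in> sets M"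
      using sets.Int[OF coloring_vimage[OF f, of "fst ab"] measurable_count_space_sets[OF c(1), of "{snd ab}"]] by simp
  next
    fix x assume x: "x \<in> space M"
    show "(f x, c x) \<in> {1..k} \<times> {..(d + 1) ^ (R + R)}"
      using coloring_range[OF f x] measurable_space[OF c(1) x] by simp
  qed simp
  moreover have "inj_on (\<lambda>x. (f x, c x)) (ball_verts E R x)" if "x \<in> space M" for x
    using c(2) that by (auto simp: inj_on_def)
  ultimately show ?thesis by (intro bexI[of _ "\<lambda>x. (f x, c x)"]) auto
qed

text \<open>After refining \<open>f\<close> to an injective labelling the type of a ball is a
  function of its word set, which is measurable with finitely many values.\<close>

lemma ball_type_measurable:
  assumes f: "f \<in> colorings k G"
  shows "ball_type k r G f \<in> measurable M (count_space (ball_classes d k r))"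
proof (rule measurable_finite_valued[OF finite_ball_classes ball_type_in_ball_classes[OF f]])
  fix T
  let ?L = "{1..k} \<times> {..(d + 1) ^ (Suc r + Suc r)}"
  obtain l where l: "l \<in> measurable M (count_space ?L)" "\<And>x. x \<in> space M \<Longrightarrow> inj_on l (ball_verts E (Suc r) x)"
    and fl: "\<And>x. fst (l x) = f x"
    using ex_injective_labelling[OF f, of "Suc r"] by blast
  have W: "words E l (Suc r) \<in> measurable M (count_space (Pow (word_set ?L (Suc r))))"
    by (rule words_measurable[OF _ l(1)]) simp
  have "ball_type k r G f x = iso_class k (word_graph fst r (words E l (Suc r) x))" if "x \<in> space M" for x
    using ball_type_eq_words[OF l(2)[OF that], of k fst] by (simp add: fl)
  then have "{x\<in>space M. ball_type k r G f x = T} =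
      {x\<in>space M. words E l (Suc r) x \<in> {W. iso_class k (word_graph fst r W) = T}}" by auto
  then show "{x\<in>space M. ball_type k r G f x = T} \<in> sets M"
    using measurable_count_space_sets[OF W, of "{W. iso_class k (word_graph fst r W) = T}"] by (simp only:)
qed

lemma star_type_eq_class_star:
  assumes f: "f \<in> colorings k G" and x: "x \<in> space M"
  shows "star_type k G f x = class_star k (ball_type k 1 G f x)"
proof -
  let ?g = "colored_ball 1 G f x"
  obtain h0 :: "nat rcgraph" where "rc_iso ?g h0" "is_ball_graph d k 1 h0"
    using ball_graph_nat_copy[OF is_ball_graph_colored_ball[OF f x]] by metis
  then have "h0 \<in> ball_type k 1 G f x" by (simp add: ball_type_def iso_class_def is_ball_graph_def)
  then have "(SOME h. h \<in> ball_type k 1 G f x) \<in> ball_type k 1 G f x" by (rule someI)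
  then obtain h where h: "h = (SOME h. h \<in> ball_type k 1 G f x)" "is_rcgraph k h" "rc_iso ?g h"
    by (auto simp: ball_type_def iso_class_def)
  then obtain \<phi> where \<phi>: "bij_betw \<phi> (verts ?g) (verts h)" "\<phi> (root ?g) = root h"
    "\<forall>u\<in>verts ?g. \<forall>v\<in>verts ?g. (u, v) \<in> edges ?g \<longleftrightarrow> (\<phi> u, \<phi> v) \<in> edges h" "\<forall>v\<in>verts ?g. col h (\<phi> v) = col ?g v"
    unfolding rc_iso_def by blast
  have rt: "root ?g = x" "x \<in> verts ?g" and cg: "col ?g = f" by (simp_all add: colored_ball_def Let_def)
  have nb: "nbrs G x \<subseteq> verts ?g" using ball_verts_edge by (auto simp: nbrs_def colored_ball_def Let_def)
  have eg: "(x, y) \<in> edges ?g \<longleftrightarrow> y \<in> nbrs G x" if "y \<in> verts ?g" for y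
    using that by (auto simp: colored_ball_def nbrs_def Let_def)
  have "card {y \<in> edges h `` {root h}. col h y = j} = card {y \<in> nbrs G x. f y = j}" for j
  proof -
    have "{y \<in> edges h `` {root h}. col h y = j} = \<phi> ` {y \<in> nbrs G x. f y = j}"
    proof (intro equalityI subsetI)
      fix z assume z: "z \<in> {y \<in> edges h `` {root h}. col h y = j}"
      then have "z \<in> verts h" using h(2) by (auto simp: is_rcgraph_def)
      then obtain y where y: "y \<in> verts ?g" "z = \<phi> y" using \<phi>(1) by (auto simp: bij_betw_def)
      then have "(x, y) \<in> edges ?g" using z \<phi>(2,3) rt by auto
      then show "z \<in> \<phi> ` {y \<in> nbrs G x. f y = j}" using z y eg \<phi>(4) cg by auto
    next
      fix z assume "z \<in> \<phi> ` {y \<in> nbrs G x. f y = j}"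
      then obtain y where y: "y \<in> nbrs G x" "f y = j" "z = \<phi> y" by auto
      then have yv: "y \<in> verts ?g" using nb by blast
      then have "(root h, z) \<in> edges h" using y eg \<phi>(2,3) rt by metis
      then show "z \<in> {y \<in> edges h `` {root h}. col h y = j}" using y yv \<phi>(4) cg by auto
    qed
    moreover have "inj_on \<phi> {y \<in> nbrs G x. f y = j}"
      using \<phi>(1) nb by (auto simp: bij_betw_def intro: inj_on_subset)
    ultimately show ?thesis by (simp add: card_image)
  qed
  moreover have "col h (root h) = f x" using \<phi>(2,4) rt cg by metis
  ultimately show ?thesis unfolding class_star_def star_type_def h(1)[symmetric] Let_def by simp
qed

end


section \<open>Copying labellings\<close>

lemma words_restrict_length: "n \<le> m \<Longrightarrow> words E l n x = {w \<in> words E l m x. length w \<le> Suc n}"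
  by (auto simp: words_def walks_def)

text \<open>The label announced by a claim \<open>W\<close> is its one-letter word. Copied claims
  may be inconsistent, so when there is no such word some element of \<open>L\<close> is returned;
  the labels derived from claims then always lie in \<open>L\<close>.\<close>

definition word_label :: "'l set \<Rightarrow> 'l list set \<Rightarrow> 'l" where
  "word_label L W = (SOME a. a \<in> L \<and> ((\<exists>b\<in>L. [b] \<in> W) \<longrightarrow> [a] \<in> W))"

lemma word_label:
  assumes "L \<noteq> {}"
  shows "word_label L W \<in> L" and "b \<in> L \<Longrightarrow> [b] \<in> W \<Longrightarrow> [word_label L W] \<in> W"
proof -
  have "\<exists>a. a \<in> L \<and> ((\<exists>b\<in>L. [b] \<in> W) \<longrightarrow> [a] \<in> W)" using assms by blast
  from someI_ex[OF this]
  show "word_label L W \<in> L" and "b \<in> L \<Longrightarrow> [b] \<in> W \<Longrightarrow> [word_label L W] \<in> W"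
    unfolding word_label_def[symmetric] by blast+
qed

text \<open>When every vertex carries (a code of) the set of label words that it claims to read along the
  walks leaving it, this is the condition that its claim agrees with the claims of its neighbours;
  it is visible in the star of the vertex.\<close>

definition consistent_star :: "'l set \<Rightarrow> nat \<Rightarrow> (nat \<Rightarrow> 'l list set) \<Rightarrow> nat \<Rightarrow> nat \<times> (nat \<Rightarrow> nat) \<Rightarrow> bool" where
  "consistent_star L R dec K = (\<lambda>(i, n). \<forall>w. w \<in> dec i \<longleftrightarrow> length w \<le> Suc R \<and>
     (\<exists>u. w = word_label L (dec i) # u \<and> (u = [] \<or> (\<exists>j\<in>{1..K}. 0 < n j \<and> u \<in> dec j))))"

context bounded_graphing
begin

lemma consistent_star_type:
  assumes f: "f \<in> colorings K G" and x: "x \<in> space M"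
  shows "consistent_star L R dec K (star_type K G f x) \<longleftrightarrow>
    (\<forall>w. w \<in> dec (f x) \<longleftrightarrow> length w \<le> Suc R \<and>
      (\<exists>u. w = word_label L (dec (f x)) # u \<and> (u = [] \<or> (\<exists>y. (x, y) \<in> E \<and> u \<in> dec (f y)))))"
proof -
  have fin: "finite (nbrs G x)" using degree[of x] by (auto simp: nbrs_def Image_def)
  have *: "0 < card {y \<in> nbrs G x. f y = j} \<longleftrightarrow> (\<exists>y. (x, y) \<in> E \<and> f y = j)" for j
    using fin by (auto simp: card_gt_0_iff nbrs_def)
  have "(\<exists>j\<in>{1..K}. 0 < (\<lambda>j\<in>{1..K}. card {y \<in> nbrs G x. f y = j}) j \<and> u \<in> dec j) \<longleftrightarrow>
      (\<exists>y. (x, y) \<in> E \<and> u \<in> dec (f y))" for u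
  proof
    assume "\<exists>j\<in>{1..K}. 0 < (\<lambda>j\<in>{1..K}. card {y \<in> nbrs G x. f y = j}) j \<and> u \<in> dec j"
    then obtain j where "j \<in> {1..K}" "0 < card {y \<in> nbrs G x. f y = j}" "u \<in> dec j" by auto
    then show "\<exists>y. (x, y) \<in> E \<and> u \<in> dec (f y)" unfolding * by blast
  next
    assume "\<exists>y. (x, y) \<in> E \<and> u \<in> dec (f y)"
    then obtain y where y: "(x, y) \<in> E" "u \<in> dec (f y)" by blast
    then have "f y \<in> {1..K}" using coloring_range[OF f] E_space by blast
    moreover have "0 < card {z \<in> nbrs G x. f z = f y}" unfolding * using y by blast
    ultimately show "\<exists>j\<in>{1..K}. 0 < (\<lambda>j\<in>{1..K}. card {y \<in> nbrs G x. f y = j}) j \<and> u \<in> dec j"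
      using y(2) by (intro bexI[of _ "f y"]) simp_all
  qed
  then show ?thesis unfolding consistent_star_def star_type_def by simp
qed

text \<open>True claims satisfy the recursion \<open>Cons_in_words\<close>. In \<open>G\<close>,
  where the claims are true, inconsistent stars therefore never occur, and so they are rare wherever
  the star statistics are close.\<close>

lemma consistent_star_words:
  assumes l: "\<And>y. y \<in> space M \<Longrightarrow> l y \<in> L" and f: "f \<in> colorings K G"
    and dec: "\<And>y. y \<in> space M \<Longrightarrow> dec (f y) = words E l R y" and x: "x \<in> space M"
  shows "consistent_star L R dec K (star_type K G f x)"
proof -
  have "L \<noteq> {}" using l x by blast
  moreover have "[l x] \<in> words E l R x" by (simp add: Cons_in_words)
  ultimately have "[word_label L (dec (f x))] \<in> dec (f x)"
    unfolding dec[OF x] using l[OF x] word_label(2) by metis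
  then have lab: "word_label L (dec (f x)) = l x" unfolding dec[OF x] by (simp add: Cons_in_words)
  have "w \<in> words E l R x \<longleftrightarrow> length w \<le> Suc R \<and>
      (\<exists>u. w = l x # u \<and> (u = [] \<or> (\<exists>y. (x, y) \<in> E \<and> u \<in> dec (f y))))" for w
  proof (cases w)
    case (Cons a u)
    \<comment> \<open>A neighbour also claims words of full length \<open>R + 1\<close>. Prolonged
      by one letter these are too long, so exactly its words of length at most \<open>R\<close>
      count.\<close>
    have "u \<in> words E l (R - 1) y \<longleftrightarrow> u \<in> dec (f y) \<and> length u \<le> R" if "(x, y) \<in> E" "0 < R" for y
      using that E_space words_restrict_length[of "R - 1" R E l y] dec by auto
    then have *: "(0 < R \<and> (\<exists>y. (x, y) \<in> E \<and> u \<in> words E l (R - 1) y)) \<longleftrightarrow>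
        length u \<le> R \<and> (\<exists>y. (x, y) \<in> E \<and> u \<in> dec (f y))" if "u \<noteq> []"
      using that by (cases "0 < R") auto
    show ?thesis
    proof (cases "u = []")
      case True
      then show ?thesis unfolding Cons Cons_in_words by simp
    next
      case False
      then show ?thesis unfolding Cons Cons_in_words using *[OF False] by auto
    qed
  qed simp
  then show ?thesis unfolding consistent_star_type[OF f x] dec[OF x] lab[unfolded dec[OF x]] by (rule allI)
qed

text \<open>Consistency at \<open>x\<close> strips off the first letter and hands the rest to the
  claim of a neighbour. A word of at most \<open>n + 1\<close> letters uses up \<open>n\<close>
  steps in this way, so consistency on the \<open>n\<close>-ball decides whether it is really
  read.\<close>

lemma claimed_words_eq:
  assumes g: "g \<in> colorings K G" and x: "x \<in> space M" and "n \<le> R" "length w \<le> Suc n"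
    and good: "\<And>y. y \<in> ball_verts E n x \<Longrightarrow> consistent_star L R dec K (star_type K G g y)"
  shows "w \<in> dec (g x) \<longleftrightarrow> w \<in> words E (\<lambda>y. word_label L (dec (g y))) R x"
  using assms(2-)
proof (induction w arbitrary: x n)
  case Nil
  then have "consistent_star L R dec K (star_type K G g x)" by simp
  then show ?case unfolding consistent_star_type[OF g Nil(1)] by simp
next
  case (Cons a u)
  let ?l = "\<lambda>y. word_label L (dec (g y))"
  have len: "length (a # u) \<le> Suc R" using Cons.prems by simp
  have "consistent_star L R dec K (star_type K G g x)" using Cons.prems by simp
  then have 1: "a # u \<in> dec (g x) \<longleftrightarrow> a = ?l x \<and> (u = [] \<or> (\<exists>y. (x, y) \<in> E \<and> u \<in> dec (g y)))"
    unfolding consistent_star_type[OF g Cons.prems(1)] using len by auto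
  show ?case
  proof (cases "u = []")
    case True
    then show ?thesis unfolding 1 Cons_in_words by simp
  next
    case False
    then obtain m where m: "n = Suc m" using Cons.prems(3) by (cases n) auto
    have "u \<in> dec (g y) \<longleftrightarrow> u \<in> words E ?l (R - 1) y" if y: "(x, y) \<in> E" for y
    proof -
      have "u \<in> dec (g y) \<longleftrightarrow> u \<in> words E ?l R y"
      proof (rule Cons.IH)
        show "y \<in> space M" using E_space y by blast
        show "m \<le> R" "length u \<le> Suc m" using Cons.prems m by auto
        fix z assume "z \<in> ball_verts E m y"
        then have "z \<in> ball_verts E n x" using y unfolding m ball_verts_Suc by blast
        then show "consistent_star L R dec K (star_type K G g z)" by (rule Cons.prems)
      qed
      also have "\<dots> \<longleftrightarrow> u \<in> words E ?l (R - 1) y"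
        using words_restrict_length[of "R - 1" R E ?l y] Cons.prems m by auto
      finally show ?thesis .
    qed
    moreover have "0 < R" using Cons.prems m by simp
    ultimately show ?thesis unfolding 1 Cons_in_words using False by blast
  qed
qed

end

abbreviation star_approx :: "nat \<Rightarrow> nat \<Rightarrow> 'a graphing \<Rightarrow> 'b graphing \<Rightarrow> real \<Rightarrow> bool" where
  "star_approx d k G H e \<equiv> \<forall>f\<in>colorings k G. \<exists>g\<in>colorings k H.
     dTV (stars d k) (star_stat d k G f) (star_stat d k H g) < e"

abbreviation ball_approx :: "nat \<Rightarrow> nat \<Rightarrow> nat \<Rightarrow> 'a graphing \<Rightarrow> 'b graphing \<Rightarrow> real \<Rightarrow> bool" where
  "ball_approx d k r G H e \<equiv> \<forall>f\<in>colorings k G. \<exists>g\<in>colorings k H.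
     dTV (ball_classes d k r) (ball_stat d k r G f) (ball_stat d k r H g) < e"

text \<open>In the constant, 1 compares the words read in \<open>G\<close> with the claims copied to
  \<open>H\<close>. The rest compares the claims in \<open>H\<close> with the words read there: they
  can differ only within \<open>R\<close> steps of an inconsistent vertex, such vertices have
  measure at most \<open>2 * \<delta>\<close>, and mass transport costs the factor
  \<open>(d + 1) ^ R\<close>.\<close>

lemma copy_labelling:
  fixes G :: "'a graphing" and H :: "'b graphing" and L :: "'l set" and \<delta> :: real
  assumes G: "is_graphing d G" and H: "is_graphing d H"
    and L: "finite L" and K: "K = card (Pow (word_set L R))"
    and copy: "star_approx d K G H \<delta>"
    and l: "l \<in> measurable (gmeas G) (count_space L)"
  shows "\<exists>l'\<in>measurable (gmeas H) (count_space L).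
    law_dist (Pow (word_set L R)) (gmeas G) (words (gedges G) l R) (gmeas H) (words (gedges H) l' R) \<le> (1 + 2 * (d + 1) ^ R) * \<delta>"
proof -
  interpret G: bounded_graphing d G by unfold_locales (rule G)
  interpret H: bounded_graphing d H by unfold_locales (rule H)
  let ?W = "Pow (word_set L R)"
  have finW: "finite ?W" using finite_word_set[OF L] by simp
  have lL: "l x \<in> L" if "x \<in> space G.M" for x using measurable_space[OF l that] by simp
  have Lne: "L \<noteq> {}" using G.not_empty lL by (metis all_not_in_conv)
  have "card ?W = card {1..K}" unfolding K by simp
  \<comment> \<open>\<open>K\<close> was chosen as the number of possible claims, so a claim can be
    used as a color.\<close>
  then obtain enc where enc: "bij_betw enc ?W {1..K}"
    using finite_same_card_bij[OF finW finite_atLeastAtMost] by blast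
  define dec where "dec = inv_into ?W enc"
  have dec_enc: "dec (enc W) = W" if "W \<in> ?W" for W
    using enc that by (simp add: dec_def bij_betw_def)
  have dec_in: "dec i \<in> ?W" if "i \<in> {1..K}" for i
    using enc that inv_into_into[of i enc ?W] by (simp add: dec_def bij_betw_def)
  have wm: "words G.E l R \<in> measurable G.M (count_space ?W)"
    by (rule G.words_measurable[OF L l])
  define f where "f x = enc (words G.E l R x)" for x
  have f: "f \<in> colorings K G"
  proof -
    have "enc \<in> measurable (count_space ?W) (count_space {1..K})" using enc by (auto simp: bij_betw_def)
    then show ?thesis unfolding colorings_def f_def using wm by (rule measurable_compose[rotated])
  qed
  have decf: "dec (f x) = words G.E l R x" if "x \<in> space G.M" for x
    unfolding f_def using dec_enc measurable_space[OF wm that] by simp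
  obtain g where g: "g \<in> colorings K H" "dTV (stars d K) (star_stat d K G f) (star_stat d K H g) < \<delta>"
    using copy f by blast
  note sf = G.star_type_measurable[OF f] and sg = H.star_type_measurable[OF g(1)]
  note PP = G.prob_space_axioms H.prob_space_axioms
  let ?l' = "\<lambda>y. word_label L (dec (g y))"
  have l': "?l' \<in> measurable H.M (count_space L)"
  proof -
    have "(\<lambda>i. word_label L (dec i)) \<in> measurable (count_space {1..K}) (count_space L)"
      using word_label(1)[OF Lne] by auto
    then show ?thesis using g(1) unfolding colorings_def by (rule measurable_compose[rotated])
  qed
  note wm' = H.words_measurable[OF L l', of R]
  have dgm: "(\<lambda>y. dec (g y)) \<in> measurable H.M (count_space ?W)"
  proof -
    have "dec \<in> measurable (count_space {1..K}) (count_space ?W)" using dec_in by simp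
    then show ?thesis using g(1) unfolding colorings_def by (rule measurable_compose[rotated])
  qed
  \<comment> \<open>No star of \<open>G\<close> is inconsistent, so closeness of the star statistics
    alone bounds the measure of \<open>bad\<close>.\<close>
  define bad where "bad = {y\<in>space H.M. star_type K H g y \<in> {s. \<not> consistent_star L R dec K s}}"
  have bad: "bad \<in> sets H.M" unfolding bad_def by (rule measurable_count_space_sets[OF sg])
  have emp: "{x\<in>space G.M. star_type K G f x \<in> {s. \<not> consistent_star L R dec K s}} = {}"
    using G.consistent_star_words[OF lL f decf] by blast
  have badm: "measure H.M bad \<le> 2 * \<delta>"
    using prob_diff_le_dTV[OF PP(2,1) sg sf finite_stars, of "{s. \<not> consistent_star L R dec K s}"] g(2)
    unfolding bad_def[symmetric] emp measure_empty star_stat_def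
    by (subst (asm) dTV_commute) linarith
  have eq: "dec (g y) = words H.E ?l' R y" if y: "y \<in> space H.M" "y \<notin> H.reach R bad" for y
  proof -
    have good: "consistent_star L R dec K (star_type K H g z)" if z: "z \<in> ball_verts H.E R y" for z
      using y z H.ball_space[OF y(1)] unfolding H.reach_def bad_def by blast
    have "w \<in> dec (g y) \<longleftrightarrow> w \<in> words H.E ?l' R y" for w
    proof (cases "length w \<le> Suc R")
      case True
      then show ?thesis using H.claimed_words_eq[OF g(1) y(1) order_refl True] good by blast
    next
      case False
      have "dec (g y) \<subseteq> word_set L R" using dec_in[OF H.coloring_range[OF g(1) y(1)]] by simp
      then have "w \<notin> dec (g y)" using False by (auto simp: word_set_def)
      moreover have "w \<notin> words H.E ?l' R y" using False length_words by metis
      ultimately show ?thesis by simp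
    qed
    then show ?thesis by blast
  qed
  let ?wG = "distr G.M (count_space ?W) (words G.E l R)"
  let ?wH = "distr H.M (count_space ?W) (words H.E ?l' R)"
  let ?cH = "distr H.M (count_space ?W) (\<lambda>y. dec (g y))"
  have 1: "dTV ?W ?wG ?cH \<le> \<delta>"
  proof -
    have "law_dist ?W G.M (\<lambda>x. dec (fst (star_type K G f x))) H.M (\<lambda>y. dec (fst (star_type K H g y)))
        \<le> dTV (stars d K) (star_stat d K G f) (star_stat d K H g)"
      unfolding star_stat_def
      using dec_in G.coloring_range[OF f] H.coloring_range[OF g(1)]
      by (intro dTV_distr_compose_le[where \<psi> = "\<lambda>s. dec (fst s)"] PP sf sg finite_stars finW) (simp_all add: star_type_def)
    moreover have "distr G.M (count_space ?W) (\<lambda>x. dec (fst (star_type K G f x))) = distr G.M (count_space ?W) (words G.E l R)"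
      using decf by (intro distr_cong) (simp_all add: star_type_def)
    ultimately show ?thesis using g(2) by (simp add: star_type_def)
  qed
  have 2: "dTV ?W ?cH ?wH \<le> (d + 1) ^ R * (2 * \<delta>)"
  proof -
    have "dTV ?W ?cH ?wH
        \<le> measure H.M {y\<in>space H.M. dec (g y) \<noteq> words H.E ?l' R y}"
      by (rule dTV_distr_same_space[OF PP(2) dgm wm' finW])
    also have "\<dots> \<le> measure H.M (H.reach R bad)"
      using eq by (intro H.finite_measure_mono H.reach_measurable bad) blast
    also have "\<dots> \<le> (d + 1) ^ R * measure H.M bad"
      by (rule H.measure_reach_le[OF bad])
    also have "\<dots> \<le> (d + 1) ^ R * (2 * \<delta>)" using badm by (intro mult_left_mono) auto
    finally show ?thesis .
  qed
  have "dTV ?W ?wG ?wH \<le> \<delta> + (d + 1) ^ R * (2 * \<delta>)"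
    using dTV_triangle[of ?W ?wG
      ?wH ?cH] 1 2
    by linarith
  also have "\<dots> = (1 + 2 * (d + 1) ^ R) * \<delta>" by (simp add: algebra_simps)
  finally show ?thesis using l' by (intro bexI[of _ ?l']) (simp_all add: add.commute)
qed

text \<open>The number of distinct labels on a ball is a bounded function of its word set, so its
  expectation changes little when word laws are close. On the side of the injective \<open>l\<close>
  it is the size of the ball.\<close>

lemma expected_ball_size_le:
  fixes G :: "'a graphing" and H :: "'b graphing" and l :: "'a \<Rightarrow> 'l" and l' :: "'b \<Rightarrow> 'l" and \<eta> :: real
  assumes G: "is_graphing d G" and H: "is_graphing d H" and L: "finite L"
    and l: "l \<in> measurable (gmeas G) (count_space L)" and l': "l' \<in> measurable (gmeas H) (count_space L)"
    and inj: "\<forall>x\<in>space (gmeas G). inj_on l (ball_verts (gedges G) R x)"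
    and close: "law_dist (Pow (word_set L R)) (gmeas G) (words (gedges G) l R) (gmeas H) (words (gedges H) l' R) \<le> \<eta>"
  shows "(LINT x|gmeas G. real (card (ball_verts (gedges G) R x)))
    \<le> (LINT y|gmeas H. real (card (l' ` ball_verts (gedges H) R y))) + 2 * real (card (word_set L R)) * \<eta>"
    and "integrable (gmeas H) (\<lambda>y. real (card (l' ` ball_verts (gedges H) R y)))"
proof -
  interpret G: bounded_graphing d G by unfold_locales (rule G)
  interpret H: bounded_graphing d H by unfold_locales (rule H)
  let ?W = "Pow (word_set L R)"
  let ?h = "\<lambda>W :: 'l list set. real (card (last ` W))"
  have finS: "finite (word_set L R)" by (rule finite_word_set[OF L])
  then have finW: "finite ?W" by simp
  note wl = G.words_measurable[OF L l, of R] and wl' = H.words_measurable[OF L l', of R]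
  have bnd: "\<bar>?h W\<bar> \<le> real (card (word_set L R))" if "W \<in> ?W" for W
  proof -
    have "card (last ` W) \<le> card W" using that finS finite_subset by (intro card_image_le) blast
    also have "\<dots> \<le> card (word_set L R)" using that finS by (intro card_mono) auto
    finally show ?thesis by simp
  qed
  have "(LINT x|G.M. real (card (ball_verts G.E R x))) = (LINT x|G.M. ?h (words G.E l R x))"
    using card_image[OF inj[rule_format]] by (intro Bochner_Integration.integral_cong refl) (simp add: last_words)
  also have "\<dots> \<le> (LINT y|H.M. ?h (words H.E l' R y)) + 2 * real (card (word_set L R)) *
      law_dist ?W G.M (words G.E l R) H.M (words H.E l' R)"
    by (rule integral_diff_le_dTV[OF G.prob_space_axioms H.prob_space_axioms wl wl' finW bnd])
  also have "\<dots> \<le> (LINT y|H.M. ?h (words H.E l' R y)) + 2 * real (card (word_set L R)) * \<eta>"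
    using close by (intro add_left_mono mult_left_mono) auto
  finally show "(LINT x|G.M. real (card (ball_verts G.E R x)))
    \<le> (LINT y|H.M. real (card (l' ` ball_verts H.E R y))) + 2 * real (card (word_set L R)) * \<eta>"
    by (simp add: last_words)
  show "integrable H.M (\<lambda>y. real (card (l' ` ball_verts H.E R y)))"
    using H.integral_finite_valued(1)[OF wl' finW, of ?h] by (simp add: last_words)
qed

lemma (in bounded_graphing) ball_size_integrable: "integrable M (\<lambda>x. real (card (ball_verts E R x)))"
proof (rule integrable_const_bound[where B = "real ((d + 1) ^ R)"])
  have "real (card (ball_verts E R x)) \<le> real ((d + 1) ^ R)" for x using card_ball of_nat_le_iff by blast
  then show "AE x in M. norm (real (card (ball_verts E R x))) \<le> real ((d + 1) ^ R)" by simp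
qed (rule card_ball_measurable)

section \<open>Copying ball statistics from one graphing to another\<close>

definition label_set :: "nat \<Rightarrow> nat \<Rightarrow> nat \<Rightarrow> (nat \<times> nat) set" where
  "label_set d k R = {1..k} \<times> {..(d + 1) ^ (R + R)}"

lemma finite_label_set: "finite (label_set d k R)"
  by (simp add: label_set_def)

lemma const_coloring: "k \<ge> 1 \<Longrightarrow> (\<lambda>_. 1) \<in> colorings k G"
  by (simp add: colorings_def)

text \<open>The label words read in the copy have at most as many end points as the ball has vertices, so
  copying cannot shrink the expected size of a ball. As copies exist in both directions, the sizes
  nearly agree, and hence the copied labels are injective on most balls.\<close>

lemma copy_ball_statistics:
  fixes G :: "'a graphing" and H :: "'b graphing" and \<delta> :: real
  assumes G: "is_graphing d G" and H: "is_graphing d H" and k: "k \<ge> 1"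
    and K: "K = card (Pow (word_set (label_set d k (Suc r)) (Suc r)))"
    and GH: "star_approx d K G H \<delta>"
    and HG: "star_approx d K H G \<delta>"
    and f: "f \<in> colorings k G"
  shows "\<exists>g\<in>colorings k H. dTV (ball_classes d k r) (ball_stat d k r G f) (ball_stat d k r H g)
    \<le> (1 + 4 * card (word_set (label_set d k (Suc r)) (Suc r))) * ((1 + 2 * (real d + 1) ^ Suc r) * \<delta>)"
proof -
  interpret G: bounded_graphing d G by unfold_locales (rule G)
  interpret H: bounded_graphing d H by unfold_locales (rule H)
  note PP = G.prob_space_axioms H.prob_space_axioms
  define R where "R = Suc r"
  define L where "L = label_set d k R"
  define \<eta> where "\<eta> = (1 + 2 * (real d + 1) ^ R) * \<delta>"
  define B where "B = real (card (word_set L R))"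
  have L: "finite L" by (simp add: L_def finite_label_set)
  let ?W = "Pow (word_set L R)"
  have finW: "finite ?W" using finite_word_set[OF L] by simp
  have K': "K = card ?W" unfolding K L_def R_def ..
  obtain l where l: "l \<in> measurable G.M (count_space L)"
    and l_inj: "\<forall>x\<in>space G.M. inj_on l (ball_verts G.E R x)" and l_fst: "\<forall>x. fst (l x) = f x"
    using G.ex_injective_labelling[OF f, of R] unfolding L_def label_set_def by (elim bexE conjE)
  have injl: "inj_on l (ball_verts G.E R x)" if "x \<in> space G.M" for x using l_inj that by (rule bspec)
  have fl: "fst (l x) = f x" for x using l_fst by (rule spec)
  obtain l' where l': "l' \<in> measurable H.M (count_space L)"
    and close: "law_dist ?W G.M (words G.E l R) H.M (words H.E l' R) \<le> \<eta>"
    using copy_labelling[OF G H L K' GH l] unfolding \<eta>_def by (elim bexE)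
  let ?N = "LINT y|H.M. real (card (ball_verts H.E R y))"
  let ?I = "LINT y|H.M. real (card (l' ` ball_verts H.E R y))"
  let ?NG = "LINT x|G.M. real (card (ball_verts G.E R x))"
  have 1: "?NG \<le> ?I + 2 * B * \<eta>" and Lint: "integrable H.M (\<lambda>y. real (card (l' ` ball_verts H.E R y)))"
    using expected_ball_size_le[OF G H L l l' l_inj close] by (simp_all add: B_def)
  \<comment> \<open>The roles are exchanged: an injective labelling of \<open>H\<close> is copied to
    \<open>G\<close>, where it cannot show more labels than vertices. Only sizes matter here, so it
    may refine a constant coloring.\<close>
  have 2: "?N \<le> ?NG + 2 * B * \<eta>"
  proof -
    obtain m where m: "m \<in> measurable H.M (count_space L)"
      and m_inj: "\<forall>x\<in>space H.M. inj_on m (ball_verts H.E R x)"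
      using H.ex_injective_labelling[OF const_coloring[OF k], of R] unfolding L_def label_set_def by (elim bexE conjE)
    obtain m' where m': "m' \<in> measurable G.M (count_space L)"
      and closem: "law_dist ?W H.M (words H.E m R) G.M (words G.E m' R) \<le> \<eta>"
      using copy_labelling[OF H G L K' HG m] unfolding \<eta>_def by (elim bexE)
    have "?N \<le> (LINT x|G.M. real (card (m' ` ball_verts G.E R x))) + 2 * B * \<eta>"
      using expected_ball_size_le(1)[OF H G L m m' m_inj closem] by (simp add: B_def)
    also have "(LINT x|G.M. real (card (m' ` ball_verts G.E R x))) \<le> ?NG"
      using expected_ball_size_le(2)[OF H G L m m' m_inj closem] G.ball_size_integrable
      by (intro integral_mono) (auto intro!: card_image_le G.finite_ball)
    finally show ?thesis by simp
  qed
  \<comment> \<open>Vertices whose ball carries a repeated copied label. There the two sizes differ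
    by at least 1, being integers, so the measure of \<open>bad\<close> is at most the expected
    difference \<open>?N - ?I\<close>, which the two estimates above bound.\<close>
  define bad where "bad = {y\<in>space H.M. real (card (l' ` ball_verts H.E R y)) \<noteq> real (card (ball_verts H.E R y))}"
  have badm: "bad \<in> sets H.M"
    unfolding bad_def using borel_measurable_integrable[OF Lint] H.card_ball_measurable[of R]
    by (intro borel_measurable_neq)
  have bad: "measure H.M bad \<le> 4 * B * \<eta>"
  proof -
    have "measure H.M bad = (LINT y|H.M. indicat_real bad y)"
      using badm sets.sets_into_space[OF badm] by (simp add: Int_absorb2)
    also have "\<dots> \<le> (LINT y|H.M. real (card (ball_verts H.E R y)) - real (card (l' ` ball_verts H.E R y)))"
    proof (rule integral_mono)
      show "integrable H.M (indicat_real bad)"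
        by (rule integrable_real_indicator[OF badm]) (simp add: H.emeasure_eq_measure)
      show "integrable H.M (\<lambda>y. real (card (ball_verts H.E R y)) - real (card (l' ` ball_verts H.E R y)))"
        by (intro Bochner_Integration.integrable_diff Lint H.ball_size_integrable)
      fix y
      have "card (l' ` ball_verts H.E R y) \<le> card (ball_verts H.E R y)"
        by (rule card_image_le[OF H.finite_ball])
      then show "indicat_real bad y \<le> real (card (ball_verts H.E R y)) - real (card (l' ` ball_verts H.E R y))"
        by (auto simp: indicator_def bad_def)
    qed
    also have "\<dots> = ?N - ?I" by (rule Bochner_Integration.integral_diff[OF H.ball_size_integrable Lint])
    also have "\<dots> \<le> 4 * B * \<eta>" using 1 2 by linarith
    finally show ?thesis .
  qed
  have inj': "inj_on l' (ball_verts H.E R y)" if "y \<in> space H.M" "y \<notin> bad" for y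
    using that eq_card_imp_inj_on[OF H.finite_ball, of l' R y] by (simp add: bad_def)
  define g where "g y = fst (l' y)" for y
  have g: "g \<in> colorings k H"
  proof -
    have "fst \<in> measurable (count_space L) (count_space {1..k})" by (auto simp: L_def label_set_def)
    then show ?thesis unfolding colorings_def g_def using l' by (rule measurable_compose[rotated])
  qed
  let ?B = "ball_classes d k r"
  obtain x0 where x0: "x0 \<in> space G.M" using G.not_empty by blast
  define T0 where "T0 = ball_type k r G f x0"
  have T0: "T0 \<in> ?B" unfolding T0_def by (rule G.ball_type_in_ball_classes[OF f x0])
  \<comment> \<open>A word set that comes from no injective labelling may fail to encode a ball; a
    type occurring in \<open>G\<close> then serves as default, so that every value of
    \<open>\<Phi>\<close> is a ball class and the push-forward estimate applies.\<close>
  define \<Phi> where "\<Phi> W = (let T = iso_class k (word_graph fst r W) in if T \<in> ?B then T else T0)"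
    for W :: "(nat \<times> nat) list set"
  have \<Phi>: "\<Phi> W \<in> ?B" for W using T0 by (simp add: \<Phi>_def Let_def)
  note wl = G.words_measurable[OF L l, of R] and wl' = H.words_measurable[OF L l', of R]
  have eqG: "\<Phi> (words G.E l R x) = ball_type k r G f x" if x: "x \<in> space G.M" for x
  proof -
    have "ball_type k r G f x = iso_class k (word_graph fst r (words G.E l R x))"
      using G.ball_type_eq_words[OF injl[OF x, unfolded R_def], of k fst] by (simp add: fl R_def)
    then show ?thesis using G.ball_type_in_ball_classes[OF f x, of r] by (simp add: \<Phi>_def Let_def)
  qed
  have eqH: "\<Phi> (words H.E l' R y) = ball_type k r H g y" if y: "y \<in> space H.M" "y \<notin> bad" for y
  proof -
    have "ball_type k r H g y = iso_class k (word_graph fst r (words H.E l' R y))"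
      using H.ball_type_eq_words[OF inj'[OF y, unfolded R_def], of k fst] unfolding g_def R_def .
    then show ?thesis using H.ball_type_in_ball_classes[OF g y(1), of r] by (simp add: \<Phi>_def Let_def)
  qed
  have \<Phi>m: "(\<lambda>y. \<Phi> (words H.E l' R y)) \<in> measurable H.M (count_space ?B)"
  proof -
    have "\<Phi> \<in> measurable (count_space ?W) (count_space ?B)" using \<Phi> by simp
    then show ?thesis using wl' by (rule measurable_compose[rotated])
  qed
  let ?D = "distr H.M (count_space ?B) (\<lambda>y. \<Phi> (words H.E l' R y))"
  have "dTV ?B (ball_stat d k r G f) ?D \<le> \<eta>"
  proof -
    have "ball_stat d k r G f = distr G.M (count_space ?B) (\<lambda>x. \<Phi> (words G.E l R x))"
      unfolding ball_stat_def using eqG by (intro distr_cong) simp_all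
    moreover have "dTV ?B (distr G.M (count_space ?B) (\<lambda>x. \<Phi> (words G.E l R x))) ?D
      \<le> law_dist ?W G.M (words G.E l R) H.M (words H.E l' R)"
      by (rule dTV_distr_compose_le[OF PP wl wl' finW finite_ball_classes \<Phi> \<Phi>])
    ultimately show ?thesis using close by simp
  qed
  moreover have "dTV ?B ?D (ball_stat d k r H g) \<le> 4 * B * \<eta>"
  proof -
    have "dTV ?B ?D (ball_stat d k r H g) \<le> measure H.M {y\<in>space H.M. \<Phi> (words H.E l' R y) \<noteq> ball_type k r H g y}"
      unfolding ball_stat_def
      by (rule dTV_distr_same_space[OF PP(2) \<Phi>m H.ball_type_measurable[OF g] finite_ball_classes])
    also have "\<dots> \<le> measure H.M bad"
      using eqH by (intro H.finite_measure_mono badm) blast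
    finally show ?thesis using bad by linarith
  qed
  ultimately have "dTV ?B (ball_stat d k r G f) (ball_stat d k r H g) \<le> \<eta> + 4 * B * \<eta>"
    using dTV_triangle[of ?B "ball_stat d k r G f" "ball_stat d k r H g" ?D] by linarith
  also have "\<dots> = (1 + 4 * card (word_set (label_set d k (Suc r)) (Suc r))) * ((1 + 2 * (real d + 1) ^ Suc r) * \<delta>)"
    unfolding B_def \<eta>_def L_def R_def by (simp add: algebra_simps)
  finally show ?thesis using g by blast
qed

section \<open>Convergence of star statistics against convergence of ball statistics\<close>

context bounded_graphing
begin

lemma star_stats_simplex: "k \<ge> 1 \<Longrightarrow> colorings k G \<noteq> {} \<and> star_stat d k G ` colorings k G \<subseteq> prob_simplex (stars d k)"
  using const_coloring[of k G] distr_count_space(1)[OF star_type_measurable] unfolding star_stat_def by blast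

lemma ball_stats_simplex: "k \<ge> 1 \<Longrightarrow> colorings k G \<noteq> {} \<and> ball_stat d k r G ` colorings k G \<subseteq> prob_simplex (ball_classes d k r)"
  using const_coloring[of k G] distr_count_space(1)[OF ball_type_measurable] unfolding ball_stat_def by blast

end

lemma star_stat_dist_le:
  fixes G :: "'a graphing" and H :: "'b graphing"
  assumes G: "is_graphing d G" and H: "is_graphing d H" and f: "f \<in> colorings k G" and g: "g \<in> colorings k H"
  shows "dTV (stars d k) (star_stat d k G f) (star_stat d k H g)
    \<le> dTV (ball_classes d k 1) (ball_stat d k 1 G f) (ball_stat d k 1 H g)"
proof -
  interpret G: bounded_graphing d G by unfold_locales (rule G)
  interpret H: bounded_graphing d H by unfold_locales (rule H)
  note sG = G.star_type_eq_class_star[OF f] and sH = H.star_type_eq_class_star[OF g]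
  have "star_stat d k G f = distr G.M (count_space (stars d k)) (\<lambda>x. class_star k (ball_type k 1 G f x))"
    "star_stat d k H g = distr H.M (count_space (stars d k)) (\<lambda>x. class_star k (ball_type k 1 H g x))"
    unfolding star_stat_def using sG sH by (intro distr_cong; simp)+
  moreover have "law_dist (stars d k) G.M (\<lambda>x. class_star k (ball_type k 1 G f x)) H.M (\<lambda>x. class_star k (ball_type k 1 H g x))
    \<le> dTV (ball_classes d k 1) (ball_stat d k 1 G f) (ball_stat d k 1 H g)"
    unfolding ball_stat_def
  proof (rule dTV_distr_compose_le[OF G.prob_space_axioms H.prob_space_axioms G.ball_type_measurable[OF f]
        H.ball_type_measurable[OF g] finite_ball_classes finite_stars])
    show "class_star k (ball_type k 1 G f x) \<in> stars d k" if "x \<in> space G.M" for x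
      using measurable_space[OF G.star_type_measurable[OF f] that] sG[OF that] by simp
    show "class_star k (ball_type k 1 H g x) \<in> stars d k" if "x \<in> space H.M" for x
      using measurable_space[OF H.star_type_measurable[OF g] that] sH[OF that] by simp
  qed
  ultimately show ?thesis by (simp only:)
qed

theorem theorem2p7:
  fixes d :: nat and G :: "nat \<Rightarrow> 'a graphing"
  assumes "d \<ge> 2"
    and "\<And>n. n \<ge> 1 \<Longrightarrow> is_graphing d (G n)"
  shows "local_global_convergent d G \<longleftrightarrow>
    (\<forall>k\<ge>1. hausdorff_convergent (stars d k) (\<lambda>n. star_stats d k (G n)))"
proof -
  note gr = assms(2)
  have bg: "bounded_graphing d (G n)" if "n \<ge> 1" for n by unfold_locales (rule gr[OF that])
  note star_simplex = bounded_graphing.star_stats_simplex[OF bg] and ball_simplex = bounded_graphing.ball_stats_simplex[OF bg]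
  show ?thesis
    unfolding local_global_convergent_def star_stats_def ball_stats_def
  proof (intro iffI allI impI)
    fix k :: nat
    assume lg: "\<forall>k\<ge>1. \<forall>r. hausdorff_convergent (ball_classes d k r)
      (\<lambda>n. tv_topology (ball_classes d k r) closure_of ball_stat d k r (G n) ` colorings k (G n))"
      and k: "k \<ge> 1"
    show "hausdorff_convergent (stars d k) (\<lambda>n. tv_topology (stars d k) closure_of star_stat d k (G n) ` colorings k (G n))"
    proof (rule hausdorff_convergent_transfer[OF finite_ball_classes finite_stars ball_simplex[OF _ k, of _ 1]
          star_simplex[OF _ k] _ lg[rule_format, OF k, of 1]])
      fix e :: real assume e: "e > 0"
      have "\<exists>g\<in>colorings k (G n). dTV (stars d k) (star_stat d k (G m) f) (star_stat d k (G n) g) < e"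
        if mn: "m \<ge> 1" "n \<ge> 1" and f: "f \<in> colorings k (G m)"
          and copy: "ball_approx d k 1 (G m) (G n) e" for m n f
      proof -
        from copy f obtain g where g: "g \<in> colorings k (G n)"
          "dTV (ball_classes d k 1) (ball_stat d k 1 (G m) f) (ball_stat d k 1 (G n) g) < e" by blast
        show ?thesis
          using star_stat_dist_le[OF gr[OF mn(1)] gr[OF mn(2)] f g(1)] g by (intro bexI[of _ g]) linarith+
      qed
      then show "\<exists>\<delta>>0. \<forall>m\<ge>1. \<forall>n\<ge>1.
        ball_approx d k 1 (G m) (G n) \<delta> \<longrightarrow>
        ball_approx d k 1 (G n) (G m) \<delta> \<longrightarrow>
        star_approx d k (G m) (G n) e"
        using e by (intro exI[of _ e]) simp
    qed
  next
    fix k r :: nat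
    assume st: "\<forall>k\<ge>1. hausdorff_convergent (stars d k)
      (\<lambda>n. tv_topology (stars d k) closure_of star_stat d k (G n) ` colorings k (G n))" and k: "k \<ge> 1"
    let ?W = "word_set (label_set d k (Suc r)) (Suc r)"
    \<comment> \<open>Depends on \<open>d\<close>, \<open>k\<close> and \<open>r\<close> only, so
      the hypothesis for this single number of colors serves all pairs of members.\<close>
    define K where "K = card (Pow ?W)"
    define c where "c = (1 + 4 * real (card ?W)) * (1 + 2 * (real d + 1) ^ Suc r)"
    have c: "c > 0" unfolding c_def by (intro mult_pos_pos add_pos_nonneg) auto
    have K1: "K \<ge> 1"
      unfolding K_def using finite_word_set[OF finite_label_set]
      by (metis Pow_not_empty Suc_leI One_nat_def card_gt_0_iff finite_Pow_iff)
    show "hausdorff_convergent (ball_classes d k r)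
      (\<lambda>n. tv_topology (ball_classes d k r) closure_of ball_stat d k r (G n) ` colorings k (G n))"
    proof (rule hausdorff_convergent_transfer[OF finite_stars finite_ball_classes star_simplex[OF _ K1]
          ball_simplex[OF _ k] _ st[rule_format, OF K1]])
      fix e :: real assume e: "e > 0"
      \<comment> \<open>Copying costs the factor \<open>c\<close>; the 2 makes the resulting bound
        strictly less than \<open>e\<close>.\<close>
      define \<delta> where "\<delta> = e / (2 * c)"
      have \<delta>: "\<delta> > 0" "c * \<delta> < e" using c e by (simp_all add: \<delta>_def)
      have "\<exists>g\<in>colorings k (G n). dTV (ball_classes d k r) (ball_stat d k r (G m) f) (ball_stat d k r (G n) g) < e"
        if mn: "m \<ge> 1" "n \<ge> 1" and f: "f \<in> colorings k (G m)"
          and copy: "star_approx d K (G m) (G n) \<delta>"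
            "star_approx d K (G n) (G m) \<delta>"
        for m n f
      proof -
        obtain g where g: "g \<in> colorings k (G n)" "dTV (ball_classes d k r) (ball_stat d k r (G m) f) (ball_stat d k r (G n) g)
            \<le> (1 + 4 * card ?W) * ((1 + 2 * (real d + 1) ^ Suc r) * \<delta>)"
          using copy_ball_statistics[OF gr[OF mn(1)] gr[OF mn(2)] k K_def copy f] by blast
        have "(1 + 4 * card ?W) * ((1 + 2 * (real d + 1) ^ Suc r) * \<delta>) = c * \<delta>"
          unfolding c_def by (simp only: mult.assoc of_nat_add of_nat_mult of_nat_1 of_nat_numeral)
        then show ?thesis using g \<delta>(2) by (intro bexI[of _ g]) linarith+
      qed
      then show "\<exists>\<delta>>0. \<forall>m\<ge>1. \<forall>n\<ge>1.
        star_approx d K (G m) (G n) \<delta> \<longrightarrow>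
        star_approx d K (G n) (G m) \<delta> \<longrightarrow>
        ball_approx d k r (G m) (G n) e"
        using \<delta>(1) by (intro exI[of _ \<delta>]) simp
    qed
  qed
qed

end
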